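(* For every integer $n\ge 2$ and every $g\in\mathrm{PU}(n,1)$, there exists $h\in\mathrm{PU}(n,1)$ such that $$h^2=g,\qquad \ell_{\mathcal I}(h)\le 3.$$ Moreover, this uniform upper bound is optimal: for every integer $n\ge 2$, $$\sup_{g\in\mathrm{PU}(n,1)}\ \min_{\substack{h\in\mathrm{PU}(n,1)\\ h^2=g}}\ell_{\mathcal I}(h)=3.$$
   Context: Let $V=\mathbb C^{n+1}$ be endowed with a nondegenerate Hermitian form $\langle\cdot,\cdot\rangle$ of signature $(n,1)$ ($n$ positive directions, one negative direction). Let $\mathrm U(n,1)$ be the group of linear automorphisms of $V$ preserving this form, and $\mathrm{PU}(n,1)=\mathrm U(n,1)/\{e^{i\theta}\mathrm I:\theta\in\mathbb R\}$ (the group of holomorphic isometries of complex hyperbolic $n$-space). A holomorphic involution is an element of $\mathcal I=\{I\in\mathrm{PU}(n,1): I^2=1,\ I\ne 1\}$. For $g\in\mathrm{PU}(n,1)$ put $$\ell_{\mathcal I}(g)=\min\{k\ge 0: g=I_1\cdots I_k,\ I_j\in\mathcal I\},$$ where the identity has length $0$ (empty product) and the value is $+\infty$ if no such $k$ exists. *)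

theory Defs
  imports
    "HOL-Algebra.Coset"
    "HOL-Library.Extended_Nat"
    "Jordan_Normal_Form.VS_Connect"
begin

definition hermitian_form :: "nat \<Rightarrow> (complex vec \<Rightarrow> complex vec \<Rightarrow> complex) \<Rightarrow> bool" where
  "hermitian_form m H \<longleftrightarrow>
     (\<forall>u \<in> carrier_vec m. \<forall>v \<in> carrier_vec m. \<forall>w \<in> carrier_vec m. H (u + v) w = H u w + H v w) \<and>
     (\<forall>c. \<forall>u \<in> carrier_vec m. \<forall>v \<in> carrier_vec m. H (c \<cdot>\<^sub>v u) v = c * H u v) \<and>
     (\<forall>u \<in> carrier_vec m. \<forall>v \<in> carrier_vec m. H v u = cnj (H u v))"

definition nondegenerate_form :: "nat \<Rightarrow> (complex vec \<Rightarrow> complex vec \<Rightarrow> complex) \<Rightarrow> bool" where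
  "nondegenerate_form m H \<longleftrightarrow>
     (\<forall>u \<in> carrier_vec m. (\<forall>v \<in> carrier_vec m. H u v = 0) \<longrightarrow> u = 0\<^sub>v m)"

text \<open>Diagonal entries of a Hermitian form are real, so taking the real part loses nothing.
  By Sylvester's law of inertia \<open>p\<close> and \<open>q\<close> do not depend on the choice of \<open>B\<close>.\<close>

definition has_signature ::
    "nat \<Rightarrow> (complex vec \<Rightarrow> complex vec \<Rightarrow> complex) \<Rightarrow> nat \<Rightarrow> nat \<Rightarrow> bool" where
  "has_signature m H p q \<longleftrightarrow>
     (\<exists>B. vectorspace.basis class_ring (module_vec TYPE(complex) m) B \<and>
          (\<forall>b \<in> B. \<forall>c \<in> B. b \<noteq> c \<longrightarrow> H b c = 0) \<and>
          card {b \<in> B. Re (H b b) > 0} = p \<and>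
          card {b \<in> B. Re (H b b) < 0} = q)"

definition unitary_group ::
    "nat \<Rightarrow> (complex vec \<Rightarrow> complex vec \<Rightarrow> complex) \<Rightarrow> complex mat monoid" where
  "unitary_group m H =
     \<lparr>carrier = {A \<in> carrier_mat m m. invertible_mat A \<and>
        (\<forall>u \<in> carrier_vec m. \<forall>v \<in> carrier_vec m. H (A *\<^sub>v u) (A *\<^sub>v v) = H u v)},
      mult = (*), one = 1\<^sub>m m\<rparr>"

definition unit_scalars :: "nat \<Rightarrow> complex mat set" where
  "unit_scalars m = {exp (\<i> * complex_of_real \<theta>) \<cdot>\<^sub>m 1\<^sub>m m | \<theta>. True}"

definition proj_unitary_group ::
    "nat \<Rightarrow> (complex vec \<Rightarrow> complex vec \<Rightarrow> complex) \<Rightarrow> complex mat set monoid" where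
  "proj_unitary_group m H = unitary_group m H Mod unit_scalars m"

definition involutions :: "('a, 'b) monoid_scheme \<Rightarrow> 'a set" where
  "involutions G = {I \<in> carrier G. I [^]\<^bsub>G\<^esub> (2::nat) = \<one>\<^bsub>G\<^esub> \<and> I \<noteq> \<one>\<^bsub>G\<^esub>}"

text \<open>In \<^typ>\<open>enat\<close>, the infimum of a nonempty set is its minimum, and \<open>Inf {} = \<infinity>\<close>.\<close>

definition involution_length :: "('a, 'b) monoid_scheme \<Rightarrow> 'a \<Rightarrow> enat" where
  "involution_length G g =
     Inf {enat (length Is) | Is. set Is \<subseteq> involutions G \<and> g = foldr (mult G) Is \<one>\<^bsub>G\<^esub>}"

end

theory Submission
  imports Defs "HOL-Library.Function_Algebras" "HOL-Computational_Algebra.Fundamental_Theorem_Algebra"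
    "Jordan_Normal_Form.Determinant"
begin

text \<open>\<^emph>\<open>Upper bound.\<close> If \<open>R = h I\<close> with an involution \<open>I\<close>, and an involution \<open>J\<close> inverts \<open>R\<close>, then
  \<open>h = (R J) J I\<close> is a product of three involutions. So for a unitary \<open>g\<close> one looks for a unit scalar \<open>c\<close>,
  a square root \<open>h\<close> of \<open>c g\<close> and an involution \<open>I\<close> such that \<open>h I\<close> is inverted by an involution.

  Split off pairwise orthogonal positive eigenlines of \<open>g\<close> as long as possible (lemma
  \<open>maximal_eigenvector_list\<close>). What remains is a block that contains the negative direction. By lemma
  \<open>isometry_normal_form\<close> it is a negative line, a hyperbolic plane on which \<open>g\<close> is loxodromic or parabolic, or
  a three-dimensional space on which \<open>g\<close> is a scalar times a unipotent map with a single Jordan block.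

  On two positive eigenlines, \<open>h\<close> acts by numbers \<open>a, b\<close> whose squares are given but whose signs are free. When
  \<open>I\<close> runs over the reflections of the plane, \<open>h I\<close> can be given an eigenvalue \<open>r\<close> prescribed in advance,
  provided that one of the two signs of \<open>b\<close> is chosen correctly (lemma \<open>positive_plane\<close>). Therefore the
  eigenvalues of \<open>h I\<close> can be made to match in a chain: a loose eigenvalue \<open>r\<close> is matched with an eigenvalue
  \<open>cnj r\<close> in the next plane, the other eigenvalue \<open>s\<close> of this plane becomes the loose one, and so on. The
  involution \<open>J\<close> swaps matched eigenvectors. Determinants decide whether the last loose eigenvalue fits: up to
  signs, which do no harm, the condition is \<open>det (c g) = 1\<close> (lemma \<open>reversible_chain\<close>).

  It remains to start the chain on the block, with \<open>h I\<close> equal to a reversible map times a complex reflection in a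
  positive vector. On a plane it suffices that \<open>\<langle>h w, w\<rangle>\<close> is real for some negative vector \<open>w\<close>: if \<open>I\<close> swaps
  \<open>h w\<close> and \<open>w\<close>, then \<open>h I\<close> fixes \<open>h w\<close> (lemma \<open>plane_block\<close>). In dimension three one takes an isotropic
  \<open>w\<close> with \<open>\<langle>h w, w\<rangle>\<close> real and nonzero and makes \<open>h w\<close> an eigenvector of \<open>h I\<close> for the eigenvalue 2
  (lemma \<open>three_block\<close>). A negative line is first enlarged by a positive eigenline with a different
  eigenvalue; if there is none, \<open>g\<close> is a scalar and \<open>h\<close> can be the identity. In every case a suitable \<open>w\<close> exists as soon as \<open>Re (c z) < 0\<close> for a certain
  \<open>z \<noteq> 0\<close> that depends only on \<open>g\<close>. The solutions \<open>c\<close> of \<open>det (c g) = 1\<close> are the vertices of a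
  regular polygon with \<open>n + 1 \<ge> 3\<close> vertices, and such a polygon meets every open half-plane bounded by a line
  through its centre (lemma \<open>rotation_choice\<close>).

  \<^emph>\<open>Lower bound.\<close> Let \<open>g\<close> be the class of a complex reflection \<open>G\<close> of order 4 in a positive vector. If a
  square root of \<open>g\<close> were a product \<open>A B\<close> of two elements with trivial square, then \<open>A\<close> would conjugate
  \<open>G\<close> to a scalar multiple of its inverse. A negative vector fixed by \<open>G\<close> forces the scalar to be 1, but \<open>G\<close>
  has the eigenvalue \<open>\<i>\<close> and not \<open>- \<i>\<close> (lemma \<open>quarter_turn_not_inverted\<close>).\<close>

section \<open>Hermitian forms, isometries and complex reflections\<close>

text \<open>The form is defined on a whole type and may be degenerate there; the spaces of interest will be subspaces on which
  it is nondegenerate. In this way complex reflections are total maps, and the identities between them hold without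
  membership conditions.\<close>

locale hermitian_space = vector_space scale
  for scale :: "complex \<Rightarrow> 'a::ab_group_add \<Rightarrow> 'a" (infixr "*s" 75) +
  fixes H :: "'a \<Rightarrow> 'a \<Rightarrow> complex"
  assumes H_add_left: "H (u + v) w = H u w + H v w"
    and H_scale_left: "H (c *s u) v = c * H u v"
    and H_sym: "H v u = cnj (H u v)"
begin

lemma H_add_right: "H w (u + v) = H w u + H w v"
  by (metis H_sym H_add_left complex_cnj_add)

lemma H_scale_right: "H v (c *s u) = cnj c * H v u"
  by (metis H_sym H_scale_left complex_cnj_mult)

lemma H_zero_left [simp]: "H 0 v = 0"
  using H_scale_left[of 0 0 v] by simp

lemma H_zero_right [simp]: "H v 0 = 0"
  by (metis H_sym H_zero_left complex_cnj_zero)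

lemma H_minus_left: "H (- u) v = - H u v"
  using H_add_left[of u "- u" v] by (simp add: add_eq_0_iff)

lemma H_minus_right: "H v (- u) = - H v u"
  by (metis H_sym H_minus_left complex_cnj_minus)

lemma H_diff_left: "H (u - v) w = H u w - H v w"
  using H_add_left[of u "- v" w] by (simp add: H_minus_left)

lemma H_diff_right: "H w (u - v) = H w u - H w v"
  using H_add_right[of w u "- v"] by (simp add: H_minus_right)

lemma H_sum_left: "H (sum f A) v = (\<Sum>a\<in>A. H (f a) v)"
  by (induction A rule: infinite_finite_induct) (auto simp: H_add_left)

lemma H_sum_right: "H v (sum f A) = (\<Sum>a\<in>A. H v (f a))"
  by (induction A rule: infinite_finite_induct) (auto simp: H_add_right)

lemmas H_simps = H_add_left H_add_right H_scale_left H_scale_right H_diff_left H_diff_right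
  H_minus_left H_minus_right

lemma H_self_real: "cnj (H u u) = H u u"
  using H_sym[of u u] by simp

lemma H_self_of_real: "H u u = of_real (Re (H u u))"
  using H_self_real[of u] by (simp add: complex_eq_iff)

lemma H_zero_commute: "H u v = 0 \<longleftrightarrow> H v u = 0"
  by (metis H_sym complex_cnj_zero)

lemma orthogonal_independent:
  assumes "\<And>a. a \<in> S \<Longrightarrow> H a a \<noteq> 0" "\<And>a b. a \<in> S \<Longrightarrow> b \<in> S \<Longrightarrow> a \<noteq> b \<Longrightarrow> H a b = 0"
  shows "independent S"
  unfolding dependent_def
proof (rule notI, elim bexE)
  fix a assume a: "a \<in> S" "a \<in> span (S - {a})"
  have "subspace {x. H x a = 0}" by (auto simp: subspace_def H_simps)
  moreover have "S - {a} \<subseteq> {x. H x a = 0}" using assms(2) a by auto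
  ultimately have "H a a = 0" using a(2) span_minimal by blast
  with assms(1) a show False by blast
qed

definition linear_op :: "('a \<Rightarrow> 'a) \<Rightarrow> bool" where
  "linear_op T \<longleftrightarrow> (\<forall>u v. T (u + v) = T u + T v) \<and> (\<forall>c u. T (c *s u) = c *s T u)"

definition isometry :: "('a \<Rightarrow> 'a) \<Rightarrow> bool" where
  "isometry T \<longleftrightarrow> linear_op T \<and> (\<forall>u v. H (T u) (T v) = H u v)"

text \<open>The complex reflection with multiplier \<open>\<zeta>\<close> in a nonisotropic vector \<open>u\<close>.\<close>

definition crefl :: "'a \<Rightarrow> complex \<Rightarrow> 'a \<Rightarrow> 'a" where
  "crefl u \<zeta> x = x + ((\<zeta> - 1) * H x u / H u u) *s u"

text \<open>The reflection that exchanges two vectors of equal norm and real product. Equal vectors are allowed, because the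
  vectors to be swapped come out of constructions in which they may coincide.\<close>

definition swap_op :: "'a \<Rightarrow> 'a \<Rightarrow> 'a \<Rightarrow> 'a" where
  "swap_op v w = (if v = w then id else crefl (v - w) (-1))"

lemma linear_op_add: "linear_op T \<Longrightarrow> T (u + v) = T u + T v"
  and linear_op_scale: "linear_op T \<Longrightarrow> T (c *s u) = c *s T u"
  by (auto simp: linear_op_def)

lemma linear_op_zero: "linear_op T \<Longrightarrow> T 0 = 0"
  using linear_op_scale[of T 0 0] by simp

lemma linear_op_minus: "linear_op T \<Longrightarrow> T (- u) = - T u"
  using linear_op_add[of T u "- u"] linear_op_zero[of T] by (simp add: add_eq_0_iff)

lemma linear_op_diff: "linear_op T \<Longrightarrow> T (u - v) = T u - T v"
  using linear_op_add[of T u "- v"] by (simp add: linear_op_minus)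

lemma linear_op_sum: "linear_op T \<Longrightarrow> T (sum f A) = (\<Sum>a\<in>A. T (f a))"
  by (induction A rule: infinite_finite_induct) (auto simp: linear_op_zero linear_op_add)

lemma linear_op_comp: "linear_op S \<Longrightarrow> linear_op T \<Longrightarrow> linear_op (S \<circ> T)"
  by (auto simp: linear_op_def)

lemma linear_op_id: "linear_op id"
  by (auto simp: linear_op_def)

lemma isometry_linear: "isometry T \<Longrightarrow> linear_op T"
  and isometry_H: "isometry T \<Longrightarrow> H (T u) (T v) = H u v"
  by (auto simp: isometry_def)

lemmas linear_op_simps = linear_op_add linear_op_scale linear_op_zero linear_op_minus linear_op_diff

lemma isometry_comp: "isometry S \<Longrightarrow> isometry T \<Longrightarrow> isometry (S \<circ> T)"
  by (auto simp: isometry_def linear_op_comp)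

lemma isometry_id: "isometry id"
  by (auto simp: isometry_def linear_op_id)

lemma linear_op_crefl: "linear_op (crefl u \<zeta>)"
  by (auto simp: linear_op_def crefl_def H_simps ring_distribs add_divide_distrib
      scale_left_distrib scale_right_distrib)

lemma crefl_self: "H u u \<noteq> 0 \<Longrightarrow> crefl u \<zeta> u = \<zeta> *s u"
  by (simp add: crefl_def scale_left_diff_distrib)

lemma crefl_orth: "H x u = 0 \<Longrightarrow> crefl u \<zeta> x = x"
  by (simp add: crefl_def)

lemma crefl_one: "crefl u 1 = id"
  by (auto simp: crefl_def)

lemma H_crefl: "H u u \<noteq> 0 \<Longrightarrow> H (crefl u \<zeta> x) u = \<zeta> * H x u"
  by (simp add: crefl_def H_simps field_simps)

lemma crefl_crefl: "H u u \<noteq> 0 \<Longrightarrow> crefl u \<zeta> (crefl u \<xi> x) = crefl u (\<zeta> * \<xi>) x"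
  unfolding crefl_def[of u \<zeta> "crefl u \<xi> x"] H_crefl
  by (simp add: crefl_def add.assoc flip: scale_left_distrib add_divide_distrib) (simp add: algebra_simps)

lemma crefl_involutive: "H u u \<noteq> 0 \<Longrightarrow> crefl u (-1) \<circ> crefl u (-1) = id"
  by (auto simp: fun_eq_iff crefl_crefl crefl_one)

lemma isometry_crefl:
  assumes "H u u \<noteq> 0" "\<zeta> * cnj \<zeta> = 1"
  shows "isometry (crefl u \<zeta>)"
proof -
  have "H (crefl u \<zeta> x) (crefl u \<zeta> y) = H x y" for x y
  proof -
    have r: "cnj (H u u) = H u u" by (rule H_self_real)
    have s: "H u y = cnj (H y u)" by (rule H_sym)
    have "H (crefl u \<zeta> x) (crefl u \<zeta> y)
        = H x y + ((\<zeta> - 1) + cnj (\<zeta> - 1) + (\<zeta> - 1) * cnj (\<zeta> - 1)) * (H x u * cnj (H y u)) / H u u"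
      using assms(1) by (simp add: crefl_def H_simps s r field_simps)
    also have "(\<zeta> - 1) + cnj (\<zeta> - 1) + (\<zeta> - 1) * cnj (\<zeta> - 1) = 0"
      using assms(2) by (simp add: algebra_simps)
    finally show ?thesis by simp
  qed
  then show ?thesis by (auto simp: isometry_def linear_op_crefl)
qed

text \<open>Commutation of operators with orthogonal supports is always derived from this lemma: a reflection commutes with
  every isometry that fixes its vector.\<close>

lemma isometry_crefl_conj:
  "isometry T \<Longrightarrow> T (crefl u \<zeta> x) = crefl (T u) \<zeta> (T x)"
  by (auto simp: crefl_def isometry_H linear_op_simps dest: isometry_linear)

lemma isometry_swap_op:
  assumes "v \<noteq> w \<Longrightarrow> H (v - w) (v - w) \<noteq> 0"
  shows "isometry (swap_op v w)"
  using assms by (auto simp: swap_op_def isometry_id isometry_crefl)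

lemma swap_op_involutive:
  assumes "v \<noteq> w \<Longrightarrow> H (v - w) (v - w) \<noteq> 0"
  shows "swap_op v w \<circ> swap_op v w = id"
  using assms by (auto simp: swap_op_def crefl_involutive)

lemma swap_op_orth: "H x v = 0 \<Longrightarrow> H x w = 0 \<Longrightarrow> swap_op v w x = x"
  by (auto simp: swap_op_def crefl_orth H_simps)

lemma isometry_swap_op_conj:
  "isometry T \<Longrightarrow> T v = v \<Longrightarrow> T w = w \<Longrightarrow> T (swap_op v w x) = swap_op v w (T x)"
  using isometry_crefl_conj[of T "v - w" "-1" x]
  by (auto simp: swap_op_def linear_op_diff dest: isometry_linear)

lemma swap_op_left:
  assumes "H v v = H w w" "H v w = H w v" "v \<noteq> w \<Longrightarrow> H (v - w) (v - w) \<noteq> 0"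
  shows "swap_op v w v = w"
proof (cases "v = w")
  case False
  have e: "H (v - w) (v - w) = 2 * H v (v - w)"
    using assms(1,2) by (simp add: H_simps)
  with assms(3) False have "H v (v - w) \<noteq> 0" by auto
  then have "(- 1 - 1) * H v (v - w) / H (v - w) (v - w) = -1" unfolding e by simp
  then have "swap_op v w v = v + (-1) *s (v - w)"
    using False by (simp add: swap_op_def crefl_def)
  then show ?thesis by (simp add: scale_minus_left)
qed (simp add: swap_op_def)

lemma swap_op_right:
  assumes "H v v = H w w" "H v w = H w v" "v \<noteq> w \<Longrightarrow> H (v - w) (v - w) \<noteq> 0"
  shows "swap_op v w w = v"
  using swap_op_left[OF assms] swap_op_involutive[OF assms(3)] by (metis comp_apply id_apply)

end

section \<open>Lorentzian spaces and eigenvectors of isometries\<close>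

text \<open>Signature \<open>(n, 1)\<close>, stated without a basis: one negative vector whose orthogonal complement is positive definite.\<close>

locale lorentz_space = hermitian_space scale H
  for scale :: "complex \<Rightarrow> 'a::ab_group_add \<Rightarrow> 'a" (infixr "*s" 75) and H +
  fixes V :: "'a set" and e0 :: 'a
  assumes subspace_V: "subspace V"
    and finite_dimensional: "\<exists>B. finite B \<and> V \<subseteq> span B"
    and e0_in_V: "e0 \<in> V"
    and e0_negative: "Re (H e0 e0) < 0"
    and positive_on_e0_perp: "\<And>u. u \<in> V \<Longrightarrow> H u e0 = 0 \<Longrightarrow> u \<noteq> 0 \<Longrightarrow> Re (H u u) > 0"
begin

lemma V_closed [intro]: "u \<in> V \<Longrightarrow> v \<in> V \<Longrightarrow> u + v \<in> V" "u \<in> V \<Longrightarrow> c *s u \<in> V"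
  "u \<in> V \<Longrightarrow> v \<in> V \<Longrightarrow> u - v \<in> V" "0 \<in> V"
  using subspace_V by (auto intro: subspace_add subspace_scale subspace_diff subspace_0)

definition preserves :: "('a \<Rightarrow> 'a) \<Rightarrow> bool" where
  "preserves T \<longleftrightarrow> (\<forall>v\<in>V. T v \<in> V)"

definition orthonormal :: "'a list \<Rightarrow> bool" where
  "orthonormal es \<longleftrightarrow> distinct es \<and> set es \<subseteq> V \<and> (\<forall>e\<in>set es. H e e = 1) \<and>
     (\<forall>e\<in>set es. \<forall>e'\<in>set es. e \<noteq> e' \<longrightarrow> H e e' = 0)"

definition perp :: "'a list \<Rightarrow> 'a set" where
  "perp es = {u\<in>V. \<forall>e\<in>set es. H u e = 0}"

lemma subspace_perp: "subspace (perp es)"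
  by (auto simp: subspace_def perp_def H_simps V_closed)

text \<open>A subspace on which the form is nonpositive has dimension at most one, since it meets the complement of \<open>e0\<close>
  only in 0. The signature enters the arguments below through this lemma.\<close>

lemma nonpositive_orth_dependent:
  assumes "u \<in> V" "w \<in> V" "Re (H u u) \<le> 0" "Re (H w w) \<le> 0" "H u w = 0"
  shows "\<exists>a b. (a \<noteq> 0 \<or> b \<noteq> 0) \<and> a *s u + b *s w = 0"
proof (cases "H w e0 = 0 \<and> H u e0 = 0")
  case True
  then have "u = 0" using positive_on_e0_perp[of u] assms by force
  then have "1 *s u + 0 *s w = 0" by simp
  then show ?thesis by (metis zero_neq_one)
next
  case False
  define t where "t = H w e0 *s u + (- H u e0) *s w"
  have "t \<in> V" unfolding t_def using assms by blast
  moreover have "H t e0 = 0" by (simp add: t_def H_simps)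
  moreover have "Re (H t t) \<le> 0"
  proof -
    have wu: "H w u = 0" using assms(5) H_zero_commute by blast
    have "H t t = (H w e0 * cnj (H w e0)) * H u u + (H u e0 * cnj (H u e0)) * H w w"
      unfolding t_def H_simps assms(5) wu by (simp add: algebra_simps)
    also have "\<dots> = of_real ((cmod (H w e0))\<^sup>2 * Re (H u u) + (cmod (H u e0))\<^sup>2 * Re (H w w))"
      by (simp only: complex_norm_square[symmetric] of_real_add of_real_mult H_self_of_real[symmetric])
    finally show ?thesis using assms by (simp add: mult_nonneg_nonpos add_nonpos_nonpos)
  qed
  ultimately have "t = 0" using positive_on_e0_perp[of t] by force
  then show ?thesis unfolding t_def using False by (metis neg_equal_0_iff_equal)
qed

lemma positive_on_negative_perp:
  assumes "v \<in> V" "Re (H v v) < 0" "u \<in> V" "H u v = 0" "u \<noteq> 0"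
  shows "Re (H u u) > 0"
proof (rule ccontr)
  assume "\<not> Re (H u u) > 0"
  then obtain a b where ab: "a \<noteq> 0 \<or> b \<noteq> 0" "a *s u + b *s v = 0"
    using nonpositive_orth_dependent[of u v] assms by auto
  have "H (a *s u + b *s v) v = 0" using ab(2) by simp
  then have "b = 0" using assms by (auto simp: H_simps)
  with ab assms show False by simp
qed

lemma positive_on_isotropic_perp:
  assumes "x \<in> V" "H x x = 0" "x \<noteq> 0" "u \<in> V" "H u x = 0" "u \<notin> span {x}"
  shows "Re (H u u) > 0"
proof (rule ccontr)
  assume "\<not> Re (H u u) > 0"
  then obtain a b where ab: "a \<noteq> 0 \<or> b \<noteq> 0" "a *s u + b *s x = 0"
    using nonpositive_orth_dependent[of u x] assms by auto
  have "a \<noteq> 0" using ab assms(3) by auto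
  then have "u = (- b / a) *s x"
    using ab(2) by (metis (no_types, opaque_lifting) add_eq_0_iff2 divide_inverse_commute scale_minus_left scale_one scale_scale left_inverse)
  with assms(6) show False by (metis span_base span_scale singletonI)
qed

lemma unit_multiple:
  assumes "Re (H u u) > 0"
  shows "\<exists>c. c \<noteq> 0 \<and> H (c *s u) (c *s u) = 1"
proof -
  define r where "r = Re (H u u)"
  have "H u u = of_real r" using H_self_of_real[of u] r_def by simp
  then have "H (of_real (1 / sqrt r) *s u) (of_real (1 / sqrt r) *s u) = of_real ((1 / sqrt r) * (1 / sqrt r) * r)"
    by (simp only: H_simps complex_cnj_complex_of_real of_real_mult mult.assoc)
  also have "(1 / sqrt r) * (1 / sqrt r) * r = 1" using assms r_def by (simp add: field_simps)
  finally show ?thesis using assms r_def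
    by (intro exI[of _ "of_real (1 / sqrt r)"]) auto
qed

lemma orthonormal_length_bounded: "\<exists>K. \<forall>es. orthonormal es \<longrightarrow> length es \<le> K"
proof -
  obtain B where B: "finite B" "V \<subseteq> span B" using finite_dimensional by blast
  have "length es \<le> card B" if es: "orthonormal es" for es
  proof -
    have "independent (set es)"
      by (rule orthogonal_independent) (use es in \<open>auto simp: orthonormal_def\<close>)
    moreover have "set es \<subseteq> span B" using es B by (auto simp: orthonormal_def)
    ultimately have "card (set es) \<le> card B" using independent_span_bound[of B "set es"] B by auto
    then show ?thesis using es by (simp add: orthonormal_def distinct_card)
  qed
  then show ?thesis by blast
qed

text \<open>\<open>poly_op N g p\<close> is the value of the polynomial \<open>p\<close> at \<open>g\<close> if \<open>degree p < N\<close>. A fixed number of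
  summands makes it visibly linear in \<open>p\<close>.\<close>

definition poly_op :: "nat \<Rightarrow> ('a \<Rightarrow> 'a) \<Rightarrow> complex poly \<Rightarrow> 'a \<Rightarrow> 'a" where
  "poly_op N g p w = (\<Sum>i<N. coeff p i *s (g ^^ i) w)"

lemma poly_op_in: 
  assumes "subspace W" "\<And>v. v \<in> W \<Longrightarrow> g v \<in> W" "w \<in> W"
  shows "poly_op N g p w \<in> W"
proof -
  have "(g ^^ i) w \<in> W" for i by (induction i) (auto simp: assms)
  then show ?thesis unfolding poly_op_def using assms(1)
    by (intro subspace_sum) (auto intro: subspace_scale)
qed

lemma poly_op_linear_factor:
  assumes "linear_op g" "degree q < N"
  shows "poly_op (Suc N) g ([:-l, 1:] * q) w = g (poly_op (Suc N) g q w) - l *s poly_op (Suc N) g q w"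
proof -
  have c0: "coeff q N = 0" using assms(2) by (simp add: coeff_eq_0)
  have "coeff ([:-l, 1:] * q) i = coeff (pCons 0 q) i - l * coeff q i" for i by simp
  then have "poly_op (Suc N) g ([:-l, 1:] * q) w
      = poly_op (Suc N) g (pCons 0 q) w - l *s poly_op (Suc N) g q w"
    by (simp only: poly_op_def scale_left_diff_distrib sum_subtractf scale_sum_right scale_scale)
  also have "poly_op (Suc N) g (pCons 0 q) w = (\<Sum>i<N. coeff q i *s (g ^^ Suc i) w)"
    unfolding poly_op_def by (subst sum.lessThan_Suc_shift) simp
  also have "\<dots> = g (poly_op (Suc N) g q w)"
    using assms(1) c0 by (simp add: poly_op_def linear_op_sum linear_op_add linear_op_scale)
  finally show ?thesis .
qed

text \<open>An eigenvector of the map induced on the quotient by \<open>S\<close>. Among the nonzero polynomials \<open>p\<close> with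
  \<open>p(g) w \<in> S\<close>, which exist because the powers \<open>g^i w\<close> are dependent, take one of least degree and
  split off a root \<open>l\<close>: the cofactor applied to \<open>w\<close> lies outside \<open>S\<close> by minimality.\<close>

lemma eigenvector_modulo:
  assumes lin: "linear_op g" and W: "subspace W" "W \<subseteq> V" "\<And>v. v \<in> W \<Longrightarrow> g v \<in> W"
    and S: "subspace S" and w: "w \<in> W" "w \<notin> S"
  shows "\<exists>u l. u \<in> W \<and> u \<notin> S \<and> g u - l *s u \<in> S"
proof -
  obtain B where B: "finite B" "V \<subseteq> span B" using finite_dimensional by blast
  define K where "K = card B"
  let ?P = "\<lambda>p. p \<noteq> 0 \<and> degree p \<le> K \<and> poly_op (Suc K) g p w \<in> S"
  have gi: "(g ^^ i) w \<in> span B" for i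
  proof -
    have "(g ^^ i) w \<in> W" by (induction i) (auto simp: W w)
    then show ?thesis using W B by blast
  qed
  have "\<exists>p. ?P p"
  proof (cases "inj_on (\<lambda>i. (g ^^ i) w) {..K}")
    case True
    let ?A = "(\<lambda>i. (g ^^ i) w) ` {..K}"
    have "dependent ?A"
    proof (rule ccontr)
      assume "independent ?A"
      then have "card ?A \<le> card B" using independent_span_bound[of B ?A] B gi by blast
      then show False using True by (simp add: card_image K_def)
    qed
    then obtain u where u: "(\<Sum>v\<in>?A. u v *s v) = 0" "\<exists>v\<in>?A. u v \<noteq> 0"
      using dependent_finite[of ?A] by auto
    define p where "p = (\<Sum>i\<le>K. monom (u ((g ^^ i) w)) i)"
    have cp: "coeff p i = (if i \<le> K then u ((g ^^ i) w) else 0)" for i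
      by (auto simp: p_def coeff_sum)
    have "poly_op (Suc K) g p w = (\<Sum>i\<le>K. u ((g ^^ i) w) *s (g ^^ i) w)"
      by (simp add: poly_op_def cp lessThan_Suc_atMost)
    also have "\<dots> = 0" using u(1) True by (simp add: sum.reindex)
    finally have "poly_op (Suc K) g p w \<in> S" using S by (simp add: subspace_0)
    moreover have "p \<noteq> 0" using u(2) cp by (metis (no_types, lifting) atMost_iff coeff_0 image_iff)
    moreover have "degree p \<le> K" by (rule degree_le) (simp add: cp)
    ultimately show ?thesis by blast
  next
    case False
    then obtain i j where ij: "i \<le> K" "j \<le> K" "i < j" "(g ^^ i) w = (g ^^ j) w"
      unfolding inj_on_def by (metis atMost_iff linorder_neqE_nat)
    define p :: "complex poly" where "p = monom 1 j - monom 1 i"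
    have cp: "coeff p k = (if k = j then 1 else 0) - (if k = i then 1 else 0)" for k
      by (auto simp: p_def)
    have "poly_op (Suc K) g p w = (\<Sum>k<Suc K. (if k = j then (g ^^ j) w else 0) - (if k = i then (g ^^ i) w else 0))"
      unfolding poly_op_def by (rule sum.cong) (auto simp: cp scale_left_diff_distrib)
    also have "\<dots> = 0" using ij by (subst sum_subtractf) auto
    finally have "poly_op (Suc K) g p w \<in> S" using S by (simp add: subspace_0)
    moreover have "coeff p j = 1" using ij by (simp add: cp)
    then have "p \<noteq> 0" by auto
    moreover have "degree p \<le> K" by (rule degree_le) (use ij in \<open>auto simp: cp\<close>)
    ultimately show ?thesis by blast
  qed
  then obtain p where p: "?P p" and min: "\<And>q. ?P q \<Longrightarrow> degree p \<le> degree q"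
    using ex_has_least_nat[of ?P _ degree] by blast
  have "degree p \<noteq> 0"
  proof
    assume "degree p = 0"
    then obtain c where c: "p = [:c:]" by (meson degree_eq_zeroE)
    have "poly_op (Suc K) g p w = c *s w"
      unfolding poly_op_def by (subst sum.lessThan_Suc_shift) (simp add: c)
    moreover have "c \<noteq> 0" using p c by auto
    ultimately show False
      using subspace_scale[OF S, of "c *s w" "inverse c"] p w by simp
  qed
  then obtain l where "poly p l = 0"
    using fundamental_theorem_of_algebra constant_degree by metis
  then obtain q where q: "p = [:-l, 1:] * q" by (metis dvd_def poly_eq_0_iff_dvd)
  have "q \<noteq> 0" using p q by auto
  have dp: "degree p = Suc (degree q)" using degree_mult_eq[of "[:-l, 1:]" q] \<open>q \<noteq> 0\<close> by (simp add: q del: mult_pCons_left)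
  define u where "u = poly_op (Suc K) g q w"
  have "g u - l *s u \<in> S"
    using poly_op_linear_factor[OF lin, of q K l w] p dp q unfolding u_def by simp
  moreover have "u \<in> W" unfolding u_def by (rule poly_op_in) (use W w in auto)
  moreover have "u \<notin> S" using min[of q] dp p \<open>q \<noteq> 0\<close> unfolding u_def by fastforce
  ultimately show ?thesis by blast
qed

lemma eigenvector_exists:
  assumes "linear_op g" "subspace W" "W \<subseteq> V" "\<And>v. v \<in> W \<Longrightarrow> g v \<in> W" "w \<in> W" "w \<noteq> 0"
  shows "\<exists>u l. u \<in> W \<and> u \<noteq> 0 \<and> g u = l *s u"
  using eigenvector_modulo[of g W "{0}" w] assms by (auto simp: subspace_def)

lemma eigenvalue_unimodular:
  assumes "isometry g" "g u = l *s u" "H u u \<noteq> 0"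
  shows "l * cnj l = 1"
proof -
  have "H (g u) (g u) = l * cnj l * H u u" unfolding assms(2) by (simp add: H_simps)
  then show ?thesis using assms isometry_H[of g u u] by simp
qed

lemma eigenvector_perp_invariant:
  assumes "isometry g" "preserves g" "\<forall>e\<in>set es. H e e \<noteq> 0 \<and> (\<exists>l. g e = l *s e)" "v \<in> perp es"
  shows "g v \<in> perp es"
proof -
  have "H (g v) e = 0" if e: "e \<in> set es" for e
  proof -
    obtain l where l: "g e = l *s e" "l * cnj l = 1" using assms e eigenvalue_unimodular by blast
    have "cnj l * H (g v) e = H (g v) (g e)" by (simp add: l H_simps)
    also have "\<dots> = 0" using assms e by (auto simp: isometry_H perp_def)
    finally show ?thesis using l(2) by auto
  qed
  then show ?thesis using assms by (auto simp: perp_def preserves_def)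
qed

end

section \<open>Normal forms of isometries\<close>

context lorentz_space
begin

lemma perp_subset: "perp es \<subseteq> V" by (auto simp: perp_def)

lemma linear_op_eq_on_span:
  assumes "linear_op A" "linear_op B" "\<And>s. s \<in> S \<Longrightarrow> A s = B s" "w \<in> span S"
  shows "A w = B w"
proof -
  have "span S \<subseteq> {w. A w = B w}"
    by (rule span_minimal) (use assms in \<open>auto simp: subspace_def linear_op_simps\<close>)
  then show ?thesis using assms by blast
qed

lemma minus_projection_in_perp:
  assumes "orthonormal es" "v \<in> V"
  shows "v - (\<Sum>e\<in>set es. H v e *s e) \<in> perp es"
proof -
  have "H (v - (\<Sum>e\<in>set es. H v e *s e)) e' = 0" if e': "e' \<in> set es" for e'
  proof -
    have "H (\<Sum>e\<in>set es. H v e *s e) e' = (\<Sum>e\<in>set es. if e = e' then H v e' else 0)"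
      unfolding H_sum_left by (rule sum.cong) (use assms(1) e' in \<open>auto simp: orthonormal_def H_simps\<close>)
    then show ?thesis using e' by (simp add: H_simps)
  qed
  moreover have "(\<Sum>e\<in>set es. H v e *s e) \<in> V"
    using assms(1) by (intro subspace_sum[OF subspace_V]) (auto simp: orthonormal_def)
  ultimately show ?thesis using assms by (auto simp: perp_def)
qed

lemma negative_in_perp:
  assumes "orthonormal es"
  shows "\<exists>w\<in>perp es. Re (H w w) < 0"
proof -
  define w where "w = e0 - (\<Sum>e\<in>set es. H e0 e *s e)"
  have w: "w \<in> perp es" unfolding w_def by (rule minus_projection_in_perp[OF assms e0_in_V])
  then have "H w e = 0" if "e \<in> set es" for e using that by (auto simp: perp_def)
  then have "H w w = H w e0"
    by (subst (2) w_def) (simp add: H_diff_right H_sum_right H_scale_right)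
  also have "\<dots> = H e0 e0 - (\<Sum>e\<in>set es. H e0 e * cnj (H e0 e))"
  proof -
    have "(\<Sum>e\<in>set es. H e0 e * H e e0) = (\<Sum>e\<in>set es. H e0 e * cnj (H e0 e))"
      by (intro sum.cong refl arg_cong2[where f = "(*)"] H_sym)
    then show ?thesis unfolding w_def H_diff_left H_sum_left H_scale_left by simp
  qed
  also have "Re \<dots> \<le> Re (H e0 e0)"
    by (simp add: sum_nonneg flip: complex_norm_square)
  finally have "Re (H w w) < 0" using e0_negative by linarith
  with w show ?thesis by blast
qed

text \<open>Orthonormal lists have bounded length, so there is a longest one that consists of eigenvectors; a positive eigenvector in its
  complement could be added to it.\<close>

lemma maximal_eigenvector_list:
  assumes g: "isometry g" "preserves g"
  shows "\<exists>es. orthonormal es \<and> (\<forall>e\<in>set es. \<exists>l. g e = l *s e) \<and>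
    (\<forall>u l. u \<in> perp es \<longrightarrow> g u = l *s u \<longrightarrow> Re (H u u) \<le> 0)"
proof -
  obtain K where K: "\<And>es. orthonormal es \<Longrightarrow> length es \<le> K" using orthonormal_length_bounded by blast
  let ?P = "\<lambda>es. orthonormal es \<and> (\<forall>e\<in>set es. \<exists>l. g e = l *s e)"
  have "?P []" by (simp add: orthonormal_def)
  moreover have "\<forall>es. ?P es \<longrightarrow> length es < Suc K" using K by (simp add: less_Suc_eq_le)
  ultimately obtain es where es: "?P es" and max: "\<And>fs. ?P fs \<Longrightarrow> length fs \<le> length es"
    using ex_has_greatest_nat[of ?P "[]" length "Suc K"] by blast
  have "Re (H u u) \<le> 0" if u: "u \<in> perp es" "g u = l *s u" for u l
  proof (rule ccontr)
    assume "\<not> Re (H u u) \<le> 0"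
    then obtain c where c: "H (c *s u) (c *s u) = 1" using unit_multiple[of u] by auto
    have p: "c *s u \<in> perp es" using u subspace_perp subspace_scale by blast
    then have o: "H (c *s u) e = 0" if "e \<in> set es" for e
      using that by (simp add: perp_def)
    have o': "H e (c *s u) = 0" if "e \<in> set es" for e
      using o[OF that] by (simp only: H_zero_commute[of e])
    have "c *s u \<notin> set es"
    proof
      assume "c *s u \<in> set es"
      then show False using o c by simp
    qed
    then have "orthonormal (c *s u # es)" using es p o o' c by (auto simp: orthonormal_def perp_def)
    moreover have "g (c *s u) = l *s (c *s u)"
      using u g by (simp add: linear_op_simps isometry_linear mult.commute)
    then have "\<exists>m. g (c *s u) = m *s (c *s u)" by blast
    ultimately have "?P (c *s u # es)" using es by simp
    from max[OF this] show False by simp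
  qed
  then show ?thesis using es by blast
qed

lemma span_pairI: "w = a *s x + b *s y \<Longrightarrow> w \<in> span {x, y}"
  by (auto intro!: span_add span_scale intro: span_base)

lemma span_pairE:
  assumes "w \<in> span {x, y}" obtains a b where "w = a *s x + b *s y"
proof -
  obtain a where "w - a *s x \<in> span {y}" using assms unfolding span_insert by blast
  then obtain b where "w - a *s x - b *s y = 0" unfolding span_insert by auto
  then have "w = a *s x + b *s y" by (simp add: diff_diff_eq)
  then show thesis by (rule that)
qed

lemma span_singletonE:
  assumes "w \<in> span {x}" obtains a where "w = a *s x"
  using assms unfolding span_insert by auto

definition elliptic_part where
  "elliptic_part g W \<longleftrightarrow> (\<exists>u l. u \<in> W \<and> H u u = -1 \<and> g u = l *s u \<and> W \<subseteq> span {u})"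

definition loxodromic_part where
  "loxodromic_part g W \<longleftrightarrow> (\<exists>x y l. x \<in> W \<and> y \<in> W \<and> H x x = 0 \<and> H y y = 0 \<and> H x y = 1 \<and>
     l \<noteq> 0 \<and> cmod l \<noteq> 1 \<and> g x = l *s x \<and> g y = (1 / cnj l) *s y \<and> W \<subseteq> span {x, y})"

text \<open>The digit is the dimension of the block. In the smaller case the nilpotent part is a multiple of the vertical
  translation; in the larger one \<open>n \<noteq> 0\<close> makes the Jordan block have length three.\<close>

definition parabolic_part2 where
  "parabolic_part2 g W \<longleftrightarrow> (\<exists>x y l t. x \<in> W \<and> y \<in> W \<and> H x x = 0 \<and> H y y = 0 \<and> H x y = 1 \<and>
     l * cnj l = 1 \<and> t \<noteq> 0 \<and> g x = l *s x \<and> g y = l *s (y + (\<i> * of_real t) *s x) \<and> W \<subseteq> span {x, y})"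

definition parabolic_part3 where
  "parabolic_part3 g W \<longleftrightarrow> (\<exists>x u y l n k. x \<in> W \<and> u \<in> W \<and> y \<in> W \<and> H x x = 0 \<and> H y y = 0 \<and>
     H x y = 1 \<and> H u u = 1 \<and> H x u = 0 \<and> H y u = 0 \<and>
     l * cnj l = 1 \<and> n \<noteq> 0 \<and> g x = l *s x \<and> g u = l *s (u + n *s x) \<and>
     g y = l *s (y - cnj n *s u + k *s x) \<and> W \<subseteq> span {x, u, y})"

lemma H_cross: "H x y = 1 \<Longrightarrow> H y x = 1" "H x y = 0 \<Longrightarrow> H y x = 0"
  by (metis H_sym complex_cnj_one) (metis H_sym complex_cnj_zero)

lemma isotropic_partner:
  assumes W: "subspace W" "W \<subseteq> V" and w0: "w0 \<in> W" "Re (H w0 w0) < 0"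
    and x: "x \<in> W" "H x x = 0" "x \<noteq> 0"
  shows "\<exists>y\<in>W. H y y = 0 \<and> H x y = 1"
proof -
  have n: "H x w0 \<noteq> 0" using positive_on_negative_perp[of w0 x] W w0 x by auto
  define y0 where "y0 = cnj (1 / H x w0) *s w0"
  define y where "y = y0 - (H y0 y0 / 2) *s x"
  have xy0: "H x y0 = 1" using n by (simp add: y0_def H_simps)
  then have y0x: "H y0 x = 1" by (rule H_cross)
  have "H y y = H y0 y0 - H y0 y0 / 2 - cnj (H y0 y0) / 2"
    unfolding y_def H_simps x(2) xy0 y0x by simp
  then have "H y y = 0" by (simp add: H_self_real)
  moreover have "H x y = 1" by (simp add: y_def H_simps xy0 x)
  moreover have "y \<in> W" unfolding y_def y0_def using W w0 x
    by (intro subspace_diff subspace_scale) auto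
  ultimately show ?thesis by blast
qed

context
  fixes g W
  assumes g: "isometry g" and W: "subspace W" "W \<subseteq> V" and inv: "\<And>v. v \<in> W \<Longrightarrow> g v \<in> W"
    and neg: "\<exists>w\<in>W. Re (H w w) < 0"
    and no_pos: "\<And>u l. u \<in> W \<Longrightarrow> g u = l *s u \<Longrightarrow> Re (H u u) \<le> 0"
begin

lemma g_lin: "linear_op g" using g by (rule isometry_linear)

lemma W_closed: "u \<in> W \<Longrightarrow> v \<in> W \<Longrightarrow> u + v \<in> W" "u \<in> W \<Longrightarrow> c *s u \<in> W"
  "u \<in> W \<Longrightarrow> v \<in> W \<Longrightarrow> u - v \<in> W" "0 \<in> W"
  using W by (auto intro: subspace_add subspace_scale subspace_diff subspace_0)

text \<open>The complement of a negative eigenvector is positive definite and invariant. If it were not 0, it would contain an eigenvector,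
  which would be positive.\<close>

lemma elliptic_case:
  assumes "u \<in> W" "Re (H u u) < 0" "g u = l *s u"
  shows "elliptic_part g W"
proof -
  have "H u u \<noteq> 0" using assms by auto
  then have l: "l * cnj l = 1" using eigenvalue_unimodular g assms by blast
  define X where "X = {w\<in>W. H w u = 0}"
  have X: "subspace X" "X \<subseteq> V" using W by (auto simp: X_def subspace_def H_simps W_closed)
  have "g v \<in> X" if "v \<in> X" for v
  proof -
    have "cnj l * H (g v) u = H (g v) (g u)" by (simp add: assms H_simps)
    also have "\<dots> = 0" using that by (simp add: isometry_H[OF g] X_def)
    finally show ?thesis using l that inv by (auto simp: X_def)
  qed
  note X_inv = this
  have X0: "w = 0" if wX: "w \<in> X" for w
  proof (rule ccontr)
    assume "w \<noteq> 0"
    then obtain v k where v: "v \<in> X" "v \<noteq> 0" "g v = k *s v"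
      using eigenvector_exists[OF g_lin X X_inv wX] by blast
    then have vW: "v \<in> W" "H v u = 0" by (simp_all add: X_def)
    have "Re (H v v) > 0"
      using positive_on_negative_perp[of u v] assms vW v W by blast
    then show False using no_pos[OF vW(1) v(3)] by simp
  qed
  have "W \<subseteq> span {u}"
  proof
    fix w assume "w \<in> W"
    then have "w - (H w u / H u u) *s u \<in> X"
      using assms \<open>H u u \<noteq> 0\<close> by (auto simp: X_def H_simps W_closed)
    then have "w - (H w u / H u u) *s u = 0" by (rule X0)
    then have "w = (H w u / H u u) *s u" by simp
    then show "w \<in> span {u}" by (metis insertCI span_base span_scale)
  qed
  moreover define c where "c = complex_of_real (1 / sqrt (- Re (H u u)))"
  have "c \<noteq> 0" using assms by (simp add: c_def)
  have "H (c *s u) (c *s u) = -1"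
  proof -
    have "H (c *s u) (c *s u) = of_real ((1 / sqrt (- Re (H u u))) * (1 / sqrt (- Re (H u u))) * Re (H u u))"
      unfolding c_def by (simp only: H_simps complex_cnj_complex_of_real of_real_mult mult.assoc H_self_of_real[symmetric])
    also have "(1 / sqrt (- Re (H u u))) * (1 / sqrt (- Re (H u u))) * Re (H u u) = -1"
      using assms by (simp add: field_simps)
    finally show ?thesis by simp
  qed
  moreover have "span {u} \<subseteq> span {c *s u}"
  proof -
    have "u = inverse c *s (c *s u)" using \<open>c \<noteq> 0\<close> by simp
    then have "u \<in> span {c *s u}" by (metis insertCI span_base span_scale)
    then show ?thesis by (simp add: span_minimal)
  qed
  moreover have "g (c *s u) = l *s (c *s u)" by (simp add: linear_op_simps g_lin assms mult.commute)
  moreover have "c *s u \<in> W" using assms W_closed by blast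
  ultimately show ?thesis unfolding elliptic_part_def by blast
qed

lemma isotropic_minus:
  assumes "H x x = 0" "H y y = 0" "H x y = 1"
  shows "H (w - H w y *s x - H w x *s y) x = 0" "H (w - H w y *s x - H w x *s y) y = 0"
  using assms H_cross[of x y] by (auto simp: H_simps)

text \<open>If the eigenvalue of \<open>x\<close> had modulus one, then \<open>x\<close> and \<open>y\<close> would share it and, scaled to
  product 1, would have a positive eigenvector as their sum. An eigenvector orthogonal to \<open>x\<close> and \<open>y\<close> would be isotropic, hence a multiple
  of \<open>x\<close>, but \<open>x\<close> is not orthogonal to \<open>y\<close>.\<close>

lemma loxodromic_case:
  assumes x: "x \<in> W" "H x x = 0" "g x = l *s x" and y: "y \<in> W" "H y y = 0" "g y = m *s y" and xy: "H x y \<noteq> 0"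
    and no_neg: "\<And>u l. u \<in> W \<Longrightarrow> g u = l *s u \<Longrightarrow> Re (H u u) \<ge> 0"
  shows "loxodromic_part g W"
proof -
  define y' where "y' = cnj (1 / H x y) *s y"
  have y': "y' \<in> W" "H y' y' = 0" "g y' = m *s y'" "H x y' = 1"
    using y xy by (auto simp: y'_def H_simps W_closed linear_op_simps g_lin)
  then have yx: "H y' x = 1" using H_cross by blast
  have lm: "l * cnj m = 1" using isometry_H[OF g, of x y'] by (simp add: x y' H_simps mult.commute)
  then have "l \<noteq> 0" "m \<noteq> 0" by auto
  then have m: "m = 1 / cnj l" using arg_cong[OF lm, of cnj] by (simp add: field_simps)
  have "cmod l \<noteq> 1"
  proof
    assume "cmod l = 1"
    then have "l * cnj l = 1" by (simp flip: complex_norm_square)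
    then have "l * cnj m = l * cnj l" using lm by simp
    then have "m = l" using \<open>l \<noteq> 0\<close> by simp
    then have "g (x + y') = l *s (x + y')" by (simp add: linear_op_simps g_lin x y' scale_right_distrib)
    moreover have "H (x + y') (x + y') = 2" using x y' yx by (simp add: H_simps)
    ultimately show False using no_pos[of "x + y'" l] x y' W_closed by simp
  qed
  define X where "X = {w\<in>W. H w x = 0 \<and> H w y' = 0}"
  have X: "subspace X" "X \<subseteq> V" using W by (auto simp: X_def subspace_def H_simps W_closed)
  have "g v \<in> X" if "v \<in> X" for v
  proof -
    have "cnj l * H (g v) x = H (g v) (g x)" "cnj m * H (g v) y' = H (g v) (g y')"
      by (simp_all add: x y' H_simps)
    moreover have "H (g v) (g x) = 0" "H (g v) (g y') = 0"
      using that by (auto simp: isometry_H[OF g] X_def)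
    ultimately show ?thesis using \<open>l \<noteq> 0\<close> \<open>m \<noteq> 0\<close> that inv by (auto simp: X_def)
  qed
  note X_inv = this
  have X0: "w = 0" if w: "w \<in> X" for w
  proof (rule ccontr)
    assume "w \<noteq> 0"
    then obtain u k where u: "u \<in> X" "u \<noteq> 0" "g u = k *s u"
      using eigenvector_exists[OF g_lin X X_inv w] by blast
    then have uW: "u \<in> W" "H u x = 0" by (simp_all add: X_def)
    have "x \<noteq> 0" using yx by auto
    then have "u \<in> span {x}"
      using positive_on_isotropic_perp[of x u] no_pos[OF uW(1) u(3)] x uW W by force
    then obtain a where "u = a *s x" by (rule span_singletonE)
    moreover have "H u y' = 0" using u by (simp add: X_def)
    ultimately show False using y' u by (simp add: H_simps)
  qed
  have "W \<subseteq> span {x, y'}"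
  proof
    fix w assume "w \<in> W"
    then have "w - H w y' *s x - H w x *s y' \<in> X"
      using isotropic_minus[of x y' w] x y' by (auto simp: X_def W_closed)
    then have "w - H w y' *s x - H w x *s y' = 0" by (rule X0)
    then have "w = H w y' *s x + H w x *s y'" by (simp add: diff_diff_eq)
    then show "w \<in> span {x, y'}" by (rule span_pairI)
  qed
  then have "x \<in> W \<and> y' \<in> W \<and> H x x = 0 \<and> H y' y' = 0 \<and> H x y' = 1 \<and> l \<noteq> 0 \<and> cmod l \<noteq> 1 \<and>
      g x = l *s x \<and> g y' = (1 / cnj l) *s y' \<and> W \<subseteq> span {x, y'}"
    using x y' \<open>l \<noteq> 0\<close> \<open>cmod l \<noteq> 1\<close> m by simp
  then show ?thesis unfolding loxodromic_part_def by blast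
qed

text \<open>Let \<open>X\<close> be the complement of \<open>x\<close> in the block. On the positive definite quotient of \<open>X\<close> by \<open>x\<close> the map
  can only have the eigenvalue \<open>l\<close>, since an eigenvector for another eigenvalue would lift to \<open>X\<close>. Two
  independent eigenvectors of the quotient could be combined into an eigenvector in \<open>X\<close> outside the line of
  \<open>x\<close>, so the quotient has dimension at most one. The remaining coefficients are determined by the invariance
  of the form.\<close>

lemma parabolic_case:
  assumes x: "x \<in> W" "x \<noteq> 0" "H x x = 0" "g x = l *s x"
    and only: "\<And>u k. u \<in> W \<Longrightarrow> g u = k *s u \<Longrightarrow> u \<in> span {x}"
  shows "parabolic_part2 g W \<or> parabolic_part3 g W"
proof -
  obtain y where y: "y \<in> W" "H y y = 0" "H x y = 1"
    using isotropic_partner[OF W _ _ x(1,3,2)] neg by blast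
  have yx: "H y x = 1" using y H_cross by blast
  have not_eigen: "g (v + a *s x) \<noteq> k *s (v + a *s x)" if "v \<in> W" "v \<notin> span {x}" for v a k
  proof
    assume "g (v + a *s x) = k *s (v + a *s x)"
    then have "v + a *s x \<in> span {x}" using only that x W_closed by blast
    moreover have "a *s x \<in> span {x}" by (simp add: span_scale span_base)
    ultimately have "v + a *s x - a *s x \<in> span {x}" by (rule span_diff)
    then show False using that by simp
  qed
  have diag: "k = l" if v: "v \<in> W" "v \<notin> span {x}" "g v = k *s v + a *s x" for v a k
  proof (rule ccontr)
    assume "k \<noteq> l"
    define b where "b = a / (k - l)"
    have "a + l * b = k * b" using \<open>k \<noteq> l\<close> by (simp add: b_def field_simps)
    then have "g (v + b *s x) = k *s (v + b *s x)"
      by (simp add: linear_op_simps g_lin v x scale_right_distrib add.assoc mult.commute[of b] flip: scale_left_distrib)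
    then show False using not_eigen v by blast
  qed
  define X where "X = {w\<in>W. H w x = 0}"
  have X: "subspace X" "X \<subseteq> V" using W by (auto simp: X_def subspace_def H_simps W_closed)
  have l0: "l \<noteq> 0"
  proof
    assume "l = 0"
    then have "H x y = 0" using isometry_H[OF g, of x y] x by simp
    then show False using y by simp
  qed
  have X_inv: "g v \<in> X" if "v \<in> X" for v
  proof -
    have "cnj l * H (g v) x = H (g v) (g x)" by (simp add: x H_simps)
    also have "\<dots> = 0" using that by (simp add: isometry_H[OF g] X_def)
    finally show ?thesis using l0 that inv by (auto simp: X_def)
  qed
  have y_notin: "y \<notin> span {x}" using yx x(3) by (auto elim!: span_singletonE simp: H_simps)
  show ?thesis
  proof (cases "X \<subseteq> span {x}")
    case True
    have sp: "W \<subseteq> span {x, y}"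
    proof
      fix w assume "w \<in> W"
      then have "w - H w x *s y \<in> X" using x y yx by (auto simp: X_def W_closed H_simps)
      then obtain a where "w - H w x *s y = a *s x" using True by (auto elim: span_singletonE)
      then have "w = a *s x + H w x *s y" by (simp add: diff_eq_eq)
      then show "w \<in> span {x, y}" by (rule span_pairI)
    qed
    then obtain a b where ab: "g y = a *s x + b *s y" using inv y span_pairE by blast
    then have "g y = b *s y + a *s x" by (simp add: add.commute)
    then have bl: "b = l" using diag y y_notin by blast
    have l1: "l * cnj l = 1" using isometry_H[OF g, of x y] by (simp add: ab bl x y H_simps mult.commute)
    define t where "t = Im (a / l)"
    have "a * cnj l + cnj a * l = 0" 
      using isometry_H[OF g, of y y] by (simp add: ab bl x y yx H_simps mult.commute add.commute)
    then have "cnj l * (a * cnj l + cnj a * l) * l = 0" by simp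
    then have "(cnj l * a) * (l * cnj l) + l * cnj a * (l * cnj l) = 0" by (simp add: algebra_simps)
    then have "cnj l * a + cnj (cnj l * a) = 0" by (simp add: l1)
    moreover have "Re z = 0" if "z + cnj z = 0" for z using that by (simp add: complex_eq_iff)
    ultimately have "Re (cnj l * a) = 0" by blast
    moreover have al: "a / l = cnj l * a" using l1 l0 by (simp add: field_simps)
    ultimately have "Re (a / l) = 0" by (simp only:)
    then have "a / l = \<i> * of_real t" by (simp add: t_def complex_eq_iff)
    then have a: "a = l * (\<i> * of_real t)" using l0 by (simp add: field_simps)
    have "t \<noteq> 0"
    proof
      assume "t = 0"
      then show False using not_eigen[OF y(1) y_notin, of 0 l] ab a bl by simp
    qed
    moreover have "g y = l *s (y + (\<i> * of_real t) *s x)"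
      by (simp add: ab a bl scale_right_distrib add.commute)
    ultimately have "parabolic_part2 g W" unfolding parabolic_part2_def using x y l1 sp by blast
    then show ?thesis ..
  next
    case False
    then obtain u0 where "u0 \<in> X" "u0 \<notin> span {x}" by blast
    then obtain u1 m where u1: "u1 \<in> X" "u1 \<notin> span {x}" "g u1 - m *s u1 \<in> span {x}"
      using eigenvector_modulo[OF g_lin X X_inv subspace_span[of "{x}"]] by blast
    then have "Re (H u1 u1) > 0" using positive_on_isotropic_perp[of x u1] x W by (auto simp: X_def)
    then obtain c where c: "c \<noteq> 0" "H (c *s u1) (c *s u1) = 1" using unit_multiple by blast
    define u where "u = c *s u1"
    have u: "u \<in> X" "u \<in> W" "H u u = 1" "H u x = 0"
      using u1 c subspace_scale[OF X(1)] by (auto simp: u_def X_def)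
    have xu: "H x u = 0" using u H_zero_commute by blast
    have u_notin: "u \<notin> span {x}" using u x by (auto elim!: span_singletonE simp: H_simps)
    obtain a1 where "g u1 - m *s u1 = a1 *s x" using u1 by (auto elim: span_singletonE)
    then have "g u1 = m *s u1 + a1 *s x" by (simp add: diff_eq_eq add.commute)
    then have gu: "g u = m *s u + (c * a1) *s x"
      by (simp add: u_def linear_op_simps g_lin scale_right_distrib mult.commute)
    then have "m = l" using diag u u_notin by blast
    define n where "n = c * a1 / l"
    have gu: "g u = l *s (u + n *s x)" using gu l0 \<open>m = l\<close> by (simp add: n_def scale_right_distrib)
    have n0: "n \<noteq> 0"
    proof
      assume "n = 0"
      then show False using not_eigen[OF u(2) u_notin, of 0 l] gu by simp
    qed
    have l1: "l * cnj l = 1"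
      using isometry_H[OF g, of u u] by (simp add: gu x u xu H_simps mult.commute)
    define y1 where "y1 = y - H y u *s u"
    have y1: "y1 \<in> W" "H y1 u = 0" "H x y1 = 1"
      using y u x xu by (auto simp: y1_def W_closed H_simps)
    define z where "z = y1 - (H y1 y1 / 2) *s x"
    have "H z z = H y1 y1 - H y1 y1 / 2 - cnj (H y1 y1) / 2"
      unfolding z_def H_simps x(3) y1 H_cross(1)[OF y1(3)] by simp
    then have z: "H z z = 0" "z \<in> W" "H z u = 0" "H x z = 1"
      using x y1 xu by (auto simp: z_def W_closed H_simps H_self_real)
    have zx: "H z x = 1" "H u z = 0" using z H_cross by blast+
    define Y where "Y = {w. w \<in> X \<and> H w u = 0}"
    have Y: "subspace Y" "Y \<subseteq> V" using X by (auto simp: Y_def subspace_def H_simps)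
    have Y_inv: "g v \<in> Y" if "v \<in> Y" for v
    proof -
      have v: "g v \<in> X" "H (g v) x = 0" using that X_inv[of v] by (auto simp: Y_def X_def)
      have "cnj l * H (g v) u = H (g v) (g u)" by (simp add: gu v H_simps)
      also have "\<dots> = 0" using that by (simp add: isometry_H[OF g] Y_def)
      finally show ?thesis using l0 v by (auto simp: Y_def)
    qed
    have Yx: "Y \<subseteq> span {x}"
    proof (rule ccontr)
      assume "\<not> Y \<subseteq> span {x}"
      then obtain v m' where v: "v \<in> Y" "v \<notin> span {x}" "g v - m' *s v \<in> span {x}"
        using eigenvector_modulo[OF g_lin Y Y_inv subspace_span[of "{x}"]] by blast
      then obtain a where a: "g v - m' *s v = a *s x" by (auto elim: span_singletonE)
      then have gv: "g v = m' *s v + a *s x" by (simp add: diff_eq_eq add.commute)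
      have vW: "v \<in> W" "H v u = 0" using v by (auto simp: Y_def X_def)
      have "m' = l" using diag[OF vW(1) v(2) gv] .
      define d where "d = n *s v - (a / l) *s u"
      have "g d = l *s d"
        using l0 by (simp add: d_def linear_op_simps g_lin gv gu \<open>m' = l\<close> scale_right_distrib scale_right_diff_distrib mult.commute)
      moreover have "d \<in> W" unfolding d_def using vW u by (intro W_closed)
      ultimately have "d \<in> span {x}" using only by blast
      then obtain b where "d = b *s x" by (rule span_singletonE)
      then have "H d u = 0" by (simp add: xu H_simps)
      then have "a = 0" using vW u l0 by (simp add: d_def H_simps)
      then show False using not_eigen[OF vW(1) v(2), of 0 l] gv \<open>m' = l\<close> by simp
    qed
    have sp: "\<exists>a b c. w = a *s x + b *s u + c *s z" if "w \<in> W" for w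
    proof -
      have "w - H w x *s z - H w u *s u \<in> Y" using that z zx u x xu
        by (auto simp: Y_def X_def W_closed H_simps)
      then obtain a where "w - H w x *s z - H w u *s u = a *s x" using Yx by (auto elim: span_singletonE)
      then have "w = a *s x + H w u *s u + H w x *s z" by (simp add: diff_eq_eq)
      then show ?thesis by blast
    qed
    then obtain a b d where gz: "g z = a *s x + b *s u + d *s z" using inv z by blast
    have "l * cnj d = 1" using isometry_H[OF g, of x z] by (simp add: gz x xu z H_simps mult.commute)
    then have "(l * cnj l) * cnj d = cnj l" by (simp add: algebra_simps)
    then have d: "d = l" using l1 by (metis complex_cnj_cnj mult_1)
    have "l * (cnj b + n * cnj l) = 0" using isometry_H[OF g, of u z]
      by (simp add: gz gu d x xu u z zx H_simps algebra_simps)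
    then have "cnj b = - (n * cnj l)" using l0 by (simp add: eq_neg_iff_add_eq_0)
    then have b: "b = - (cnj n * l)" by (metis complex_cnj_cnj complex_cnj_minus complex_cnj_mult)
    have "g z = l *s (z - cnj n *s u + (a / l) *s x)"
      using l0 by (simp add: gz d b scale_right_distrib scale_right_diff_distrib scale_minus_left mult.commute)
    moreover have "W \<subseteq> span {x, u, z}"
    proof
      fix w assume "w \<in> W"
      then obtain a b c where "w = a *s x + b *s u + c *s z" using sp by blast
      then show "w \<in> span {x, u, z}" by (auto intro!: span_add span_scale intro: span_base)
    qed
    ultimately have "parabolic_part3 g W"
      unfolding parabolic_part3_def using x u xu z l1 n0 gu by blast
    then show ?thesis ..
  qed
qed

text \<open>If no eigenvector in \<open>W\<close> is negative, all of them are isotropic. Then either two of them have a nonzero product,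
  or any two are orthogonal and hence proportional.\<close>

lemma isometry_normal_form:
  "elliptic_part g W \<or> loxodromic_part g W \<or> parabolic_part2 g W \<or> parabolic_part3 g W"
proof (cases "\<exists>u l. u \<in> W \<and> Re (H u u) < 0 \<and> g u = l *s u")
  case True
  then show ?thesis using elliptic_case by blast
next
  case False
  then have no_neg: "Re (H u u) \<ge> 0" if "u \<in> W" "g u = l *s u" for u l using that by force
  have iso: "H u u = 0" if "u \<in> W" "g u = l *s u" for u l
    using no_neg[OF that] no_pos[OF that] H_self_of_real[of u] by simp
  obtain w where "w \<in> W" "Re (H w w) < 0" using neg by blast
  then have "w \<in> W" "w \<noteq> 0" by auto
  then obtain x l where x: "x \<in> W" "x \<noteq> 0" "g x = l *s x"
    using eigenvector_exists[OF g_lin W inv] by blast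
  show ?thesis
  proof (cases "\<exists>y m. y \<in> W \<and> g y = m *s y \<and> H x y \<noteq> 0")
    case True
    then obtain y m where "y \<in> W" "g y = m *s y" "H x y \<noteq> 0" by blast
    then show ?thesis using loxodromic_case[OF x(1) _ x(3), of y m] iso x no_neg by blast
  next
    case False
    have "u \<in> span {x}" if "u \<in> W" "g u = k *s u" for u k
    proof (rule ccontr)
      assume "u \<notin> span {x}"
      then have "Re (H u u) > 0"
        using positive_on_isotropic_perp[of x u] x iso[OF x(1,3)] that False H_zero_commute W by blast
      then show False using iso[OF that] by simp
    qed
    then show ?thesis using parabolic_case[OF x(1,2) iso[OF x(1,3)] x(3)] by blast
  qed
qed

end
end

section \<open>Prescribing an eigenvalue on a positive plane\<close>

text \<open>The parameter \<open>dt\<close> stands for the determinant of the restriction to \<open>V\<close>. Only its formal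
  properties are needed: it decides whether the last eigenvalue of a chain fits.\<close>

locale lorentz_space_det = lorentz_space scale H V e0
  for scale :: "complex \<Rightarrow> 'a::ab_group_add \<Rightarrow> 'a" (infixr "*s" 75) and H V e0 +
  fixes dt :: "('a \<Rightarrow> 'a) \<Rightarrow> complex" and m :: nat
  assumes dt_comp: "linear_op S \<Longrightarrow> linear_op T \<Longrightarrow> preserves S \<Longrightarrow> preserves T \<Longrightarrow> dt (S \<circ> T) = dt S * dt T"
    and dt_cong: "(\<And>v. v \<in> V \<Longrightarrow> S v = T v) \<Longrightarrow> dt S = dt T"
    and dt_id: "dt id = 1"
    and dt_crefl: "u \<in> V \<Longrightarrow> H u u \<noteq> 0 \<Longrightarrow> dt (crefl u \<zeta>) = \<zeta>"
    and dt_unimodular: "isometry T \<Longrightarrow> preserves T \<Longrightarrow> cmod (dt T) = 1"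
    and dt_scale: "dt (\<lambda>v. c *s T v) = c ^ m * dt T"
begin

definition unitary :: "('a \<Rightarrow> 'a) \<Rightarrow> bool" where
  "unitary T \<longleftrightarrow> isometry T \<and> preserves T"

lemma unitary_isometry: "unitary T \<Longrightarrow> isometry T"
  and unitary_preserves: "unitary T \<Longrightarrow> v \<in> V \<Longrightarrow> T v \<in> V"
  and unitary_linear: "unitary T \<Longrightarrow> linear_op T"
  by (auto simp: unitary_def preserves_def isometry_linear)

lemma unitary_comp: "unitary S \<Longrightarrow> unitary T \<Longrightarrow> unitary (S \<circ> T)"
  by (auto simp: unitary_def preserves_def isometry_comp)

lemma unitary_id: "unitary id"
  by (auto simp: unitary_def preserves_def isometry_id)

lemma unitary_crefl: "u \<in> V \<Longrightarrow> H u u \<noteq> 0 \<Longrightarrow> \<zeta> * cnj \<zeta> = 1 \<Longrightarrow> unitary (crefl u \<zeta>)"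
  by (auto simp: unitary_def preserves_def isometry_crefl crefl_def V_closed)

lemma unitary_swap_op:
  "u \<in> V \<Longrightarrow> v \<in> V \<Longrightarrow> (u \<noteq> v \<Longrightarrow> H (u - v) (u - v) \<noteq> 0) \<Longrightarrow> unitary (swap_op u v)"
  by (auto simp: swap_op_def unitary_id intro!: unitary_crefl V_closed)

lemma dt_unitary_comp: "unitary S \<Longrightarrow> unitary T \<Longrightarrow> dt (S \<circ> T) = dt S * dt T"
  by (rule dt_comp) (auto simp: unitary_def isometry_linear)

lemma dt_involution:
  assumes "unitary T" "T \<circ> T = id" shows "(dt T)\<^sup>2 = 1"
  using dt_unitary_comp[OF assms(1,1)] assms(2) by (simp add: dt_id power2_eq_square)

lemma unimodular: "cmod z = 1 \<longleftrightarrow> z * cnj z = 1"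
  by (metis complex_norm_square norm_one norm_power of_real_1 of_real_eq_1_iff power_one
      norm_mult complex_mod_cnj power2_eq_square abs_norm_cancel power2_eq_1_iff norm_ge_zero zero_le_one
      order_antisym_conv neg_0_le_iff_le not_one_le_zero)

lemma real_conj_eq: "Im (H u v) = 0 \<Longrightarrow> H u v = H v u"
  by (metis H_sym complex_is_Real_iff Reals_cnj_iff)

text \<open>Let \<open>h\<close> have the eigenvalues \<open>a\<close> and \<open>b\<close> on the plane. It suffices to find a unit vector \<open>w\<close> with
  \<open>r \<langle>h w, w\<rangle>\<close> real: the swap \<open>I\<close> of \<open>f1 = r h w\<close> with \<open>w\<close> satisfies
  \<open>h I f1 = cnj r f1\<close>. The numbers \<open>\<langle>h w, w\<rangle>\<close> fill the segment from \<open>a\<close> to \<open>b\<close>. If the sign of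
  \<open>b\<close> is such that \<open>r a\<close> and \<open>r b\<close> do not lie strictly on the same side of the real axis, then \<open>r\<close> times
  this segment meets the axis. The second eigenvalue \<open>s\<close> is found, up to sign, by comparing determinants.\<close>

lemma positive_plane:
  assumes e: "e1 \<in> V" "e2 \<in> V" "H e1 e1 = 1" "H e2 e2 = 1" "H e1 e2 = 0"
    and g: "cmod g1 = 1" "cmod g2 = 1" "cmod r = 1"
  shows "\<exists>a b I f1 f2 s. a\<^sup>2 = g1 \<and> b\<^sup>2 = g2 \<and> unitary I \<and> I \<circ> I = id \<and>
    f1 \<in> span {e1, e2} \<and> f2 \<in> span {e1, e2} \<and> H f1 f1 = 1 \<and> H f2 f2 = 1 \<and> H f1 f2 = 0 \<and>
    s\<^sup>2 = g1 * g2 * r\<^sup>2 \<and>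
    crefl e1 a \<circ> crefl e2 b \<circ> I = crefl f1 (cnj r) \<circ> crefl f2 s \<and>
    (\<forall>T. isometry T \<longrightarrow> T e1 = e1 \<longrightarrow> T e2 = e2 \<longrightarrow> (\<forall>x. T (I x) = I (T x))) \<and>
    (\<forall>x. H x e1 = 0 \<longrightarrow> H x e2 = 0 \<longrightarrow> I x = x)"
proof -
  have e21: "H e2 e1 = 0" using e(5) H_zero_commute by blast
  define a where "a = csqrt g1"
  define b where "b = (if Im (r * a) * Im (r * csqrt g2) \<le> 0 then csqrt g2 else - csqrt g2)"
  have ab: "a\<^sup>2 = g1" "b\<^sup>2 = g2" by (auto simp: a_def b_def)
  have sgn: "Im (r * a) * Im (r * b) \<le> 0"
    unfolding b_def by (auto simp: algebra_simps)
  have "(cmod a)\<^sup>2 = 1" "(cmod b)\<^sup>2 = 1" using ab g by (metis norm_power)+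
  then have cab: "cmod a = 1" "cmod b = 1" by (auto simp: power2_eq_1_iff) (metis norm_ge_zero not_one_le_zero neg_0_le_iff_le)+
  then have a1: "a * cnj a = 1" and b1: "b * cnj b = 1" and r1: "r * cnj r = 1"
    using g by (auto simp: unimodular)
  \<comment> \<open>the point at which the segment from \<open>r a\<close> to \<open>r b\<close> crosses the real axis\<close>
  obtain p where p: "0 \<le> p" "p \<le> 1" "p * Im (r * a) + (1 - p) * Im (r * b) = 0"
  proof (cases "Im (r * a) = Im (r * b)")
    case True
    then have "Im (r * a) = 0" using sgn by (metis mult_le_0_iff order_antisym)
    then show thesis using that[of 1] by simp
  next
    case False
    define x y where "x = Im (r * a)" and "y = Im (r * b)"
    have xy: "x \<noteq> y" "x * y \<le> 0" using False sgn by (auto simp: x_def y_def)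
    have "0 \<le> y / (y - x)" "y / (y - x) \<le> 1"
      using xy by (auto simp: mult_le_0_iff divide_simps split: if_splits)
    moreover have "y / (y - x) * x + (1 - y / (y - x)) * y = 0"
      using xy by (simp add: field_simps)
    ultimately show thesis using that x_def y_def by blast
  qed
  define cp cq where "cp = complex_of_real (sqrt p)" and "cq = complex_of_real (sqrt (1 - p))"
  have c: "cnj cp = cp" "cnj cq = cq" "cp * cp = of_real p" "cq * cq = 1 - of_real p"
    using p by (auto simp: cp_def cq_def simp flip: of_real_mult)
  define h where "h = crefl e1 a \<circ> crefl e2 b"
  have h: "unitary h" unfolding h_def by (intro unitary_comp unitary_crefl) (use e a1 b1 in auto)
  have he: "h e1 = a *s e1" "h e2 = b *s e2"
    using e e21 by (auto simp: h_def crefl_orth crefl_self linear_op_scale[OF linear_op_crefl])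
  have h_perp: "h x = x" if "H x e1 = 0" "H x e2 = 0" for x
    using that by (simp add: h_def crefl_orth)
  define w where "w = cp *s e1 + cq *s e2"
  define f1 where "f1 = (r * cp * a) *s e1 + (r * cq * b) *s e2"
  define f2 where "f2 = (cq * a) *s e1 - (cp * b) *s e2"
  have hw: "h w = cnj r *s f1"
    using r1 by (simp add: w_def f1_def linear_op_simps[OF unitary_linear[OF h]] he scale_right_distrib mult.assoc[symmetric] mult.commute[of "cnj r" r] mult.commute[of a] mult.commute[of b])
  have V: "w \<in> V" "f1 \<in> V" "f2 \<in> V" using e by (auto simp: w_def f1_def f2_def intro!: V_closed)
  have Hsp: "H (x *s e1 + y *s e2) (x' *s e1 + y' *s e2) = x * cnj x' + y * cnj y'" for x y x' y'
    using e e21 by (simp add: H_simps)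
  have f2': "f2 = (cq * a) *s e1 + (- (cp * b)) *s e2" by (simp add: f2_def scale_minus_left)
  have ww: "H w w = 1" unfolding w_def Hsp using c by simp
  have f11: "H f1 f1 = 1"
  proof -
    have "H f1 f1 = (r * cnj r) * ((cp * cp) * (a * cnj a) + (cq * cq) * (b * cnj b))"
      unfolding f1_def Hsp complex_cnj_mult complex_cnj_minus c(1,2) by (simp add: algebra_simps)
    then show ?thesis by (simp add: a1 b1 r1 c)
  qed
  have f22: "H f2 f2 = 1"
  proof -
    have "H f2 f2 = (cq * cq) * (a * cnj a) + (cp * cp) * (b * cnj b)"
      unfolding f2' Hsp complex_cnj_mult complex_cnj_minus c(1,2) by (simp add: algebra_simps)
    then show ?thesis by (simp add: a1 b1 c)
  qed
  have f12: "H f1 f2 = 0"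
  proof -
    have "H f1 f2 = r * cp * cq * ((a * cnj a) - (b * cnj b))"
      unfolding f1_def f2' Hsp complex_cnj_mult complex_cnj_minus c(1,2) by (simp add: algebra_simps)
    then show ?thesis by (simp add: a1 b1)
  qed
  then have f21: "H f2 f1 = 0" using H_zero_commute by blast
  have "H f1 w = (cp * cp) * (r * a) + (cq * cq) * (r * b)"
    unfolding f1_def w_def Hsp complex_cnj_mult complex_cnj_minus c(1,2) by (simp add: algebra_simps)
  then have "Im (H f1 w) = p * Im (r * a) + (1 - p) * Im (r * b)"
    unfolding c by simp
  then have f1w: "H f1 w = H w f1" using real_conj_eq p by metis
  have def_pos: "v = 0" if "v = x *s e1 + y *s e2" "H v v = 0" for v x y
  proof -
    have "x * cnj x + y * cnj y = 0" using that Hsp by metis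
    then have "complex_of_real ((cmod x)\<^sup>2 + (cmod y)\<^sup>2) = 0" by (simp add: complex_norm_square del: of_real_power)
    then have "x = 0 \<and> y = 0" by (simp only: of_real_eq_0_iff) (auto simp: add_nonneg_eq_0_iff)
    then show ?thesis using that by simp
  qed
  have "f1 - w = (r * cp * a - cp) *s e1 + (r * cq * b - cq) *s e2"
    by (simp add: f1_def w_def scale_left_diff_distrib)
  then have nz: "f1 \<noteq> w \<Longrightarrow> H (f1 - w) (f1 - w) \<noteq> 0" using def_pos by (metis right_minus_eq)
  define I where "I = swap_op f1 w"
  have I: "unitary I" "I \<circ> I = id" unfolding I_def
    using unitary_swap_op[OF V(2,1) nz] swap_op_involutive[OF nz] by auto
  have If1: "I f1 = w" unfolding I_def by (rule swap_op_left) (use f11 ww f1w nz in auto)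
  have sp: "w \<in> span {e1, e2}" "f1 \<in> span {e1, e2}" "f2 \<in> span {e1, e2}"
    using span_pairI w_def f1_def f2' by blast+
  have perp_sp: "H x v = 0" if "H x e1 = 0" "H x e2 = 0" "v \<in> span {e1, e2}" for x v
    using that(3) by (rule span_pairE) (use that in \<open>auto simp: H_simps\<close>)
  have I_perp: "I x = x" if "H x e1 = 0" "H x e2 = 0" for x
    unfolding I_def by (rule swap_op_orth) (use that sp perp_sp in blast)+
  define R where "R = h \<circ> I"
  have R: "unitary R" unfolding R_def using h I unitary_comp by blast
  have Rf1: "R f1 = cnj r *s f1" by (simp add: R_def If1 hw)
  have R_sp: "R x \<in> span {e1, e2}" if "x \<in> span {e1, e2}" for x
  proof -
    have "I x = x + (if f1 = w then 0 else (-1 - 1) * H x (f1 - w) / H (f1 - w) (f1 - w)) *s (f1 - w)"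
      by (simp add: I_def swap_op_def crefl_def)
    then have "I x \<in> span {e1, e2}" using that sp by (metis span_add span_diff span_scale)
    then obtain x1 x2 where "I x = x1 *s e1 + x2 *s e2" by (rule span_pairE)
    then have "R x = (x1 * a) *s e1 + (x2 * b) *s e2"
      by (simp add: R_def linear_op_simps[OF unitary_linear[OF h]] he)
    then show ?thesis by (rule span_pairI)
  qed
  have frame: "x = H x f1 *s f1 + H x f2 *s f2" if "x \<in> span {e1, e2}" for x
  proof -
    have k: "H x f1 *s f1 + H x f2 *s f2 = x" if x: "x = e1 \<or> x = e2" for x
    proof -
      have co: "H x f1 *s f1 + H x f2 *s f2 = (H x f1 * (r * cp * a) + H x f2 * (cq * a)) *s e1
         + (H x f1 * (r * cq * b) - H x f2 * (cp * b)) *s e2"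
        by (simp add: f1_def f2_def scale_right_distrib scale_right_diff_distrib scale_left_distrib scale_left_diff_distrib)
      have h1: "H e1 f1 = cnj r * cp * cnj a" "H e1 f2 = cq * cnj a"
        "H e2 f1 = cnj r * cq * cnj b" "H e2 f2 = - (cp * cnj b)"
        using e e21 by (simp_all add: f1_def f2_def H_simps c)
      from x show ?thesis
      proof
        assume [simp]: "x = e1"
        have "H x f1 * (r * cp * a) + H x f2 * (cq * a) = (cp * cp) * (r * cnj r) * (a * cnj a) + (cq * cq) * (a * cnj a)"
          by (simp add: h1 algebra_simps)
        moreover have "H x f1 * (r * cq * b) - H x f2 * (cp * b) = (r * cnj r - 1) * (cp * cq * cnj a * b)"
          by (simp add: h1 algebra_simps)
        ultimately show ?thesis unfolding co r1 a1 c by simp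
      next
        assume [simp]: "x = e2"
        have "H x f1 * (r * cq * b) - H x f2 * (cp * b) = (cq * cq) * (r * cnj r) * (b * cnj b) + (cp * cp) * (b * cnj b)"
          by (simp add: h1 algebra_simps)
        moreover have "H x f1 * (r * cp * a) + H x f2 * (cq * a) = (r * cnj r - 1) * (cp * cq * cnj b * a)"
          by (simp add: h1 algebra_simps)
        ultimately show ?thesis unfolding co r1 b1 c by simp
      qed
    qed
    have "(\<lambda>x. H x f1 *s f1 + H x f2 *s f2) x = id x"
      by (rule linear_op_eq_on_span[OF _ linear_op_id _ that])
        (use k in \<open>auto simp: linear_op_def H_simps scale_left_distrib scale_right_distrib\<close>)
    then show ?thesis by simp
  qed
  define s where "s = H (R f2) f2"
  have "H (R f2) (R f1) = 0" using isometry_H[OF unitary_isometry[OF R]] f21 by simp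
  then have "r * H (R f2) f1 = 0" by (simp add: Rf1 H_simps)
  then have "H (R f2) f1 = 0" using r1 by auto
  then have Rf2: "R f2 = s *s f2" using frame[OF R_sp[OF sp(3)]] by (simp add: s_def)
  have RR: "R = crefl f1 (cnj r) \<circ> crefl f2 s"
  proof
    fix x
    define y where "y = H x e1 *s e1 + H x e2 *s e2"
    have y: "y \<in> span {e1, e2}" unfolding y_def by (rule span_pairI) simp
    have z: "H (x - y) e1 = 0" "H (x - y) e2 = 0" using e e21 by (auto simp: y_def H_simps)
    have "R y = (crefl f1 (cnj r) \<circ> crefl f2 s) y"
      by (subst (1 2) frame[OF y])
        (simp add: linear_op_simps[OF unitary_linear[OF R]] linear_op_simps[OF linear_op_crefl] Rf1 Rf2
          crefl_self crefl_orth f11 f22 f12 f21)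
    moreover have "R (x - y) = x - y" using z by (simp add: R_def I_perp h_perp)
    moreover have "(crefl f1 (cnj r) \<circ> crefl f2 s) (x - y) = x - y"
      using perp_sp[OF z] sp by (simp add: crefl_orth)
    ultimately have "R (y + (x - y)) = (crefl f1 (cnj r) \<circ> crefl f2 s) (y + (x - y))"
      by (simp only: linear_op_add[OF unitary_linear[OF R]] linear_op_add[OF linear_op_comp[OF linear_op_crefl linear_op_crefl]])
    then show "R x = (crefl f1 (cnj r) \<circ> crefl f2 s) x" by simp
  qed
  have s2: "s\<^sup>2 = g1 * g2 * r\<^sup>2"
  proof -
    have "dt R = a * b * dt I"
      unfolding R_def dt_unitary_comp[OF h I(1)] unfolding h_def using e a1 b1
      by (subst dt_unitary_comp) (auto intro!: unitary_crefl simp: dt_crefl)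
    moreover have "dt R = cnj r * s" unfolding RR
      using V f11 f22 by (subst dt_comp)
        (auto simp: dt_crefl linear_op_crefl preserves_def crefl_def intro!: V_closed)
    ultimately have "(r * (cnj r * s))\<^sup>2 = (r * (a * b * dt I))\<^sup>2" by simp
    then have "((r * cnj r) * s)\<^sup>2 = r\<^sup>2 * (a\<^sup>2 * b\<^sup>2 * (dt I)\<^sup>2)" by (simp only: power_mult_distrib mult.assoc)
    then show ?thesis using dt_involution[OF I] ab r1 by (simp add: algebra_simps)
  qed
  have comm: "T (I x) = I (T x)" if T: "isometry T" "T e1 = e1" "T e2 = e2" for T x
  proof -
    have fix_sp: "T v = v" if "v \<in> span {e1, e2}" for v
      using linear_op_eq_on_span[OF isometry_linear[OF T(1)] linear_op_id _ that] T by auto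
    show ?thesis unfolding I_def
      by (rule isometry_swap_op_conj[OF T(1)]) (use fix_sp sp in auto)
  qed
  show ?thesis
    by (rule exI[of _ a], rule exI[of _ b], rule exI[of _ I], rule exI[of _ f1], rule exI[of _ f2], rule exI[of _ s])
      (use ab I sp f11 f22 f12 s2 RR comm I_perp in \<open>simp add: R_def h_def\<close>)
qed

definition diagonal_op :: "'a list \<Rightarrow> ('a \<Rightarrow> complex) \<Rightarrow> 'a \<Rightarrow> 'a" where
  "diagonal_op es \<gamma> = foldr (\<lambda>e T. crefl e (\<gamma> e) \<circ> T) es id"

lemma diagonal_op_simps [simp]: "diagonal_op [] \<gamma> = id"
  "diagonal_op (e # es) \<gamma> = crefl e (\<gamma> e) \<circ> diagonal_op es \<gamma>"
  by (simp_all add: diagonal_op_def)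

lemma crefl_commute:
  assumes "H e e = 1" "H f f = 1" "H e f = 0" "\<zeta> * cnj \<zeta> = 1"
  shows "crefl e \<zeta> (crefl f \<xi> x) = crefl f \<xi> (crefl e \<zeta> x)"
proof -
  have "crefl e \<zeta> f = f" using assms(3) H_zero_commute by (simp add: crefl_orth)
  then show ?thesis using isometry_crefl_conj[of "crefl e \<zeta>" f \<xi> x] isometry_crefl[of e \<zeta>] assms by simp
qed

text \<open>The pair of opposite eigenvalues \<open>r\<close> and \<open>cnj r\<close> is inverted by the exchange of its eigenvectors.\<close>

lemma swap_pair_reverses:
  assumes f: "H f f = 1" "H e e = 1" "H f e = 0" and r: "r * cnj r = 1"
  defines "S \<equiv> swap_op f e" and "P \<equiv> crefl f r \<circ> crefl e (cnj r)"
  shows "f \<noteq> e" "H (f - e) (f - e) \<noteq> 0" "S (P (S (P x))) = x"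
proof -
  have ef: "H e f = 0" using f(3) H_zero_commute by blast
  show "f \<noteq> e" using f by auto
  show n: "H (f - e) (f - e) \<noteq> 0" using f ef by (simp add: H_simps)
  have S: "isometry S" unfolding S_def using n by (intro isometry_swap_op) auto
  have Sf: "S f = e" "S e = f" unfolding S_def
    using swap_op_left[of f e] swap_op_right[of f e] f ef n by auto
  have SS: "S (S y) = y" for y using swap_op_involutive[of f e] n by (metis S_def comp_apply id_apply)
  have r': "cnj r * cnj (cnj r) = 1" using r by (simp add: mult.commute)
  have "S (P (S (P x))) = crefl e r (crefl f (cnj r) (crefl f r (crefl e (cnj r) x)))"
    by (simp add: P_def isometry_crefl_conj[OF S] Sf SS)
  also have "\<dots> = crefl e r (crefl e (cnj r) x)" using f r' by (simp add: crefl_crefl crefl_one mult.commute)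
  also have "\<dots> = x" using f r by (simp add: crefl_crefl crefl_one)
  finally show "S (P (S (P x))) = x" .
qed

end

section \<open>Chains of positive planes\<close>

context lorentz_space_det
begin

lemma orthonormal_Cons: "orthonormal (e # es) \<longleftrightarrow>
   e \<in> V \<and> H e e = 1 \<and> (\<forall>f\<in>set es. H e f = 0) \<and> orthonormal es"
proof
  assume L: "orthonormal (e # es)"
  then show "e \<in> V \<and> H e e = 1 \<and> (\<forall>f\<in>set es. H e f = 0) \<and> orthonormal es"
    by (auto simp: orthonormal_def)
next
  assume R: "e \<in> V \<and> H e e = 1 \<and> (\<forall>f\<in>set es. H e f = 0) \<and> orthonormal es"
  then have "H f e = 0" if "f \<in> set es" for f using that H_zero_commute by blast
  moreover have "e \<notin> set es" using R by auto
  ultimately show "orthonormal (e # es)" using R by (auto simp: orthonormal_def)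
qed

text \<open>\<open>D\<close> is a square root of the diagonal operator, and \<open>J\<close> inverts the product of \<open>D I\<close> with the loose
  reflection in \<open>f\<close>. The last two clauses say that \<open>D\<close> and \<open>I\<close> are supported on the span of \<open>es\<close>,
  and \<open>J\<close> on the span of \<open>f\<close> and \<open>es\<close>. This form of the statement can be used directly to commute operators of
  different blocks.\<close>

definition reversal_data :: "'a \<Rightarrow> complex \<Rightarrow> 'a list \<Rightarrow> ('a \<Rightarrow> complex) \<Rightarrow> ('a \<Rightarrow> 'a) \<Rightarrow> ('a \<Rightarrow> 'a) \<Rightarrow> ('a \<Rightarrow> 'a) \<Rightarrow> bool" where
  "reversal_data f r es \<gamma> D I J \<longleftrightarrow> unitary D \<and> unitary I \<and> unitary J \<and>
    (\<forall>x. D (D x) = diagonal_op es \<gamma> x) \<and> (\<forall>x. I (I x) = x) \<and> (\<forall>x. J (J x) = x) \<and>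
    (\<forall>x. J (crefl f r (D (I (J (crefl f r (D (I x))))))) = x) \<and>
    (\<forall>T. isometry T \<longrightarrow> (\<forall>e\<in>set es. T e = e) \<longrightarrow> (\<forall>x. T (D x) = D (T x) \<and> T (I x) = I (T x))) \<and>
    (\<forall>T. isometry T \<longrightarrow> T f = f \<longrightarrow> (\<forall>e\<in>set es. T e = e) \<longrightarrow> (\<forall>x. T (J x) = J (T x)))"

text \<open>Induction in steps of two. The first plane receives the eigenvalue \<open>cnj r\<close>, matched with the loose eigenvalue
  \<open>r\<close> by a swap, and its other eigenvalue \<open>s\<close> is loose for the rest of the list; the product condition is
  inherited because \<open>s\<^sup>2 = \<gamma> e1 * \<gamma> e2 * r\<^sup>2\<close>. At the end the condition says either \<open>r\<^sup>2 = 1\<close>, so that the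
  loose reflection is already an involution, or that \<open>cnj r\<close> is a square root of the last eigenvalue.\<close>

lemma reversible_chain:
  assumes "orthonormal (f # es)" "\<forall>e\<in>set es. cmod (\<gamma> e) = 1" "cmod r = 1"
    "r\<^sup>2 * prod_list (map \<gamma> es) = 1"
  shows "\<exists>D I J. reversal_data f r es \<gamma> D I J"
  using assms
proof (induction es arbitrary: f r rule: induct_list012)
  case 1
  then have f: "H f f = 1" and r: "r * r = 1" by (auto simp: orthonormal_def power2_eq_square)
  have "crefl f r (crefl f r x) = x" for x using f r by (simp add: crefl_crefl crefl_one)
  then have "reversal_data f r [] \<gamma> id id id"
    by (auto simp: reversal_data_def unitary_id)
  then show ?case by blast
next
  case (2 e)
  then have e: "f \<in> V" "e \<in> V" "H f f = 1" "H e e = 1" "H f e = 0"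
    and g: "r\<^sup>2 * \<gamma> e = 1" and r: "r * cnj r = 1"
    by (auto simp: orthonormal_Cons unimodular)
  have "cnj r * cnj r = (cnj r * cnj r) * (r\<^sup>2 * \<gamma> e)" using g by simp
  also have "\<dots> = (r * cnj r) * (r * cnj r) * \<gamma> e" by (simp add: power2_eq_square algebra_simps)
  finally have rg: "cnj r * cnj r = \<gamma> e" using r by simp
  have r': "cnj r * cnj (cnj r) = 1" using r by (simp add: mult.commute)
  note S = swap_pair_reverses[OF e(3-5) r]
  have "reversal_data f r [e] \<gamma> (crefl e (cnj r)) id (swap_op f e)"
    unfolding reversal_data_def
  proof (intro conjI allI impI)
    show "unitary (crefl e (cnj r))" using e r' by (intro unitary_crefl) auto
    show "unitary id" by (rule unitary_id)
    show "unitary (swap_op f e)" using e S by (intro unitary_swap_op) auto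
    show "crefl e (cnj r) (crefl e (cnj r) x) = diagonal_op [e] \<gamma> x" for x
      using e rg by (simp add: crefl_crefl)
    show "swap_op f e (swap_op f e x) = x" for x
      using swap_op_involutive[of f e] S by (metis comp_apply id_apply)
    show "swap_op f e (crefl f r (crefl e (cnj r) (id (swap_op f e (crefl f r (crefl e (cnj r) (id x))))))) = x" for x
      using S(3)[of x] by simp
    show "T (crefl e (cnj r) x) = crefl e (cnj r) (T x)"
      if "isometry T" "\<forall>e\<in>set [e]. T e = e" for T x
      using that isometry_crefl_conj[of T e "cnj r" x] by simp
    show "T (swap_op f e x) = swap_op f e (T x)"
      if "isometry T" "T f = f" "\<forall>e\<in>set [e]. T e = e" for T x
      using that by (intro isometry_swap_op_conj) auto
  qed simp_all
  then show ?case by blast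
next
  case (3 e1 e2 es)
  then have on: "f \<in> V" "e1 \<in> V" "e2 \<in> V" "H f f = 1" "H e1 e1 = 1" "H e2 e2 = 1" "H f e1 = 0" "H f e2 = 0" "H e1 e2 = 0"
    and es: "orthonormal es" "\<And>e. e \<in> set es \<Longrightarrow> H f e = 0 \<and> H e1 e = 0 \<and> H e2 e = 0"
    and g: "cmod (\<gamma> e1) = 1" "cmod (\<gamma> e2) = 1" "\<forall>e\<in>set es. cmod (\<gamma> e) = 1"
    and r: "r * cnj r = 1" and prod: "r\<^sup>2 * (\<gamma> e1 * (\<gamma> e2 * prod_list (map \<gamma> es))) = 1"
    by (auto simp: orthonormal_Cons unimodular)
  obtain a b I2 f1 f2 s where
    ab: "a\<^sup>2 = \<gamma> e1" "b\<^sup>2 = \<gamma> e2" and I2: "unitary I2" "I2 \<circ> I2 = id"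
    and sp: "f1 \<in> span {e1, e2}" "f2 \<in> span {e1, e2}" and ff: "H f1 f1 = 1" "H f2 f2 = 1" "H f1 f2 = 0"
    and s: "s\<^sup>2 = \<gamma> e1 * \<gamma> e2 * r\<^sup>2"
    and fac0: "crefl e1 a \<circ> crefl e2 b \<circ> I2 = crefl f1 (cnj r) \<circ> crefl f2 s"
    and I2c: "\<And>T x. isometry T \<Longrightarrow> T e1 = e1 \<Longrightarrow> T e2 = e2 \<Longrightarrow> T (I2 x) = I2 (T x)"
    and I2p: "\<And>x. H x e1 = 0 \<Longrightarrow> H x e2 = 0 \<Longrightarrow> I2 x = x"
    using positive_plane[OF on(2,3,5,6,9) g(1,2) "3.prems"(3)] by blast
  have fac: "crefl e1 a (crefl e2 b (I2 x)) = crefl f1 (cnj r) (crefl f2 s x)" for x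
    using fun_cong[OF fac0, of x] by simp
  have I2I2: "I2 (I2 x) = x" for x using fun_cong[OF I2(2), of x] by simp
  have perp_sp: "H v x = 0" if "H e1 x = 0" "H e2 x = 0" "v \<in> span {e1, e2}" for x v
    using that(3) by (rule span_pairE) (use that in \<open>auto simp: H_simps\<close>)
  have spV: "v \<in> V" if "v \<in> span {e1, e2}" for v
    using that on by (auto elim!: span_pairE intro!: V_closed)
  have fix_sp: "T v = v" if "v \<in> span {e1, e2}" "isometry T" "T e1 = e1" "T e2 = e2" for T v
    using linear_op_eq_on_span[OF isometry_linear[OF that(2)] linear_op_id _ that(1)] that by auto
  have e_rev: "H e1 f = 0" "H e2 f = 0" "H e2 e1 = 0" using on H_zero_commute by blast+
  have es_rev: "H e f = 0" "H e e1 = 0" "H e e2 = 0" if "e \<in> set es" for e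
    using es(2)[OF that] H_zero_commute by blast+
  have f1f: "H f1 f = 0" "H f2 f = 0" using perp_sp e_rev sp by blast+
  have ff1: "H f f1 = 0" "H f f2 = 0" "H f2 f1 = 0" using f1f ff H_zero_commute by blast+
  have fe: "H f1 e = 0" "H f2 e = 0" if "e \<in> set es" for e using es(2)[OF that] perp_sp sp by blast+
  have ef: "H e f1 = 0" "H e f2 = 0" if "e \<in> set es" for e using fe[OF that] H_zero_commute by blast+
  have on': "orthonormal (f2 # es)" using es(1) fe(2) ff spV sp by (simp add: orthonormal_Cons)
  have cm: "cmod s = 1"
  proof -
    have "(cmod s)\<^sup>2 = cmod (s\<^sup>2)" by (simp add: norm_power)
    also have "\<dots> = 1" unfolding s using g "3.prems"(3) by (simp add: norm_mult norm_power)
    finally have "(cmod s)\<^sup>2 = 1" .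
    then show ?thesis by (metis norm_ge_zero one_power2 power2_eq_imp_eq zero_le_one)
  qed
  have "s\<^sup>2 * prod_list (map \<gamma> es) = 1" using prod s by (simp add: algebra_simps)
  from "3.IH"(1)[OF on' g(3) cm this] obtain D' I' J' where rd: "reversal_data f2 s es \<gamma> D' I' J'" by blast
  note rd' = rd[unfolded reversal_data_def]
  have D'u: "unitary D'" and I'u: "unitary I'" and J'u: "unitary J'"
    and DD: "\<And>x. D' (D' x) = diagonal_op es \<gamma> x" and II: "\<And>x. I' (I' x) = x" and JJ: "\<And>x. J' (J' x) = x"
    and JR: "\<And>x. J' (crefl f2 s (D' (I' (J' (crefl f2 s (D' (I' x))))))) = x"
    using rd' by blast+
  have cD: "T (D' x) = D' (T x)" and cI: "T (I' x) = I' (T x)" if "isometry T" "\<And>e. e \<in> set es \<Longrightarrow> T e = e" for T x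
    using rd' that by blast+
  have cJ: "T (J' x) = J' (T x)" if "isometry T" "T f2 = f2" "\<And>e. e \<in> set es \<Longrightarrow> T e = e" for T x
    using rd' that by blast
  have ca: "a * cnj a = 1" "b * cnj b = 1"
  proof -
    have "(cmod a)\<^sup>2 = 1" "(cmod b)\<^sup>2 = 1" using ab g by (metis norm_power)+
    then show "a * cnj a = 1" "b * cnj b = 1" by (metis complex_norm_square of_real_1)+
  qed
  have r': "cnj r * cnj (cnj r) = 1" using r by (simp add: mult.commute)
  define S where "S = swap_op f f1"
  define P where "P = crefl f r \<circ> crefl f1 (cnj r)"
  note Sp = swap_pair_reverses[OF on(4) ff(1) ff1(1) r, folded S_def P_def]
  have Su: "unitary S" unfolding S_def using on spV sp Sp by (intro unitary_swap_op) auto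
  have SS: "S (S x) = x" for x
    using swap_op_involutive[of f f1] Sp by (metis S_def comp_apply id_apply)
  have S_es: "S e = e" if "e \<in> set es" for e
    unfolding S_def by (rule swap_op_orth) (use es_rev ef that in auto)
  have S_f2: "S f2 = f2" unfolding S_def by (rule swap_op_orth) (use f1f ff1 in auto)
  have Pu: "unitary P" unfolding P_def
    by (intro unitary_comp unitary_crefl) (use on ff r r' spV sp in auto)
  have P_es: "P e = e" if "e \<in> set es" for e
    using es_rev ef that by (simp add: P_def crefl_orth)
  have P_f2: "P f2 = f2" using f1f ff1 by (simp add: P_def crefl_orth)
  have I2_es: "I2 e = e" if "e \<in> set es" for e using I2p es_rev that by blast
  have c_es: "crefl e1 z e = e" "crefl e2 z e = e" if "e \<in> set es" for e z
    using es_rev that by (simp_all add: crefl_orth)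
  have iso: "isometry S" "isometry P" "isometry I2" "isometry (crefl e1 a)" "isometry (crefl e2 b)"
    using Su Pu I2 on ca by (auto simp: unitary_isometry isometry_crefl)
  define D where "D = crefl e1 a \<circ> crefl e2 b \<circ> D'"
  define I where "I = I2 \<circ> I'"
  define J where "J = S \<circ> J'"
  have R: "crefl f r (D (I x)) = P (crefl f2 s (D' (I' x)))" for x
  proof -
    have "D' (I2 y) = I2 (D' y)" for y using cD[OF iso(3)] I2_es by simp
    then show ?thesis by (simp add: D_def I_def P_def fac)
  qed
  have move: "J' (S x) = S (J' x)" "J' (P x) = P (J' x)" "D' (S x) = S (D' x)" "D' (P x) = P (D' x)"
     "I' (S x) = S (I' x)" "I' (P x) = P (I' x)" for x
    using cJ[OF iso(1)] cJ[OF iso(2)] cD[OF iso(1)] cD[OF iso(2)] cI[OF iso(1)] cI[OF iso(2)]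
      S_f2 S_es P_f2 P_es by auto
  have movef: "crefl f2 s (S x) = S (crefl f2 s x)" "crefl f2 s (P x) = P (crefl f2 s x)" for x
    using isometry_crefl_conj[OF iso(1), of f2 s x] isometry_crefl_conj[OF iso(2), of f2 s x] S_f2 P_f2 by auto
  have "reversal_data f r (e1 # e2 # es) \<gamma> D I J"
    unfolding reversal_data_def
  proof (intro conjI allI impI)
    show "unitary D" unfolding D_def using on ca D'u by (intro unitary_comp unitary_crefl) auto
    show "unitary I" unfolding I_def using I2 I'u by (intro unitary_comp)
    show "unitary J" unfolding J_def using Su J'u by (intro unitary_comp)
    show "D (D x) = diagonal_op (e1 # e2 # es) \<gamma> x" for x
    proof -
      have "crefl e1 a (D' y) = D' (crefl e1 a y)" "crefl e2 b (D' y) = D' (crefl e2 b y)" for y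
        using cD[OF iso(4)] cD[OF iso(5)] c_es by auto
      then have "D (D x) = crefl e1 a (crefl e2 b (crefl e1 a (crefl e2 b (D' (D' x)))))"
        by (simp add: D_def)
      also have "crefl e2 b (crefl e1 a y) = crefl e1 a (crefl e2 b y)" for y
        by (rule crefl_commute) (use on e_rev ca in auto)
      then have "crefl e1 a (crefl e2 b (crefl e1 a (crefl e2 b (D' (D' x))))) =
         crefl e1 a (crefl e1 a (crefl e2 b (crefl e2 b (D' (D' x)))))" by simp
      also have "\<dots> = crefl e1 (a\<^sup>2) (crefl e2 (b\<^sup>2) (D' (D' x)))"
        using on by (simp add: crefl_crefl power2_eq_square)
      finally show ?thesis by (simp add: ab DD)
    qed
    show "I (I x) = x" for x
    proof -
      have "I' (I2 y) = I2 (I' y)" for y using cI[OF iso(3)] I2_es by simp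
      then show ?thesis by (simp add: I_def II I2I2)
    qed
    show "J (J x) = x" for x by (simp add: J_def move SS JJ)
    show "J (crefl f r (D (I (J (crefl f r (D (I x))))))) = x" for x
    proof -
      have "J (crefl f r (D (I (J (crefl f r (D (I x)))))))
         = S (P (S (P (J' (crefl f2 s (D' (I' (J' (crefl f2 s (D' (I' x)))))))))))"
        by (simp add: R J_def move movef)
      then show ?thesis by (simp add: JR Sp(3))
    qed
  next
    fix T x assume T: "isometry T" "\<forall>e\<in>set (e1 # e2 # es). T e = e"
    have T': "T (D' y) = D' (T y)" "T (I' y) = I' (T y)" for y using cD[of T y] cI[of T y] T by auto
    show "T (D x) = D (T x)"
      using T isometry_crefl_conj[OF T(1)] by (simp add: D_def T')
    show "T (I x) = I (T x)" using I2c[OF T(1)] T by (simp add: I_def T')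
  next
    fix T x assume T: "isometry T" "T f = f" "\<forall>e\<in>set (e1 # e2 # es). T e = e"
    have fx: "T f1 = f1" "T f2 = f2" using fix_sp sp T by auto
    then have "T (J' y) = J' (T y)" for y using cJ[of T y] T by auto
    then show "T (J x) = J (T x)"
      using isometry_swap_op_conj[of T f f1] T fx by (simp add: J_def S_def)
  qed
  then show ?case by blast
qed

end

section \<open>From a reversible block to a square root\<close>

context lorentz_space_det
begin

lemma eq_on_V:
  assumes "orthonormal es" "linear_op A" "linear_op B" "\<And>e. e \<in> set es \<Longrightarrow> A e = B e"
    "\<And>w. w \<in> perp es \<Longrightarrow> A w = B w" "v \<in> V"
  shows "A v = B v"
proof -
  define p where "p = (\<Sum>e\<in>set es. H v e *s e)"
  have "A p = B p" unfolding p_def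
    using assms(2-4) by (simp add: linear_op_sum linear_op_scale cong: sum.cong)
  moreover have "A (v - p) = B (v - p)"
    using minus_projection_in_perp[OF assms(1,6)] assms(5) by (simp add: p_def)
  ultimately have "A (p + (v - p)) = B (p + (v - p))" using assms(2,3) by (simp only: linear_op_add)
  then show ?thesis by simp
qed

lemma unitary_diagonal_op:
  assumes "orthonormal es" "\<forall>e\<in>set es. cmod (\<gamma> e) = 1"
  shows "unitary (diagonal_op es \<gamma>) \<and> dt (diagonal_op es \<gamma>) = prod_list (map \<gamma> es) \<and>
    (\<forall>e\<in>set es. diagonal_op es \<gamma> e = \<gamma> e *s e) \<and> (\<forall>w. (\<forall>e\<in>set es. H w e = 0) \<longrightarrow> diagonal_op es \<gamma> w = w)"
  using assms
proof (induction es)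
  case Nil
  show ?case using unitary_id dt_id by (simp add: id_def)
next
  case (Cons e es)
  then have e: "e \<in> V" "H e e = 1" "\<And>f. f \<in> set es \<Longrightarrow> H e f = 0" "orthonormal es" "\<gamma> e * cnj (\<gamma> e) = 1"
    by (auto simp: orthonormal_Cons unimodular)
  note IH = Cons.IH[OF e(4)]
  have IH': "unitary (diagonal_op es \<gamma>)" "dt (diagonal_op es \<gamma>) = prod_list (map \<gamma> es)"
    "\<And>f. f \<in> set es \<Longrightarrow> diagonal_op es \<gamma> f = \<gamma> f *s f" "\<And>w. (\<And>f. f \<in> set es \<Longrightarrow> H w f = 0) \<Longrightarrow> diagonal_op es \<gamma> w = w"
    using IH Cons.prems by auto
  have u: "unitary (crefl e (\<gamma> e))" using e by (intro unitary_crefl) auto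
  have fe: "H f e = 0" if "f \<in> set es" for f using e(3)[OF that] H_zero_commute by blast
  show ?case
    using dt_unitary_comp[OF u IH'(1)] unitary_comp[OF u IH'(1)] e IH' fe
    by (auto simp: dt_crefl crefl_self crefl_orth linear_op_scale[OF linear_op_crefl] o_def)
qed

definition three_involution_root :: "('a \<Rightarrow> 'a) \<Rightarrow> bool" where
  "three_involution_root g \<longleftrightarrow> (\<exists>A B C. unitary A \<and> unitary B \<and> unitary C \<and>
     (\<forall>v\<in>V. A (A v) = v \<and> B (B v) = v \<and> C (C v) = v \<and> A (B (C (A (B (C v))))) = g v))"

text \<open>A root \<open>h\<close> on the block with \<open>h I = Q (crefl f s)\<close>, where \<open>J\<close> inverts \<open>Q\<close>, is continued by a chain on the
  eigenlines \<open>es\<close> that starts with the loose eigenvalue \<open>s\<close> at \<open>f\<close>. The product condition of the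
  chain holds because \<open>dt g = 1\<close> and because \<open>I\<close> and \<open>Q\<close> have determinant \<open>\<plusminus>1\<close>, so that \<open>s\<^sup>2 = (dt h)\<^sup>2\<close>.\<close>

lemma root_from_block:
  assumes g: "unitary g" "dt g = 1"
    and es: "orthonormal es" "\<And>e. e \<in> set es \<Longrightarrow> g e = \<gamma> e *s e"
    and u: "unitary h" "unitary I" "unitary J" "unitary Q"
    and f: "f \<in> perp es" "H f f = 1" and s: "cmod s = 1"
    and fix_es: "\<And>e. e \<in> set es \<Longrightarrow> h e = e \<and> I e = e \<and> J e = e \<and> Q e = e" and fix_f: "J f = f" "Q f = f"
    and inv: "\<And>x. x \<in> V \<Longrightarrow> I (I x) = x" "\<And>x. x \<in> V \<Longrightarrow> J (J x) = x" "\<And>x. x \<in> V \<Longrightarrow> J (Q (J (Q x))) = x"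
    and fac: "\<And>x. x \<in> V \<Longrightarrow> h (I x) = Q (crefl f s x)"
    and root: "\<And>w. w \<in> perp es \<Longrightarrow> h (h w) = g w"
  shows "three_involution_root g"
proof -
  have es': "e \<in> V" "H e e = 1" if "e \<in> set es" for e using es(1) that by (auto simp: orthonormal_def)
  have \<gamma>: "\<forall>e\<in>set es. cmod (\<gamma> e) = 1"
    using eigenvalue_unimodular[OF unitary_isometry[OF g(1)] es(2)] es' by (auto simp: unimodular)
  note dg = unitary_diagonal_op[OF es(1) \<gamma>]
  have dgu: "unitary (diagonal_op es \<gamma>)" using dg by blast
  have hh: "h (h (diagonal_op es \<gamma> v)) = g v" if "v \<in> V" for v
  proof -
    have "(h \<circ> h \<circ> diagonal_op es \<gamma>) v = g v"
    proof (rule eq_on_V[OF es(1) _ _ _ _ that])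
      show "linear_op (h \<circ> h \<circ> diagonal_op es \<gamma>)" "linear_op g"
        using u(1) g(1) dgu by (simp_all add: unitary_linear unitary_comp)
      show "(h \<circ> h \<circ> diagonal_op es \<gamma>) e = g e" if "e \<in> set es" for e
        using dg that fix_es es(2) by (simp add: linear_op_scale[OF unitary_linear[OF u(1)]])
      show "(h \<circ> h \<circ> diagonal_op es \<gamma>) w = g w" if "w \<in> perp es" for w
        using dg that root by (simp add: perp_def)
    qed
    then show ?thesis by simp
  qed
  have fV: "f \<in> V" "\<And>e. e \<in> set es \<Longrightarrow> H f e = 0" using f by (auto simp: perp_def)
  have s1: "s * cnj s = 1" using s by (simp add: unimodular)
  have cu: "unitary (crefl f s)" using fV f s1 by (intro unitary_crefl) auto
  have "(dt h)\<^sup>2 * prod_list (map \<gamma> es) = 1"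
  proof -
    have "dt (h \<circ> h \<circ> diagonal_op es \<gamma>) = dt g" by (rule dt_cong) (simp add: hh)
    then show ?thesis using g dg u by (simp add: dt_unitary_comp unitary_comp power2_eq_square)
  qed
  moreover have "(dt h)\<^sup>2 = s\<^sup>2"
  proof -
    have sq: "(dt T)\<^sup>2 = 1" if "unitary T" "\<And>x. x \<in> V \<Longrightarrow> T (T x) = x" for T
    proof -
      have "dt (T \<circ> T) = dt id" by (rule dt_cong) (simp add: that)
      then show ?thesis using that by (simp add: dt_unitary_comp dt_id power2_eq_square)
    qed
    have "dt (h \<circ> I) = dt (Q \<circ> crefl f s)" by (rule dt_cong) (simp add: fac)
    then have "dt h * dt I = dt Q * s" using u cu f fV by (simp add: dt_unitary_comp dt_crefl)
    moreover have "(dt I)\<^sup>2 = 1" "(dt J)\<^sup>2 = 1" using sq u inv by auto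
    moreover have "(dt (J \<circ> Q))\<^sup>2 = 1" using u inv by (intro sq) (auto intro: unitary_comp)
    then have "(dt J)\<^sup>2 * (dt Q)\<^sup>2 = 1" using u by (simp add: dt_unitary_comp power_mult_distrib)
    ultimately have "(dt Q)\<^sup>2 = 1" "(dt h * dt I)\<^sup>2 = (dt Q * s)\<^sup>2" "(dt I)\<^sup>2 = 1" by simp_all
    then show ?thesis by (simp add: power_mult_distrib)
  qed
  moreover have "orthonormal (f # es)" using es f fV by (simp add: orthonormal_Cons)
  ultimately obtain D I1 J1 where rd: "reversal_data f s es \<gamma> D I1 J1"
    using reversible_chain[of f es \<gamma> s] \<gamma> s by auto
  note rd' = rd[unfolded reversal_data_def]
  have U1: "unitary D" "unitary I1" "unitary J1"
    and DD: "\<And>x. D (D x) = diagonal_op es \<gamma> x" and I1I1: "\<And>x. I1 (I1 x) = x" and J1J1: "\<And>x. J1 (J1 x) = x"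
    and JR: "\<And>x. J1 (crefl f s (D (I1 (J1 (crefl f s (D (I1 x))))))) = x"
    using rd' by blast+
  have cDI: "T (D x) = D (T x)" "T (I1 x) = I1 (T x)" if "isometry T" "\<And>e. e \<in> set es \<Longrightarrow> T e = e" for T x
    using rd' that by blast+
  have cJ: "T (J1 x) = J1 (T x)" if "isometry T" "T f = f" "\<And>e. e \<in> set es \<Longrightarrow> T e = e" for T x
    using rd' that by blast
  have cf: "T (crefl f s x) = crefl f s (T x)" if "isometry T" "T f = f" for T x
    using isometry_crefl_conj[of T f s x] that by simp
  note iso = u[THEN unitary_isometry]
  have mI: "D (I x) = I (D x)" "I1 (I x) = I (I1 x)" "D (h x) = h (D x)" for x
    using cDI[OF iso(1)] cDI[OF iso(2)] fix_es by auto
  have mJ: "D (J x) = J (D x)" "I1 (J x) = J (I1 x)" "J1 (J x) = J (J1 x)" "crefl f s (J x) = J (crefl f s x)" for x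
    using cDI[OF iso(3)] cJ[OF iso(3)] cf[OF iso(3)] fix_es fix_f by auto
  have mQ: "D (Q x) = Q (D x)" "I1 (Q x) = Q (I1 x)" "J1 (Q x) = Q (J1 x)" "crefl f s (Q x) = Q (crefl f s x)" for x
    using cDI[OF iso(4)] cJ[OF iso(4)] cf[OF iso(4)] fix_es fix_f by auto
  define h' I' J' where "h' = h \<circ> D" and "I' = I \<circ> I1" and "J' = J \<circ> J1"
  have uu: "unitary h'" "unitary I'" "unitary J'"
    unfolding h'_def I'_def J'_def using u U1 by (auto intro: unitary_comp)
  note inV = unitary_preserves[OF u(1)] unitary_preserves[OF u(2)] unitary_preserves[OF u(3)]
    unitary_preserves[OF u(4)] unitary_preserves[OF U1(1)] unitary_preserves[OF U1(2)]
    unitary_preserves[OF U1(3)] unitary_preserves[OF cu] unitary_preserves[OF uu(1)]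
    unitary_preserves[OF uu(2)] unitary_preserves[OF uu(3)]
  define R where "R x = Q (crefl f s (D (I1 x)))" for x
  have hI: "h' (I' x) = R x" if "x \<in> V" for x
    using that by (simp add: h'_def I'_def R_def mI fac inV)
  have I'I': "I' (I' x) = x" if "x \<in> V" for x
    using that by (simp add: I'_def mI inv inV I1I1)
  have J'J': "J' (J' x) = x" if "x \<in> V" for x
    using that by (simp add: J'_def mJ inv inV J1J1)
  have JRJR: "J' (R (J' (R x))) = x" if "x \<in> V" for x
    using that by (simp add: J'_def R_def mJ mQ inv inV JR)
  have RV: "R x \<in> V" if "x \<in> V" for x using that by (simp add: R_def inV)
  have hh': "h' (h' x) = g x" if "x \<in> V" for x
    using that hh by (simp add: h'_def mI DD)
  have "unitary (h' \<circ> I' \<circ> J')" using uu by (intro unitary_comp)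
  moreover have "(h' \<circ> I' \<circ> J') ((h' \<circ> I' \<circ> J') x) = x" if x: "x \<in> V" for x
  proof -
    have "(h' \<circ> I' \<circ> J') ((h' \<circ> I' \<circ> J') x) = R (J' (R (J' x)))"
      using x by (simp add: hI inV RV)
    also have "\<dots> = J' (J' (R (J' (R (J' x)))))" using x by (simp add: J'J' RV inV)
    also have "\<dots> = J' (J' x)" using x by (simp add: JRJR inV)
    finally show ?thesis using x by (simp add: J'J')
  qed
  moreover have "(h' \<circ> I' \<circ> J') (J' (I' x)) = h' x" if "x \<in> V" for x
    using that by (simp add: J'J' I'I' inV)
  ultimately show ?thesis unfolding three_involution_root_def using uu I'I' J'J' hh' inV
    by (intro exI[of _ "h' \<circ> I' \<circ> J'"] exI[of _ J'] exI[of _ I']) simp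
qed

text \<open>The vectors \<open>y, u, x\<close> are dual to \<open>x, u, y\<close>, so this is the map that takes \<open>x, u, y\<close> to \<open>x', u', y'\<close> and is
  the identity on their orthogonal complement. Taking \<open>u = u' = 0\<close> gives maps of a hyperbolic plane.\<close>

definition triple_op :: "'a \<Rightarrow> 'a \<Rightarrow> 'a \<Rightarrow> 'a \<Rightarrow> 'a \<Rightarrow> 'a \<Rightarrow> 'a \<Rightarrow> 'a" where
  "triple_op x u y x' u' y' v = v + H v y *s (x' - x) + H v u *s (u' - u) + H v x *s (y' - y)"

lemma span_tripleE:
  assumes "w \<in> span {x, u, y}" obtains a b c where "w = a *s x + b *s u + c *s y"
proof -
  obtain a where "w - a *s x \<in> span {u, y}" using assms unfolding span_insert[of x] by blast
  then obtain b c where "w - a *s x = b *s u + c *s y" by (rule span_pairE)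
  then have "w = a *s x + b *s u + c *s y" by (simp add: diff_eq_eq add_ac)
  then show thesis by (rule that)
qed

lemma triple_op:
  assumes fr: "H x x = 0" "H y y = 0" "H x y = 1" "H x u = 0" "H y u = 0" "u = 0 \<and> u' = 0 \<or> H u u = 1"
    and sp: "x' \<in> span {x, u, y}" "u' \<in> span {x, u, y}" "y' \<in> span {x, u, y}"
    and fr': "H x' x' = 0" "H y' y' = 0" "H x' y' = 1" "H x' u' = 0" "H y' u' = 0" "H u' u' = H u u"
    and V: "x \<in> V" "u \<in> V" "y \<in> V"
  defines "T \<equiv> triple_op x u y x' u' y'"
  shows "unitary T" "T x = x'" "T u = u'" "T y = y'"
    "\<And>v. H v x = 0 \<Longrightarrow> H v u = 0 \<Longrightarrow> H v y = 0 \<Longrightarrow> T v = v"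
proof -
  have rev: "H y x = 1" "H u x = 0" "H u y = 0" using fr H_cross by blast+
  have rev': "H y' x' = 1" "H u' x' = 0" "H u' y' = 0" using fr' H_cross by blast+
  have lin: "linear_op T"
    by (auto simp: T_def triple_op_def linear_op_def H_simps scale_left_distrib scale_right_distrib
       scale_right_diff_distrib scale_left_diff_distrib algebra_simps)
  have spV: "v \<in> V" if "v \<in> span {x, u, y}" for v
    using that V by (auto elim!: span_tripleE intro!: V_closed)
  have pr: "preserves T" using V sp spV by (auto simp: preserves_def T_def triple_op_def intro!: V_closed)
  have "H (T v) (T w) = H v w" for v w
  proof -
    define z where "z v = v - (H v y *s x + H v u *s u + H v x *s y)" for v
    have z0: "H (z v) x = 0" "H (z v) u = 0" "H (z v) y = 0" for v
      using fr rev by (auto simp: z_def H_simps)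
    have zs: "H (z v) t = 0" if "t \<in> span {x, u, y}" for v t
      using that by (rule span_tripleE) (simp add: H_simps z0)
    have zs': "H t (z v) = 0" if "t \<in> span {x, u, y}" for v t
      using zs[OF that] H_zero_commute by blast
    have v: "v = z v + (H v y *s x + H v u *s u + H v x *s y)" for v by (simp add: z_def)
    have Tv: "T v = z v + (H v y *s x' + H v u *s u' + H v x *s y')" for v
      by (simp add: z_def T_def triple_op_def scale_right_diff_distrib algebra_simps)
    have inS: "x \<in> span {x, u, y}" "u \<in> span {x, u, y}" "y \<in> span {x, u, y}" by (auto intro: span_base)
    define a b c a' b' c' where abc: "a = H v y" "b = H v u" "c = H v x" "a' = H w y" "b' = H w u" "c' = H w x"
    have "H (T v) (T w) = H (z v) (z w) + (a * cnj c' + b * cnj b' * H u u + c * cnj a')"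
      unfolding Tv abc[symmetric] by (simp add: H_simps fr' rev' zs[OF sp(1)] zs[OF sp(2)] zs[OF sp(3)] zs'[OF sp(1)] zs'[OF sp(2)] zs'[OF sp(3)])
    moreover have "H v w = H (z v) (z w) + (a * cnj c' + b * cnj b' * H u u + c * cnj a')"
      by (subst v[of v], subst v[of w], unfold abc[symmetric])
        (use fr in \<open>simp add: H_simps rev zs[OF inS(1)] zs[OF inS(2)] zs[OF inS(3)] zs'[OF inS(1)] zs'[OF inS(2)] zs'[OF inS(3)]\<close>)
    ultimately show ?thesis by simp
  qed
  then show "unitary T" using lin pr by (simp add: unitary_def isometry_def)
  show "T x = x'" "T u = u'" "T y = y'"
    using fr rev by (auto simp: T_def triple_op_def)
  show "T v = v" if "H v x = 0" "H v u = 0" "H v y = 0" for v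
    using that by (simp add: T_def triple_op_def)
qed

lemma unitary_perp:
  assumes "unitary h" "\<And>e. e \<in> set es \<Longrightarrow> h e = e" "x \<in> perp es"
  shows "h x \<in> perp es"
proof -
  have "H (h x) e = 0" if "e \<in> set es" for e
    using isometry_H[OF unitary_isometry[OF assms(1)], of x e] assms(2)[OF that] assms(3) that
    by (simp add: perp_def)
  then show ?thesis using assms unitary_preserves by (simp add: perp_def)
qed

text \<open>Let \<open>I\<close> swap \<open>v = h w\<close> and \<open>w\<close>; this is possible since their product is real. Then \<open>h I\<close> fixes the negative
  vector \<open>v\<close>, hence it preserves the positive line orthogonal to \<open>v\<close> in the plane and is a complex reflection.\<close>

lemma plane_block:
  assumes es: "orthonormal es" and h: "unitary h" "\<And>e. e \<in> set es \<Longrightarrow> h e = e"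
    and pq: "p \<in> perp es" "p \<noteq> 0" "Re (H p p) \<ge> 0" "perp es \<subseteq> span {p, q}"
    and w: "w \<in> perp es" "Re (H w w) < 0" "Im (H (h w) w) = 0"
  shows "\<exists>I f s. unitary I \<and> (\<forall>x. I (I x) = x) \<and> (\<forall>e\<in>set es. I e = e) \<and> f \<in> perp es \<and> H f f = 1 \<and>
    cmod s = 1 \<and> (\<forall>x\<in>V. h (I x) = crefl f s x)"
proof -
  have hp: "h x \<in> perp es" if "x \<in> perp es" for x
    by (rule unitary_perp[OF h that])
  define v where "v = h w"
  have v: "v \<in> perp es" "H v v = H w w" using hp w isometry_H[OF unitary_isometry[OF h(1)]] by (auto simp: v_def)
  have V: "v \<in> V" "w \<in> V" "p \<in> V" using v w pq perp_subset by blast+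
  have vw: "H v w = H w v" using w(3) real_conj_eq by (simp add: v_def)
  have nz: "H (v - w) (v - w) \<noteq> 0" if "v \<noteq> w"
  proof
    assume 0: "H (v - w) (v - w) = 0"
    have "H (v - w) (v - w) = - 2 * H (v - w) w" using v vw by (simp add: H_simps)
    then have "H (v - w) w = 0" using 0 by simp
    then have "Re (H (v - w) (v - w)) > 0"
      using positive_on_negative_perp[of w "v - w"] V w that by (simp add: V_closed)
    then show False using 0 by simp
  qed
  define I where "I = swap_op v w"
  have I: "unitary I" "\<And>x. I (I x) = x" "I v = w"
    unfolding I_def using unitary_swap_op[OF V(1,2) nz] swap_op_involutive[OF nz, THEN fun_cong] swap_op_left[of v w] v vw nz
    by auto
  have I_es: "I e = e" if "e \<in> set es" for e
    unfolding I_def by (rule swap_op_orth) (use v w that in \<open>simp_all add: perp_def H_zero_commute[of e]\<close>)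
  define R where "R = h \<circ> I"
  have R: "unitary R" unfolding R_def using h I by (intro unitary_comp)
  have R_es: "R e = e" if "e \<in> set es" for e using that I_es h by (simp add: R_def)
  have Rv: "R v = v" using I by (simp add: R_def v_def)
  have Rp: "R x \<in> perp es" if "x \<in> perp es" for x
    by (rule unitary_perp[OF R R_es that])
  have vv: "H v v \<noteq> 0" "Re (H v v) < 0" using v w by auto
  define f0 where "f0 = p - (H p v / H v v) *s v"
  have f0v: "H f0 v = 0" using vv by (simp add: f0_def H_simps)
  have f0p: "f0 \<in> perp es" unfolding f0_def using pq v subspace_perp
    by (intro subspace_diff subspace_scale) auto
  have "f0 \<noteq> 0"
  proof
    assume "f0 = 0"
    then obtain k where k: "p = k *s v" by (auto simp: f0_def)
    then have "H p p = of_real ((cmod k)\<^sup>2 * Re (H v v))"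
      using H_self_of_real[of v] by (simp add: H_simps complex_norm_square mult.assoc del: of_real_power)
    moreover have "k \<noteq> 0" using k pq by auto
    ultimately show False using pq vv by (simp add: zero_le_mult_iff)
  qed
  then have "Re (H f0 f0) > 0"
    using positive_on_negative_perp[of v f0] V vv f0v f0p perp_subset by blast
  then obtain k where k: "H (k *s f0) (k *s f0) = 1" using unit_multiple by blast
  define f where "f = k *s f0"
  have f: "H f f = 1" "f \<in> perp es" "H f v = 0"
    using k f0v f0p subspace_scale[OF subspace_perp] by (auto simp: f_def H_simps)
  then have vf: "H v f = 0" using H_zero_commute by blast
  have line: "y = H y f *s f" if y: "y \<in> perp es" "H y v = 0" for y
  proof (rule ccontr)
    define y' where "y' = y - H y f *s f"
    assume "y \<noteq> H y f *s f"
    then have y0: "y' \<noteq> 0" by (simp add: y'_def)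
    have y': "y' \<in> perp es" "H y' v = 0" "H y' f = 0"
      using y f subspace_perp by (auto simp: y'_def H_simps intro: subspace_diff subspace_scale)
    have yr: "H v y' = 0" "H f y' = 0" using y' H_zero_commute by blast+
    have "Re (H y' y') > 0"
      using positive_on_negative_perp[of v y'] V vv y' y0 perp_subset by blast
    then have yy: "H y' y' \<noteq> 0" by auto
    have "independent {v, f, y'}"
      by (rule orthogonal_independent) (use vv f vf y' yr yy in auto)
    then have "card {v, f, y'} \<le> card {p, q}"
      using v f y' pq by (intro independent_span_bound[THEN conjunct2]) auto
    also have "\<dots> \<le> 2" by (simp add: card_insert_if)
    finally have "card {v, f, y'} \<le> 2" .
    moreover have "v \<noteq> f" "v \<noteq> y'" "f \<noteq> y'" using vv f vf y' yr yy by auto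
    ultimately show False by simp
  qed
  define s where "s = H (R f) f"
  have "H (R f) v = H (R f) (R v)" by (simp add: Rv)
  also have "\<dots> = 0" using isometry_H[OF unitary_isometry[OF R]] f by simp
  finally have Rf: "R f = s *s f" using line[OF Rp[OF f(2)]] by (simp add: s_def)
  then have "s * cnj s = 1" using eigenvalue_unimodular[OF unitary_isometry[OF R]] f by simp
  then have s: "cmod s = 1" by (simp add: unimodular)
  have "R x = crefl f s x" if "x \<in> V" for x
  proof (rule eq_on_V[OF es unitary_linear[OF R] linear_op_crefl _ _ that])
    show "R e = crefl f s e" if "e \<in> set es" for e
      using R_es that f by (simp add: crefl_orth perp_def H_zero_commute[of e])
    show "R x = crefl f s x" if x: "x \<in> perp es" for x
    proof -
      define a where "a = H x v / H v v"
      have "x - a *s v = H (x - a *s v) f *s f"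
        by (rule line) (use x v vv subspace_perp in \<open>auto simp: a_def H_simps intro: subspace_diff subspace_scale\<close>)
      then obtain b where "x - a *s v = b *s f" by blast
      then have "x = b *s f + a *s v" by (simp add: diff_eq_eq)
      then show ?thesis
        by (simp add: linear_op_simps[OF unitary_linear[OF R]] linear_op_simps[OF linear_op_crefl] Rv Rf crefl_self crefl_orth f vf)
    qed
  qed
  then show ?thesis using I I_es f s
    by (intro exI[of _ I] exI[of _ f] exI[of _ s]) (simp add: R_def)
qed

end

section \<open>Blocks of dimension two\<close>

context lorentz_space_det
begin

lemma unitary_scaled:
  assumes "unitary g" "cmod c = 1" shows "unitary (\<lambda>v. c *s g v)"
proof -
  have "c * cnj c = 1" using assms by (simp add: unimodular)
  moreover have "H (c *s p) (c *s q) = (c * cnj c) * H p q" for p q by (simp add: H_simps)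
  ultimately have k: "H (c *s p) (c *s q) = H p q" for p q by simp
  show ?thesis using assms(1)
    by (auto simp: unitary_def isometry_def linear_op_def preserves_def k scale_right_distrib scale_left_commute
        simp del: scale_scale intro!: V_closed)
qed

lemma eigenvalue_map:
  assumes "orthonormal es" "\<forall>e\<in>set es. \<exists>l. g e = l *s e" "e \<in> set es"
  shows "g e = H (g e) e *s e"
  using assms by (auto simp: orthonormal_def H_simps)

lemma plane_root:
  assumes g: "unitary g" "dt g = 1" and es: "orthonormal es" "\<And>e. e \<in> set es \<Longrightarrow> g e = \<gamma> e *s e"
    and h: "unitary h" "\<And>e. e \<in> set es \<Longrightarrow> h e = e"
    and pq: "p \<in> perp es" "p \<noteq> 0" "Re (H p p) \<ge> 0" "perp es \<subseteq> span {p, q}"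
    and w: "w \<in> perp es" "Re (H w w) < 0" "Im (H (h w) w) = 0"
    and root: "h (h p) = g p" "h (h q) = g q"
  shows "three_involution_root g"
proof -
  obtain I f s where I: "unitary I" "\<And>x. I (I x) = x" "\<And>e. e \<in> set es \<Longrightarrow> I e = e"
    and f: "f \<in> perp es" "H f f = 1" and s: "cmod s = 1" "\<And>x. x \<in> V \<Longrightarrow> h (I x) = crefl f s x"
    using plane_block[OF es(1) h pq w] by blast
  have "h (h v) = g v" if "v \<in> perp es" for v
    using linear_op_eq_on_span[of "h \<circ> h" g "{p, q}" v] root pq(4) that g h
    by (auto simp: unitary_linear unitary_comp)
  then show ?thesis
    by (intro root_from_block[OF g es h(1) I(1) unitary_id unitary_id f s(1)]) (use I h s in auto)
qed

lemma hyperbolic_pair_op: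
  assumes fr: "H x x = 0" "H y y = 0" "H x y = 1" and sp: "x' \<in> span {x, y}" "y' \<in> span {x, y}"
    and fr': "H x' x' = 0" "H y' y' = 0" "H x' y' = 1" and V: "x \<in> V" "y \<in> V"
  shows "\<exists>h. unitary h \<and> h x = x' \<and> h y = y' \<and> (\<forall>v. H v x = 0 \<longrightarrow> H v y = 0 \<longrightarrow> h v = v)"
proof -
  have "span {x, y} \<subseteq> span {x, 0, y}" by (rule span_mono) auto
  then have sp': "x' \<in> span {x, 0, y}" "y' \<in> span {x, 0, y}" using sp by blast+
  have z: "(0::'a) = 0 \<and> (0::'a) = 0 \<or> H 0 0 = 1" by simp
  note t = triple_op[OF fr H_zero_right H_zero_right z sp'(1) span_zero sp'(2) fr' H_zero_right H_zero_right refl V(1) V_closed(4) V(2)]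
  show ?thesis
    by (rule exI, intro conjI allI impI, rule t(1), rule t(2), rule t(4), rule t(5)) simp_all
qed

lemma csqrt_unit: "cmod z = 1 \<Longrightarrow> cmod (csqrt z) = 1"
  by (metis norm_ge_zero norm_power one_power2 power2_csqrt power2_eq_imp_eq zero_le_one)

lemma Re_square: "Re (z\<^sup>2) = (Re z)\<^sup>2 - (Im z)\<^sup>2"
  by (simp add: power2_eq_square)

lemma Re_square_unit: "cmod z = 1 \<Longrightarrow> Re (z\<^sup>2) = 1 - 2 * (Im z)\<^sup>2"
  using cmod_power2[of z] by (simp add: Re_square)

text \<open>With \<open>h e1 = a e1\<close>, \<open>h u = b u\<close> and \<open>w = sqrt p e1 + sqrt (1 + p) u\<close>, the number
  \<open>\<langle>h w, w\<rangle> = p a - (1 + p) b\<close> is real for a suitable \<open>p \<ge> 0\<close> if \<open>a\<close> is chosen with its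
  imaginary part on the same side as that of \<open>b\<close> and \<open>\<bar>Im a\<bar> > \<bar>Im b\<bar>\<close>. For numbers of modulus one this inequality is
  \<open>Re (a\<^sup>2) < Re (b\<^sup>2)\<close>, which is the half-plane condition on \<open>c\<close>.\<close>

lemma elliptic_root:
  assumes g: "unitary g" and es: "orthonormal es" "\<forall>e\<in>set es. \<exists>l. g e = l *s e"
    and u: "u \<in> perp es" "H u u = -1" "g u = l *s u" "perp es \<subseteq> span {u}"
    and e1: "e1 \<in> set es" "g e1 = l1 *s e1"
    and c: "cmod c = 1" "Re (c * (l1 - l)) < 0" "c ^ m * dt g = 1"
  shows "three_involution_root (\<lambda>v. c *s g v)"
proof -
  define es' where "es' = remove1 e1 es"
  have dist: "distinct es" using es by (simp add: orthonormal_def)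
  then have set_es: "set es = insert e1 (set es')" "e1 \<notin> set es'" using e1 by (auto simp: es'_def)
  have es': "orthonormal es'" using es(1) dist by (auto simp: orthonormal_def es'_def)
  have e1V: "e1 \<in> V" "H e1 e1 = 1" "\<And>e. e \<in> set es' \<Longrightarrow> H e1 e = 0"
    using es(1) e1 set_es by (auto simp: orthonormal_def)
  have uV: "u \<in> V" "H u e1 = 0" "\<And>e. e \<in> set es' \<Longrightarrow> H u e = 0" using u(1) set_es by (auto simp: perp_def)
  have e1u: "H e1 u = 0" using uV H_zero_commute by blast
  have mem: "u \<in> perp es'" "e1 \<in> perp es'" using uV e1V by (auto simp: perp_def)
  have rev: "H e u = 0" "H e e1 = 0" if "e \<in> set es'" for e
    using uV(3)[OF that] e1V(3)[OF that] H_zero_commute by blast+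
  have sp: "perp es' \<subseteq> span {e1, u}"
  proof
    fix w assume w: "w \<in> perp es'"
    then have "w - H w e1 *s e1 \<in> perp es"
      using e1V set_es by (auto simp: perp_def H_simps V_closed)
    then obtain a where "w - H w e1 *s e1 = a *s u" using u(4) by (blast elim: span_singletonE)
    then have "w = H w e1 *s e1 + a *s u" by (simp add: diff_eq_eq add.commute)
    then show "w \<in> span {e1, u}" by (rule span_pairI)
  qed
  have l: "cmod l = 1" using eigenvalue_unimodular[OF unitary_isometry[OF g] u(3)] u(2) by (simp add: unimodular)
  have l1: "cmod l1 = 1" using eigenvalue_unimodular[OF unitary_isometry[OF g] e1(2)] e1V by (simp add: unimodular)
  define b where "b = csqrt (c * l)"
  define a where "a = (if Im (csqrt (c * l1)) * Im b \<ge> 0 then csqrt (c * l1) else - csqrt (c * l1))"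
  have ab: "a\<^sup>2 = c * l1" "b\<^sup>2 = c * l" "cmod a = 1" "cmod b = 1"
    using c l l1 by (auto simp: a_def b_def csqrt_unit norm_mult)
  have sg: "Im a * Im b \<ge> 0" by (auto simp: a_def)
  have "Re (a\<^sup>2) < Re (b\<^sup>2)" using c(2) ab by (simp add: algebra_simps)
  then have lt: "(Im b)\<^sup>2 < (Im a)\<^sup>2" using Re_square_unit[OF ab(3)] Re_square_unit[OF ab(4)] by linarith
  define p where "p = Im b / (Im a - Im b)"
  have ne: "Im a \<noteq> Im b" using lt by auto
  have p0: "0 \<le> p"
  proof (cases "Im a > 0")
    case True
    then have "Im b \<ge> 0" using sg by (simp add: zero_le_mult_iff)
    moreover have "Im b < Im a" using lt True using power2_less_imp_less[of "Im b" "Im a"] by simp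
    ultimately show ?thesis by (simp add: p_def)
  next
    case False
    moreover have "Im a \<noteq> 0" using lt by auto
    ultimately have "Im a < 0" by simp
    then have "Im b \<le> 0" using sg by (simp add: zero_le_mult_iff)
    moreover have "- Im b < - Im a" using lt \<open>Im a < 0\<close> using power2_less_imp_less[of "- Im b" "- Im a"] by simp
    ultimately show ?thesis by (simp add: p_def divide_nonpos_neg)
  qed
  have p1: "p * Im a = (1 + p) * Im b" using ne by (simp add: p_def field_simps)
  have un: "a * cnj a = 1" "b * cnj b = 1" using ab by (auto simp: unimodular)
  define h where "h = crefl u b \<circ> crefl e1 a"
  have h: "unitary h" unfolding h_def using un uV e1V u by (intro unitary_comp unitary_crefl) auto
  have he: "h e = e" if "e \<in> set es'" for e using rev that by (simp add: h_def crefl_orth)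
  have hu: "h u = b *s u" "h e1 = a *s e1"
    using u uV e1V e1u by (auto simp: h_def crefl_orth crefl_self linear_op_scale[OF linear_op_crefl])
  define w where "w = of_real (sqrt p) *s e1 + of_real (sqrt (1 + p)) *s u"
  have sq: "complex_of_real (sqrt p) * complex_of_real (sqrt p) = of_real p"
    "complex_of_real (sqrt (1 + p)) * complex_of_real (sqrt (1 + p)) = of_real (1 + p)"
    using p0 by (simp_all flip: of_real_mult)
  have hw: "h w = (a * of_real (sqrt p)) *s e1 + (b * of_real (sqrt (1 + p))) *s u"
    by (simp add: w_def linear_op_simps[OF unitary_linear[OF h]] hu mult.commute)
  have Hh: "H (x *s e1 + y *s u) (x' *s e1 + y' *s u) = x * cnj x' - y * cnj y'" for x y x' y'
    by (simp add: H_simps e1V uV e1u u)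
  have ww: "H w w = -1" unfolding w_def Hh by (simp add: sq)
  have "H (h w) w = a * (of_real (sqrt p) * of_real (sqrt p)) - b * (of_real (sqrt (1 + p)) * of_real (sqrt (1 + p)))"
    unfolding hw unfolding w_def Hh by simp
  then have "Im (H (h w) w) = p * Im a - (1 + p) * Im b" unfolding sq by simp
  then have imw: "Im (H (h w) w) = 0" using p1 by simp
  show ?thesis
  proof (rule plane_root[OF unitary_scaled[OF g c(1)] _ es' _ h he mem(2) _ _ sp])
    show "dt (\<lambda>v. c *s g v) = 1" using c by (simp add: dt_scale)
    show "c *s g e = (c * H (g e) e) *s e" if "e \<in> set es'" for e
      using eigenvalue_map[OF es, of e] that set_es by (metis insertCI scale_scale)
    show "e1 \<noteq> 0" "0 \<le> Re (H e1 e1)" using e1V by auto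
    show "w \<in> perp es'" unfolding w_def using mem subspace_perp by (intro subspace_add subspace_scale)
    show "Re (H w w) < 0" "Im (H (h w) w) = 0" using ww imw by simp_all
    show "h (h e1) = c *s g e1" "h (h u) = c *s g u"
      using ab by (simp_all add: hu linear_op_simps[OF unitary_linear[OF h]] e1 u power2_eq_square)
  qed
qed

text \<open>For \<open>w = z x + y\<close> the imaginary part of \<open>\<langle>h w, w\<rangle>\<close> is that of \<open>(\<sigma> - 1 / \<sigma>) z\<close>. A solution with
  \<open>Re z < 0\<close>, that is, with \<open>w\<close> negative, exists unless \<open>\<sigma> - 1 / \<sigma>\<close> is imaginary, that is, unless \<open>\<sigma>\<close> is.\<close>

lemma loxodromic_root:
  assumes g: "unitary g" and es: "orthonormal es" "\<forall>e\<in>set es. \<exists>l. g e = l *s e"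
    and xy: "x \<in> perp es" "y \<in> perp es" "H x x = 0" "H y y = 0" "H x y = 1"
    and l: "l \<noteq> 0" "cmod l \<noteq> 1" "g x = l *s x" "g y = (1 / cnj l) *s y" and sp: "perp es \<subseteq> span {x, y}"
    and c: "cmod c = 1" "Re (c * (- l)) < 0" "c ^ m * dt g = 1"
  shows "three_involution_root (\<lambda>v. c *s g v)"
proof -
  have yx: "H y x = 1" using xy H_cross by blast
  define \<sigma> where "\<sigma> = csqrt (c * l)"
  have s2: "\<sigma>\<^sup>2 = c * l" by (simp add: \<sigma>_def)
  have c0: "c \<noteq> 0" using c by auto
  then have s0: "\<sigma> \<noteq> 0" using s2 l by auto
  have "(cmod \<sigma>)\<^sup>2 = cmod l" using s2 c by (simp add: norm_mult flip: norm_power)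
  then have s1: "(cmod \<sigma>)\<^sup>2 \<noteq> 1" using l by simp
  have "Re (\<sigma>\<^sup>2) > 0" using c s2 by simp
  then have re: "Re \<sigma> \<noteq> 0" by (auto simp: Re_square)
  define k where "k = Re (\<sigma> - 1 / \<sigma>)"
  have "k = Re \<sigma> * (1 - 1 / (cmod \<sigma>)\<^sup>2)"
    by (simp add: k_def Re_divide' cmod_power2 algebra_simps)
  moreover have "1 - 1 / (cmod \<sigma>)\<^sup>2 \<noteq> 0" using s1 s0 by simp
  ultimately have k0: "k \<noteq> 0" using re by simp
  have V: "x \<in> V" "y \<in> V" using xy perp_subset by blast+
  have "\<exists>h. unitary h \<and> h x = \<sigma> *s x \<and> h y = (1 / cnj \<sigma>) *s y \<and> (\<forall>v. H v x = 0 \<longrightarrow> H v y = 0 \<longrightarrow> h v = v)"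
  proof (rule hyperbolic_pair_op[OF xy(3-5) _ _ _ _ _ V])
    show "\<sigma> *s x \<in> span {x, y}" "(1 / cnj \<sigma>) *s y \<in> span {x, y}"
      by (rule span_scale, rule span_base, simp)+
    show "H (\<sigma> *s x) (\<sigma> *s x) = 0" "H ((1 / cnj \<sigma>) *s y) ((1 / cnj \<sigma>) *s y) = 0"
      "H (\<sigma> *s x) ((1 / cnj \<sigma>) *s y) = 1" using xy s0 by (simp_all add: H_scale_left H_scale_right)
  qed
  then obtain h where h: "unitary h" "h x = \<sigma> *s x" "h y = (1 / cnj \<sigma>) *s y"
    and h_perp: "\<And>v. H v x = 0 \<Longrightarrow> H v y = 0 \<Longrightarrow> h v = v" by blast
  note lh = linear_op_simps[OF unitary_linear[OF h(1)]]
  have he: "h e = e" if "e \<in> set es" for e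
    by (rule h_perp) (use xy that in \<open>simp_all add: perp_def H_zero_commute[of e]\<close>)
  define z where "z = - of_real k * cnj (\<sigma> - 1 / \<sigma>)"
  define w where "w = z *s x + y"
  have ww: "H w w = z + cnj z" by (simp add: w_def H_simps xy yx)
  have "Re (- of_real k * cnj v) = - (k * Re v)" for v by simp
  then have rz: "Re z = - (k * k)" by (simp only: z_def k_def)
  have hw: "H (h w) w = \<sigma> * z + cnj (z / \<sigma>)"
    by (simp add: w_def lh h H_simps xy yx mult.commute)
  have "Im (H (h w) w) = Im ((\<sigma> - 1 / \<sigma>) * z)"
    unfolding hw by (simp add: left_diff_distrib del: complex_cnj_divide)
  also have "(\<sigma> - 1 / \<sigma>) * z = - of_real k * ((\<sigma> - 1 / \<sigma>) * cnj (\<sigma> - 1 / \<sigma>))"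
    by (simp add: z_def mult.commute mult.left_commute)
  also have "\<dots> = of_real (- k * (cmod (\<sigma> - 1 / \<sigma>))\<^sup>2)"
    by (simp only: complex_norm_square[symmetric] of_real_mult of_real_minus)
  finally have im: "Im (H (h w) w) = 0" by simp
  show ?thesis
  proof (rule plane_root[OF unitary_scaled[OF g c(1)] _ es(1) _ h(1) he xy(1) _ _ sp])
    show "dt (\<lambda>v. c *s g v) = 1" using c by (simp add: dt_scale)
    show "c *s g e = (c * H (g e) e) *s e" if "e \<in> set es" for e
      using eigenvalue_map[OF es, of e] that by (metis scale_scale)
    show "x \<noteq> 0" "0 \<le> Re (H x x)" using xy by auto
    show "w \<in> perp es" unfolding w_def using xy subspace_perp by (intro subspace_add subspace_scale)
    show "Re (H w w) < 0" "Im (H (h w) w) = 0" using ww im rz k0 not_square_less_zero[of k] by (simp_all add: less_le)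
    show "h (h x) = c *s g x" using s2 by (simp add: h lh l power2_eq_square)
    have "c * cnj c = 1" using c by (simp add: unimodular)
    then have "1 / cnj c = c" using c0 by (simp add: field_simps)
    have "(1 / cnj \<sigma>) * (1 / cnj \<sigma>) = 1 / cnj (\<sigma>\<^sup>2)" by (simp add: power2_eq_square)
    also have "\<dots> = (1 / cnj c) * (1 / cnj l)" unfolding s2 by simp
    finally have "(1 / cnj \<sigma>) * (1 / cnj \<sigma>) = c * (1 / cnj l)" unfolding \<open>1 / cnj c = c\<close> .
    then show "h (h y) = c *s g y" by (simp only: h(3) lh l(4) scale_scale)
  qed
qed

text \<open>For \<open>w = y - q x\<close> one finds \<open>\<langle>h w, w\<rangle> = b (\<i> t / 2 - 2 q)\<close>. It is real for
  \<open>q = t Re b / (4 Im b)\<close>, and \<open>w\<close> is negative if this is positive, that is, if \<open>t Im (b\<^sup>2) > 0\<close>.\<close>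

lemma parabolic2_root:
  assumes g: "unitary g" and es: "orthonormal es" "\<forall>e\<in>set es. \<exists>l. g e = l *s e"
    and xy: "x \<in> perp es" "y \<in> perp es" "H x x = 0" "H y y = 0" "H x y = 1"
    and l: "l * cnj l = 1" "g x = l *s x" "g y = l *s (y + (\<i> * of_real t) *s x)" and sp: "perp es \<subseteq> span {x, y}"
    and c: "cmod c = 1" "Re (c * (\<i> * of_real t * l)) < 0" "c ^ m * dt g = 1"
  shows "three_involution_root (\<lambda>v. c *s g v)"
proof -
  have yx: "H y x = 1" using xy H_cross by blast
  define b where "b = csqrt (c * l)"
  have b2: "b * b = c * l" by (simp add: b_def flip: power2_eq_square)
  have "cmod l = 1" using l(1) unimodular by blast
  then have "cmod (c * l) = 1" using c(1) by (simp add: norm_mult)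
  then have b1: "b * cnj b = 1" using csqrt_unit by (simp add: b_def flip: unimodular)
  have "Re (c * (\<i> * of_real t * l)) = - t * Im (c * l)" by (simp add: algebra_simps)
  also have "Im (c * l) = 2 * (Re b * Im b)" unfolding b2[symmetric] by simp
  also have "- t * (2 * (Re b * Im b)) = - 2 * (t * (Re b * Im b))" by simp
  finally have pos: "t * (Re b * Im b) > 0" using c(2) by linarith
  define q where "q = t * Re b / (4 * Im b)"
  have imb: "Im b \<noteq> 0" using pos by auto
  have "q = t * (Re b * Im b) / (4 * (Im b)\<^sup>2)" using imb by (simp add: q_def power2_eq_square)
  then have q0: "q > 0" using pos imb by simp
  have V: "x \<in> V" "y \<in> V" using xy perp_subset by blast+
  define k where "k = \<i> * complex_of_real (t / 2)"
  have k: "k + cnj k = 0" "k + k = \<i> * of_real t" by (simp_all add: k_def)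
  have "\<exists>h. unitary h \<and> h x = b *s x \<and> h y = b *s (y + k *s x) \<and> (\<forall>v. H v x = 0 \<longrightarrow> H v y = 0 \<longrightarrow> h v = v)"
  proof (rule hyperbolic_pair_op[OF xy(3-5) _ _ _ _ _ V])
    show "b *s x \<in> span {x, y}" "b *s (y + k *s x) \<in> span {x, y}"
      by (auto intro!: span_scale span_add intro: span_base)
    have "H (y + k *s x) (y + k *s x) = k + cnj k" by (simp add: H_simps xy yx)
    then show "H (b *s (y + k *s x)) (b *s (y + k *s x)) = 0" by (simp add: H_scale_left H_scale_right k)
    show "H (b *s x) (b *s x) = 0" by (simp add: H_scale_left H_scale_right xy)
    have "H (b *s x) (b *s (y + k *s x)) = b * cnj b * H x (y + k *s x)" by (simp add: H_scale_left H_scale_right)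
    also have "H x (y + k *s x) = 1" by (simp add: H_simps xy)
    finally show "H (b *s x) (b *s (y + k *s x)) = 1" using b1 by simp
  qed
  then obtain h where h: "unitary h" "h x = b *s x" "h y = b *s (y + k *s x)"
    and h_perp: "\<And>v. H v x = 0 \<Longrightarrow> H v y = 0 \<Longrightarrow> h v = v" by blast
  note lh = linear_op_simps[OF unitary_linear[OF h(1)]]
  have he: "h e = e" if "e \<in> set es" for e
    by (rule h_perp) (use xy that in \<open>simp_all add: perp_def H_zero_commute[of e]\<close>)
  define w where "w = (- of_real q) *s x + y"
  have ww: "H w w = - of_real (2 * q)" by (simp add: w_def H_simps xy yx)
  have hw: "H (h w) w = b * (k - of_real (2 * q))"
    unfolding w_def by (simp add: lh h H_simps xy yx algebra_simps)
  have "Im (H (h w) w) = t / 2 * Re b - 2 * q * Im b"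
    unfolding hw k_def by (simp add: algebra_simps)
  also have "\<dots> = 0" using imb by (simp add: q_def)
  finally have im: "Im (H (h w) w) = 0" .
  show ?thesis
  proof (rule plane_root[OF unitary_scaled[OF g c(1)] _ es(1) _ h(1) he xy(1) _ _ sp])
    show "dt (\<lambda>v. c *s g v) = 1" using c by (simp add: dt_scale)
    show "c *s g e = (c * H (g e) e) *s e" if "e \<in> set es" for e
      using eigenvalue_map[OF es, of e] that by (metis scale_scale)
    show "x \<noteq> 0" "0 \<le> Re (H x x)" using xy by auto
    show "w \<in> perp es" unfolding w_def using xy subspace_perp by (intro subspace_add subspace_scale)
    show "Re (H w w) < 0" "Im (H (h w) w) = 0" using ww im q0 by simp_all
    show "h (h x) = c *s g x" by (simp add: h lh l b2)
    have "h (h y) = (b * b) *s y + ((b * b) *s (k *s x) + (b * b) *s (k *s x))"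
      by (simp add: h lh scale_right_distrib mult_ac add_ac)
    also have "\<dots> = (b * b) *s (y + (k + k) *s x)"
      by (simp only: scale_left_distrib scale_right_distrib)
    finally show "h (h y) = c *s g y" by (simp add: k(2) b2 l del: mult_2 mult_2_right)
  qed
qed

text \<open>The arguments of the numbers \<open>c z\<close> with \<open>c ^ n * d = 1\<close> are spaced by \<open>2 pi / n\<close>, which is at most \<open>2 pi / 3\<close>.
  So one of them lies in the half-open interval from \<open>2 pi / 3\<close> to \<open>4 pi / 3\<close>, where the cosine is negative.\<close>

lemma rotation_choice:
  assumes "n \<ge> 3" "cmod d = 1" "z \<noteq> 0"
  shows "\<exists>c. cmod c = 1 \<and> c ^ n * d = 1 \<and> Re (c * z) < 0"
proof -
  define \<psi> where "\<psi> = Arg z - Arg d / real n"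
  define k where "k = \<lfloor>(4 * pi / 3 - \<psi>) * real n / (2 * pi)\<rfloor>"
  define \<theta> where "\<theta> = 2 * pi * real_of_int k / real n - Arg d / real n"
  define c where "c = cis \<theta>"
  have n: "real n \<ge> 3" using assms by simp
  have "d \<noteq> 0" using assms(2) by auto
  then have d: "d = cis (Arg d)" using cis_Arg[of d] assms(2) by (simp add: sgn_eq)
  have "real n * \<theta> = 2 * pi * real_of_int k - Arg d" using n by (simp add: \<theta>_def field_simps)
  then have "c ^ n * d = cis (2 * pi * real_of_int k)"
    by (subst d) (simp add: c_def DeMoivre cis_mult)
  also have "\<dots> = 1" by (simp add: cis.ctr complex_eq_iff cos_int_2pin sin_int_2pin)
  finally have cn: "c ^ n * d = 1" .
  have z: "z = of_real (cmod z) * cis (Arg z)" using assms(3) by (simp add: cis_Arg sgn_eq)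
  have "c * z = of_real (cmod z) * cis (\<theta> + Arg z)"
    by (subst z) (simp add: c_def flip: cis_mult)
  then have re: "Re (c * z) = cmod z * cos (\<theta> + Arg z)" by simp
  have th: "\<theta> + Arg z = \<psi> + 2 * pi * real_of_int k / real n" by (simp add: \<theta>_def \<psi>_def)
  have k1: "real_of_int k \<le> (4 * pi / 3 - \<psi>) * real n / (2 * pi)"
    and k2: "(4 * pi / 3 - \<psi>) * real n / (2 * pi) < real_of_int k + 1" by (auto simp: k_def)
  have "2 * pi * real_of_int k / real n \<le> 4 * pi / 3 - \<psi>"
    using k1 n pi_gt_zero by (simp add: field_simps)
  then have up: "\<theta> + Arg z \<le> 4 * pi / 3" using th by simp
  have "4 * pi / 3 - \<psi> < 2 * pi * real_of_int k / real n + 2 * pi / real n"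
    using k2 n pi_gt_zero by (simp add: field_simps)
  moreover have "2 * pi / real n \<le> 2 * pi / 3" using n pi_gt_zero by (simp add: field_simps)
  ultimately have lo: "\<theta> + Arg z > 2 * pi / 3" using th by simp
  have "cos (\<theta> + Arg z) = - cos (\<theta> + Arg z - pi)" by simp
  moreover have "cos (\<theta> + Arg z - pi) > 0"
    by (rule cos_gt_zero_pi) (use up lo pi_gt_zero in linarith)+
  ultimately have "Re (c * z) < 0" using re assms(3) by (simp add: mult_pos_neg)
  moreover have "cmod c = 1" by (simp add: c_def)
  ultimately show ?thesis using cn by blast
qed

end

section \<open>Blocks of dimension three and existence of the root\<close>

context lorentz_space_det
begin

lemma perp_closed:
  "u \<in> perp es \<Longrightarrow> v \<in> perp es \<Longrightarrow> u + v \<in> perp es"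
  "u \<in> perp es \<Longrightarrow> v \<in> perp es \<Longrightarrow> u - v \<in> perp es"
  "u \<in> perp es \<Longrightarrow> c *s u \<in> perp es"
  using subspace_perp by (auto intro: subspace_add subspace_diff subspace_scale)

text \<open>A nonzero vector of the block orthogonal to \<open>X, U, Y\<close> would be positive, so that with \<open>X - Y\<close>, \<open>X + Y\<close> and
  \<open>U\<close> there would be four independent vectors in the span of three.\<close>

lemma three_frame:
  assumes fr: "X \<in> perp es" "U \<in> perp es" "Y \<in> perp es" "H X X = 0" "H Y Y = 0" "H X Y = 1"
      "H X U = 0" "H Y U = 0" "H U U = 1"
    and sp: "perp es \<subseteq> span {p, q, r}" and v: "v \<in> perp es"
  shows "v = H v Y *s X + H v U *s U + H v X *s Y"
proof (rule ccontr)
  have rev: "H Y X = 1" "H U X = 0" "H U Y = 0" using fr H_cross by blast+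
  define w where "w = v - (H v Y *s X + H v U *s U + H v X *s Y)"
  assume "v \<noteq> H v Y *s X + H v U *s U + H v X *s Y"
  then have w0: "w \<noteq> 0" by (simp add: w_def)
  have w: "w \<in> perp es" unfolding w_def using fr v subspace_perp
    by (intro subspace_diff subspace_add subspace_scale) auto
  have wo: "H w X = 0" "H w U = 0" "H w Y = 0" using fr rev by (simp_all add: w_def H_simps)
  then have wr: "H X w = 0" "H U w = 0" "H Y w = 0" using H_zero_commute by blast+
  have mn: "H (X - Y) (X - Y) = -2" "H (X + Y) (X + Y) = 2" "H (X - Y) (X + Y) = 0" "H (X + Y) (X - Y) = 0"
    using fr rev by (simp_all add: H_simps)
  have mem: "X - Y \<in> perp es" "X + Y \<in> perp es"
    using fr subspace_perp by (auto intro: subspace_diff subspace_add)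
  have "Re (H w w) > 0"
    by (rule positive_on_negative_perp[of "X - Y"]) (use mem w w0 wo mn perp_subset in \<open>auto simp: H_diff_right\<close>)
  then have ww: "H w w \<noteq> 0" by auto
  have o: "H (X - Y) U = 0" "H U (X - Y) = 0" "H (X + Y) U = 0" "H U (X + Y) = 0"
    "H (X - Y) w = 0" "H w (X - Y) = 0" "H (X + Y) w = 0" "H w (X + Y) = 0"
    using fr rev wo wr by (simp_all add: H_simps)
  have ne: "a \<noteq> b" if "H a b = 0" "H a a \<noteq> 0" for a b using that by auto
  have "independent {X - Y, X + Y, U, w}"
    by (rule orthogonal_independent) (use mn fr(9) ww wo wr o in auto)
  moreover have "{X - Y, X + Y, U, w} \<subseteq> span {p, q, r}" using mem fr(2) w sp by blast
  ultimately have "card {X - Y, X + Y, U, w} \<le> card {p, q, r}"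
    by (intro independent_span_bound[THEN conjunct2]) auto
  also have "\<dots> \<le> 3" by (simp add: card_insert_if)
  finally have "card {X - Y, X + Y, U, w} \<le> 3" .
  moreover have "X - Y \<noteq> X + Y" "X - Y \<noteq> U" "X - Y \<noteq> w" "X + Y \<noteq> U" "X + Y \<noteq> w" "U \<noteq> w"
    by (rule ne, simp add: mn fr(9) o wr wo, simp add: mn fr(9) ww)+
  ultimately show False by simp
qed

text \<open>Let \<open>I\<close> swap \<open>X = h w\<close> and \<open>2 w\<close>, both isotropic with a real product. Then \<open>R = h I\<close> has \<open>X\<close> as an eigenvector for
  the eigenvalue 2. An isometry of the block with such an eigenvalue is loxodromic: it also has an isotropic eigenvector \<open>Y\<close> for
  \<open>1 / 2\<close> and a positive eigenvector \<open>f\<close> for some \<open>s\<close> of modulus one. The swap of \<open>X\<close> and \<open>Y\<close> inverts \<open>R\<close> up to the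
  reflection in \<open>f\<close>.\<close>

lemma three_block:
  assumes g: "unitary g" "dt g = 1" and es: "orthonormal es" "\<And>e. e \<in> set es \<Longrightarrow> g e = \<gamma> e *s e"
    and h: "unitary h" "\<And>e. e \<in> set es \<Longrightarrow> h e = e"
    and fr: "w \<in> perp es" "u \<in> perp es" "x \<in> perp es" "H w w = 0" "H x x = 0" "H w x = 1"
      "H w u = 0" "H x u = 0" "H u u = 1"
    and sp: "perp es \<subseteq> span {p, q, r}"
    and real: "Im (H (h w) w) = 0" "H (h w) w \<noteq> 0"
    and root: "\<And>v. v \<in> perp es \<Longrightarrow> h (h v) = g v"
  shows "three_involution_root g"
proof -
  note hH = isometry_H[OF unitary_isometry[OF h(1)]]
  define X U Z where "X = h w" and "U = h u" and "Z = h x"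
  have XUZ: "X \<in> perp es" "U \<in> perp es" "Z \<in> perp es" "H X X = 0" "H Z Z = 0" "H X Z = 1"
      "H X U = 0" "H Z U = 0" "H U U = 1"
    using unitary_perp[OF h] fr by (simp_all add: X_def U_def Z_def hH)
  have V: "X \<in> V" "w \<in> V" using XUZ fr perp_subset by blast+
  have Xw: "H X w = H w X" using real(1) real_conj_eq by (simp add: X_def)
  have nz: "H (X - 2 *s w) (X - 2 *s w) \<noteq> 0"
  proof -
    have "H (X - 2 *s w) (X - 2 *s w) = - 4 * H X w" using XUZ fr Xw by (simp add: H_simps)
    then show ?thesis using real(2) by (simp add: X_def)
  qed
  define I where "I = swap_op X (2 *s w)"
  have I: "unitary I" "\<And>v. I (I v) = v" "I X = 2 *s w"
    unfolding I_def using unitary_swap_op[of X "2 *s w"] V nz swap_op_involutive[of X "2 *s w", THEN fun_cong]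
      swap_op_left[of X "2 *s w"] XUZ fr Xw by (auto simp: H_scale_left H_scale_right V_closed)
  have esp: "H e v = 0" if "e \<in> set es" "v \<in> perp es" for e v
    using that by (simp add: perp_def H_zero_commute[of e])
  have I_es: "I e = e" if "e \<in> set es" for e
    unfolding I_def by (rule swap_op_orth) (use that XUZ fr esp in \<open>simp_all add: H_scale_right\<close>)
  define R where "R = h \<circ> I"
  have R: "unitary R" unfolding R_def using h I by (intro unitary_comp)
  note lR = linear_op_simps[OF unitary_linear[OF R]] and RH = isometry_H[OF unitary_isometry[OF R]]
  have R_es: "R e = e" if "e \<in> set es" for e using that I_es h by (simp add: R_def)
  have Rp: "R v \<in> perp es" if "v \<in> perp es" for v by (rule unitary_perp[OF R R_es that])
  have RX: "R X = 2 *s X" by (simp add: R_def I linear_op_scale[OF unitary_linear[OF h(1)]] flip: X_def)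
  have half: "H (R v) X = H v X / 2" for v
    using RH[of v X] by (simp add: RX H_scale_right mult.commute)
  have UX: "H U X = 0" "H Z X = 1" using XUZ H_cross by blast+
  \<comment> \<open>On the quotient of the complement of \<open>X\<close> by \<open>X\<close>, which is a positive line, \<open>R\<close> acts by \<open>s\<close>. As
    \<open>s \<noteq> 2\<close>, a vector of this line lifts to an eigenvector \<open>f = U + k X\<close>.\<close>
  define s where "s = H (R U) U"
  define n where "n = H (R U) Z"
  have RU: "R U = n *s X + s *s U"
    using three_frame[OF XUZ sp Rp[OF XUZ(2)]] half[of U] UX by (simp add: s_def n_def)
  have "H (R U) (R U) = s * cnj s" unfolding RU using XUZ UX by (simp add: H_simps)
  then have s1: "s * cnj s = 1" using RH[of U U] XUZ by simp
  then have s: "cmod s = 1" by (simp add: unimodular)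
  then have s2: "s \<noteq> 2" by auto
  define k where "k = n / (s - 2)"
  have kk: "n + 2 * k = s * k" using s2 by (simp add: k_def field_simps)
  define f where "f = U + k *s X"
  have f: "f \<in> perp es" "H f f = 1" "H f X = 0" "H X f = 0"
    using XUZ UX subspace_perp by (auto simp: f_def H_simps intro: subspace_add subspace_scale)
  have Rf: "R f = s *s f"
  proof -
    have "R f = (n + 2 * k) *s X + s *s U"
      by (simp add: f_def lR RU RX scale_left_distrib mult.commute add_ac)
    then show ?thesis by (simp add: kk f_def scale_right_distrib add.commute)
  qed
  \<comment> \<open>\<open>Y0\<close> is the isotropic partner of \<open>X\<close> orthogonal to \<open>f\<close>; \<open>R Y0\<close> has a component \<open>\<alpha> X\<close> with \<open>\<alpha>\<close>
    imaginary, so the shift by \<open>- 2 \<alpha> / 3\<close> that makes it an eigenvector keeps it isotropic.\<close>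
  define Y0 where "Y0 = Z - cnj k *s U - (k * cnj k / 2) *s X"
  have UZ: "H U Z = 0" using XUZ H_cross by blast
  have Y0: "Y0 \<in> perp es" "H Y0 Y0 = 0" "H X Y0 = 1" "H Y0 f = 0"
    using XUZ UX UZ subspace_perp by (auto simp: Y0_def f_def H_simps intro: subspace_diff subspace_scale)
  have Y0': "H Y0 X = 1" "H f Y0 = 0" using Y0 H_cross by blast+
  define \<alpha> where "\<alpha> = H (R Y0) Y0"
  have "cnj s * H (R Y0) f = H (R Y0) (R f)" by (simp add: Rf H_scale_right)
  also have "\<dots> = 0" by (simp add: RH Y0)
  finally have "H (R Y0) f = 0" using s1 by auto
  then have RY0: "R Y0 = \<alpha> *s X + (1 / 2) *s Y0"
    using three_frame[OF XUZ(1) f(1) Y0(1) XUZ(4) Y0(2,3) f(4) Y0(4) f(2) sp Rp[OF Y0(1)]] half[of Y0] Y0'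
    by (simp add: \<alpha>_def)
  have "\<alpha> / 2 + cnj \<alpha> / 2 = H (R Y0) (R Y0)" unfolding RY0 using XUZ Y0 Y0' by (simp add: H_simps)
  also have "\<dots> = 0" by (simp add: RH Y0)
  finally have \<alpha>: "cnj \<alpha> = - \<alpha>" by (simp add: add_eq_0_iff flip: add_divide_distrib)
  define Y where "Y = Y0 + (- 2 * \<alpha> / 3) *s X"
  have Y: "Y \<in> perp es" "H Y Y = 0" "H X Y = 1" "H Y f = 0" "H Y X = 1" "H f Y = 0"
    using XUZ Y0 Y0' f by (auto simp: Y_def H_simps \<alpha> intro!: perp_closed)
  have RY: "R Y = (1 / 2) *s Y"
  proof -
    have "R Y = (\<alpha> + (- 2 * \<alpha> / 3) * 2) *s X + (1 / 2) *s Y0"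
      by (simp only: Y_def lR RY0 RX scale_left_distrib scale_scale add_ac)
    also have "\<alpha> + (- 2 * \<alpha> / 3) * 2 = (1 / 2) * (- 2 * \<alpha> / 3)" by simp
    finally show ?thesis by (simp only: Y_def scale_right_distrib scale_scale add.commute)
  qed
  define J where "J = swap_op X Y"
  have nz': "H (X - Y) (X - Y) \<noteq> 0" using XUZ Y by (simp add: H_simps)
  have YV: "Y \<in> V" "f \<in> V" using Y f perp_subset by blast+
  have J: "unitary J" "\<And>v. J (J v) = v" "J X = Y" "J Y = X" "J f = f" "\<And>e. e \<in> set es \<Longrightarrow> J e = e"
  proof -
    show "unitary J" "J (J v) = v" for v
      unfolding J_def using unitary_swap_op[of X Y] V YV nz' swap_op_involutive[of X Y, THEN fun_cong] by auto
    show "J X = Y" "J Y = X" unfolding J_def using swap_op_left[of X Y] swap_op_right[of X Y] XUZ Y nz' by auto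
    show "J f = f" unfolding J_def by (rule swap_op_orth) (use f Y in auto)
    show "J e = e" if "e \<in> set es" for e unfolding J_def by (rule swap_op_orth) (use esp that XUZ Y in auto)
  qed
  define Q where "Q = R \<circ> crefl f (cnj s)"
  have s1': "cnj s * cnj (cnj s) = 1" using s1 by (simp add: mult.commute)
  have Q: "unitary Q" unfolding Q_def using R f YV s1' by (intro unitary_comp unitary_crefl) auto
  have Qf: "Q f = f" "Q X = 2 *s X" "Q Y = (1 / 2) *s Y"
    using f Y s1 by (simp_all add: Q_def crefl_self crefl_orth lR Rf RX RY mult.commute)
  have Q_es: "Q e = e" if "e \<in> set es" for e using that R_es esp f by (simp add: Q_def crefl_orth)
  have fac: "h (I v) = Q (crefl f s v)" for v
  proof -
    have "crefl f (cnj s) (crefl f s v) = v" using f s1 by (simp add: crefl_crefl crefl_one mult.commute)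
    then show ?thesis by (simp add: Q_def R_def)
  qed
  note lJ = linear_op_simps[OF unitary_linear[OF J(1)]] and lQ = linear_op_simps[OF unitary_linear[OF Q]]
  have JQ: "J (Q (J (Q v))) = v" if v: "v \<in> V" for v
  proof -
    have "(J \<circ> Q \<circ> (J \<circ> Q)) v = id v"
    proof (rule eq_on_V[OF es(1) _ linear_op_id _ _ v])
      show "linear_op (J \<circ> Q \<circ> (J \<circ> Q))" using J Q by (simp add: unitary_linear unitary_comp)
      show "(J \<circ> Q \<circ> (J \<circ> Q)) e = id e" if "e \<in> set es" for e using that J Q_es by simp
      show "(J \<circ> Q \<circ> (J \<circ> Q)) v = id v" if v: "v \<in> perp es" for v
      proof -
        have "v = H v Y *s X + H v f *s f + H v X *s Y"
          by (rule three_frame[OF XUZ(1) f(1) Y(1) XUZ(4) Y(2,3) f(4) Y(4) f(2) sp v])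
        then obtain a b c where "v = a *s X + b *s f + c *s Y" by blast
        then show ?thesis by (simp add: lJ lQ J Qf)
      qed
    qed
    then show ?thesis by simp
  qed
  show ?thesis
    by (rule root_from_block[OF g es h(1) I(1) J(1) Q f(1,2) s])
      (use h I_es J Q_es Qf I JQ fac root in auto)
qed

text \<open>The root \<open>h\<close> is \<open>b\<close> times the unipotent root of the unipotent part. For the isotropic vector \<open>w = y + \<zeta> u + ...\<close>
  one has \<open>\<langle>h w, w\<rangle> = b (\<mu> + 2 \<i> Im (\<zeta> \<nu>))\<close> with \<open>Re \<mu> < 0\<close>, and the imaginary part in the bracket is
  arbitrary because \<open>\<nu> \<noteq> 0\<close>. So the product can be made real and nonzero if \<open>b\<close> is not imaginary.\<close>

lemma parabolic3_root:
  assumes g: "unitary g" and es: "orthonormal es" "\<forall>e\<in>set es. \<exists>l. g e = l *s e"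
    and fr: "x \<in> perp es" "u \<in> perp es" "y \<in> perp es" "H x x = 0" "H y y = 0" "H x y = 1"
      "H u u = 1" "H x u = 0" "H y u = 0"
    and l: "l * cnj l = 1" "n \<noteq> 0" "g x = l *s x" "g u = l *s (u + n *s x)"
      "g y = l *s (y - cnj n *s u + k *s x)" and sp: "perp es \<subseteq> span {x, u, y}"
    and c: "cmod c = 1" "Re (c * (- l)) < 0" "c ^ m * dt g = 1"
  shows "three_involution_root (\<lambda>v. c *s g v)"
proof -
  have rev: "H y x = 1" "H u x = 0" "H u y = 0" using fr H_cross by blast+
  have V: "x \<in> V" "u \<in> V" "y \<in> V" using fr perp_subset by blast+
  have unit: "H (d *s p) (d *s q) = H p q" if "d * cnj d = 1" for d p q
  proof -
    have "H (d *s p) (d *s q) = (d * cnj d) * H p q" by (simp add: H_scale_left H_scale_right)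
    then show ?thesis using that by simp
  qed
  have "H (g y) (g y) = 0" using isometry_H[OF unitary_isometry[OF g]] fr by simp
  then have "H (y - cnj n *s u + k *s x) (y - cnj n *s u + k *s x) = 0" unfolding l(5) unit[OF l(1)] .
  then have nk: "n * cnj n + (k + cnj k) = 0" using fr rev by (simp add: H_simps algebra_simps)
  define \<nu> where "\<nu> = n / 2"
  define \<mu> where "\<mu> = (k + \<nu> * cnj \<nu>) / 2"
  have n: "n = \<nu> + \<nu>" "\<nu> \<noteq> 0" using l(2) by (simp_all add: \<nu>_def)
  have km: "k = \<mu> + \<mu> - \<nu> * cnj \<nu>" by (simp add: \<mu>_def)
  have mm: "\<mu> + cnj \<mu> = - (\<nu> * cnj \<nu>)"
  proof -
    have "\<mu> + cnj \<mu> = ((k + cnj k) + 2 * (\<nu> * cnj \<nu>)) / 2" by (simp add: \<mu>_def field_simps)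
    also have "k + cnj k = - (n * cnj n)" using nk by (simp add: add_eq_0_iff)
    also have "n * cnj n = 4 * (\<nu> * cnj \<nu>)" by (simp add: \<nu>_def)
    finally show ?thesis by simp
  qed
  have re\<mu>: "Re \<mu> \<noteq> 0"
  proof
    assume "Re \<mu> = 0"
    then have "\<mu> + cnj \<mu> = 0" by (simp add: complex_eq_iff)
    then show False using mm n by simp
  qed
  define b where "b = csqrt (c * l)"
  have b2: "b * b = c * l" by (simp add: b_def flip: power2_eq_square)
  have "cmod l = 1" using l(1) unimodular by blast
  then have "cmod (c * l) = 1" using c(1) by (simp add: norm_mult)
  then have b1: "b * cnj b = 1" using csqrt_unit by (simp add: b_def flip: unimodular)
  have "Re (b\<^sup>2) > 0" using c b2 by (simp add: power2_eq_square)
  then have reb: "Re b \<noteq> 0" by (auto simp: Re_square)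
  define x' u' y' where "x' = b *s x" and "u' = b *s (u + \<nu> *s x)" and "y' = b *s (y - cnj \<nu> *s u + \<mu> *s x)"
  have sp': "x' \<in> span {x, u, y}" "u' \<in> span {x, u, y}" "y' \<in> span {x, u, y}"
    unfolding x'_def u'_def y'_def
    by (auto intro!: span_scale span_add span_diff intro: span_base)
  have fr': "H x' x' = 0" "H y' y' = 0" "H x' y' = 1" "H x' u' = 0" "H y' u' = 0" "H u' u' = H u u"
  proof -
    have "H (y - cnj \<nu> *s u + \<mu> *s x) (y - cnj \<nu> *s u + \<mu> *s x) = \<nu> * cnj \<nu> + (\<mu> + cnj \<mu>)"
      using fr rev by (simp add: H_simps algebra_simps)
    then show "H y' y' = 0" unfolding y'_def unit[OF b1] mm by simp
    show "H x' x' = 0" "H x' y' = 1" "H x' u' = 0" "H y' u' = 0" "H u' u' = H u u"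
      unfolding x'_def u'_def y'_def unit[OF b1] using fr rev by (simp_all add: H_simps)
  qed
  define h where "h = triple_op x u y x' u' y'"
  have "u = 0 \<and> u' = 0 \<or> H u u = 1" using fr by simp
  note t = triple_op[OF fr(4,5,6,8,9) this sp' fr' V, folded h_def]
  have h: "unitary h" "h x = b *s x" "h u = b *s (u + \<nu> *s x)" "h y = b *s (y - cnj \<nu> *s u + \<mu> *s x)"
    using t x'_def u'_def y'_def by auto
  note lh = linear_op_simps[OF unitary_linear[OF h(1)]]
  have he: "h e = e" if "e \<in> set es" for e
    by (rule t(5)) (use fr that in \<open>simp_all add: perp_def H_zero_commute[of e]\<close>)
  have root: "h (h v) = c *s g v" if "v \<in> perp es" for v
  proof -
    have "(h \<circ> h) v = c *s g v"
    proof (rule linear_op_eq_on_span[of _ "\<lambda>v. c *s g v" "{x, u, y}"])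
      show "linear_op (h \<circ> h)" "linear_op (\<lambda>v. c *s g v)"
        using h unitary_scaled[OF g c(1)] by (auto simp: unitary_linear unitary_comp)
      show "v \<in> span {x, u, y}" using that sp by blast
      have hx: "h (h x) = (b * b) *s x" by (simp add: h lh)
      have hu: "h (h u) = (b * b) *s (u + n *s x)"
      proof -
        have "h (h u) = (b * b) *s u + ((b * b) *s (\<nu> *s x) + (b * b) *s (\<nu> *s x))"
          by (simp add: h lh scale_right_distrib mult_ac add_ac)
        then show ?thesis unfolding n(1) by (simp only: scale_left_distrib scale_right_distrib)
      qed
      have hy: "h (h y) = (b * b) *s (y - cnj n *s u + k *s x)"
      proof -
        have "h (h y) = (b * b) *s (y - cnj \<nu> *s u + \<mu> *s x - cnj \<nu> *s (u + \<nu> *s x) + \<mu> *s x)"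
          by (simp add: h lh scale_right_distrib scale_right_diff_distrib mult_ac)
        also have "y - cnj \<nu> *s u + \<mu> *s x - cnj \<nu> *s (u + \<nu> *s x) + \<mu> *s x
            = y - cnj n *s u + k *s x"
          unfolding n(1) km
          by (simp only: complex_cnj_add scale_left_distrib scale_left_diff_distrib scale_right_distrib
              scale_scale mult.commute[of "cnj \<nu>" \<nu>]) (simp add: algebra_simps)
        finally show ?thesis .
      qed
      show "(h \<circ> h) s = c *s g s" if "s \<in> {x, u, y}" for s
        using that by (auto simp: hx hu hy b2 l simp del: scale_scale) (simp_all add: scale_scale)
    qed
    then show ?thesis by simp
  qed
  \<comment> \<open>chosen such that \<open>b (Re \<mu> + \<i> \<eta>)\<close> is real; \<open>\<zeta>\<close> then makes \<open>\<langle>h w, w\<rangle>\<close> equal to this number\<close>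
  define \<eta> where "\<eta> = - Im b * Re \<mu> / Re b"
  define \<zeta> where "\<zeta> = \<i> * of_real ((\<eta> - Im \<mu>) / 2) / \<nu>"
  have z\<nu>: "\<zeta> * \<nu> = \<i> * of_real ((\<eta> - Im \<mu>) / 2)" using n by (simp add: \<zeta>_def)
  define w where "w = y + \<zeta> *s u + (- (\<zeta> * cnj \<zeta>) / 2) *s x"
  define u2 where "u2 = u - cnj \<zeta> *s x"
  have wu: "w \<in> perp es" "u2 \<in> perp es"
    unfolding w_def u2_def using fr by (auto intro!: perp_closed)
  have wfr: "H w w = 0" "H w x = 1" "H w u2 = 0" "H x u2 = 0" "H u2 u2 = 1" "H x w = 1" "H u w = cnj \<zeta>"
    using fr rev by (simp_all add: w_def u2_def H_simps algebra_simps)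
  have hw: "h w = b *s (w + (\<zeta> * \<nu> + \<mu>) *s x - cnj \<nu> *s u)"
    by (simp add: w_def lh h scale_right_distrib scale_right_diff_distrib scale_left_distrib algebra_simps)
  have "H (h w) w = b * (\<zeta> * \<nu> + \<mu> - cnj (\<zeta> * \<nu>))"
    unfolding hw by (simp add: H_scale_left H_diff_left H_add_left wfr algebra_simps)
  also have "\<zeta> * \<nu> + \<mu> - cnj (\<zeta> * \<nu>) = Complex (Re \<mu>) \<eta>"
    unfolding z\<nu> by (simp add: complex_eq_iff)
  finally have hww: "H (h w) w = b * Complex (Re \<mu>) \<eta>" .
  have b0: "b \<noteq> 0" using b1 by auto
  have cz: "Complex (Re \<mu>) \<eta> \<noteq> 0" using re\<mu> by (simp add: complex_eq_iff)
  show ?thesis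
  proof (rule three_block[where \<gamma> = "\<lambda>e. c * H (g e) e", OF unitary_scaled[OF g c(1)] _ es(1) _ h(1) he wu fr(1)
        wfr(1) fr(4) wfr(2,3,4,5) sp _ _ root])
    show "Im (H (h w) w) = 0" unfolding hww using reb by (simp add: \<eta>_def)
    show "H (h w) w \<noteq> 0" unfolding hww using b0 cz by simp
    show "dt (\<lambda>v. c *s g v) = 1" using c by (simp add: dt_scale)
    show "c *s g e = (c * H (g e) e) *s e" if "e \<in> set es" for e
      using eigenvalue_map[OF es, of e] that by (metis scale_scale)
  qed
qed

text \<open>The cases of the normal form are settled by the preceding lemmas, with the half-plane condition given by \<open>z\<close> equal
  to the difference of two eigenvalues, to \<open>- l\<close>, to \<open>\<i> t l\<close>, and to \<open>- l\<close>. Only a scalar \<open>g\<close> has no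
  half-plane condition; a multiple of it is the identity.\<close>

theorem three_involution_root_exists:
  assumes g: "unitary g" and m: "m \<ge> 3"
  shows "\<exists>c. cmod c = 1 \<and> three_involution_root (\<lambda>v. c *s g v)"
proof -
  obtain es where es: "orthonormal es" "\<forall>e\<in>set es. \<exists>l. g e = l *s e"
    and max: "\<And>u l. u \<in> perp es \<Longrightarrow> g u = l *s u \<Longrightarrow> Re (H u u) \<le> 0"
    using maximal_eigenvector_list[of g] g by (auto simp: unitary_def)
  have inv: "g v \<in> perp es" if "v \<in> perp es" for v
    by (rule eigenvector_perp_invariant[OF _ _ _ that]) (use g es in \<open>auto simp: unitary_def orthonormal_def\<close>)
  have choice: "\<exists>c. cmod c = 1 \<and> c ^ m * dt g = 1 \<and> Re (c * z) < 0" if "z \<noteq> 0" for z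
    by (rule rotation_choice) (use m g that dt_unimodular in \<open>auto simp: unitary_def\<close>)
  have "elliptic_part g (perp es) \<or> loxodromic_part g (perp es) \<or>
      parabolic_part2 g (perp es) \<or> parabolic_part3 g (perp es)"
  proof (rule isometry_normal_form[OF unitary_isometry[OF g] subspace_perp perp_subset])
    show "g v \<in> perp es" if "v \<in> perp es" for v using that by (rule inv)
    show "\<exists>w\<in>perp es. Re (H w w) < 0" by (rule negative_in_perp[OF es(1)])
    show "Re (H u u) \<le> 0" if "u \<in> perp es" "g u = l *s u" for u l using that by (rule max)
  qed
  then consider "elliptic_part g (perp es)" | "loxodromic_part g (perp es)" | "parabolic_part2 g (perp es)"
    | "parabolic_part3 g (perp es)" by blast
  then show ?thesis
  proof cases
    case 1
    then obtain u l where u: "u \<in> perp es" "H u u = -1" "g u = l *s u" "perp es \<subseteq> span {u}"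
      unfolding elliptic_part_def by blast
    show ?thesis
    proof (cases "\<forall>e\<in>set es. g e = l *s e")
      case True
      have "l * cnj l = 1" using eigenvalue_unimodular[OF unitary_isometry[OF g] u(3)] u(2) by simp
      then have l: "cmod (cnj l) = 1" "cnj l * l = 1" by (simp_all add: unimodular mult.commute)
      have "g v = l *s v" if "v \<in> V" for v
      proof (rule eq_on_V[OF es(1) unitary_linear[OF g] _ _ _ that])
        show "linear_op ((*s) l)" by (auto simp: linear_op_def scale_right_distrib mult.commute)
        show "g w = l *s w" if w: "w \<in> perp es" for w
        proof -
          have "w \<in> span {u}" using w u by blast
          then obtain a where "w = a *s u" by (rule span_singletonE)
          then show ?thesis using u by (simp add: linear_op_scale[OF unitary_linear[OF g]] mult.commute)
        qed
      qed (use True in auto)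
      then have "three_involution_root (\<lambda>v. cnj l *s g v)"
        unfolding three_involution_root_def using l
        by (intro exI[of _ id] conjI unitary_id) simp
      then show ?thesis using l by blast
    next
      case False
      then obtain e1 l1 where e1: "e1 \<in> set es" "g e1 = l1 *s e1" "g e1 \<noteq> l *s e1" using es by blast
      then have "l1 - l \<noteq> 0" by auto
      then obtain c where "cmod c = 1" "c ^ m * dt g = 1" "Re (c * (l1 - l)) < 0" using choice by blast
      then show ?thesis using elliptic_root[OF g es u e1(1,2)] by blast
    qed
  next
    case 2
    then obtain x y l where x: "x \<in> perp es" "y \<in> perp es" "H x x = 0" "H y y = 0" "H x y = 1"
      "l \<noteq> 0" "cmod l \<noteq> 1" "g x = l *s x" "g y = (1 / cnj l) *s y" "perp es \<subseteq> span {x, y}"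
      unfolding loxodromic_part_def by blast
    then obtain c where "cmod c = 1" "c ^ m * dt g = 1" "Re (c * (- l)) < 0" using choice[of "- l"] by auto
    then show ?thesis using loxodromic_root[OF g es x] by blast
  next
    case 3
    then obtain x y l t where x: "x \<in> perp es" "y \<in> perp es" "H x x = 0" "H y y = 0" "H x y = 1"
      "l * cnj l = 1" and t: "t \<noteq> 0" and x': "g x = l *s x" "g y = l *s (y + (\<i> * of_real t) *s x)" "perp es \<subseteq> span {x, y}"
      unfolding parabolic_part2_def by blast
    have "\<i> * of_real t * l \<noteq> 0" using t x by auto
    then obtain c where "cmod c = 1" "c ^ m * dt g = 1" "Re (c * (\<i> * of_real t * l)) < 0" using choice by blast
    then show ?thesis using parabolic2_root[OF g es x x'] by blast
  next
    case 4
    then obtain x u y l n k where x: "x \<in> perp es" "u \<in> perp es" "y \<in> perp es" "H x x = 0" "H y y = 0" "H x y = 1"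
      "H u u = 1" "H x u = 0" "H y u = 0" "l * cnj l = 1" "n \<noteq> 0" "g x = l *s x" "g u = l *s (u + n *s x)"
      "g y = l *s (y - cnj n *s u + k *s x)" "perp es \<subseteq> span {x, u, y}"
      unfolding parabolic_part3_def by blast
    have "- l \<noteq> 0" using x by auto
    then obtain c where "cmod c = 1" "c ^ m * dt g = 1" "Re (c * (- l)) < 0" using choice by blast
    then show ?thesis using parabolic3_root[OF g es x] by blast
  qed
qed

end

section \<open>The coordinate model\<close>

text \<open>Vectors of dimension \<open>m\<close> are modelled by functions on the natural numbers that vanish from \<open>m\<close> on, because these
  form a subspace of a single type that is an abelian group.\<close>

definition fscale :: "complex \<Rightarrow> (nat \<Rightarrow> complex) \<Rightarrow> nat \<Rightarrow> complex" where
  "fscale c u = (\<lambda>i. c * u i)"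

definition fspace :: "nat \<Rightarrow> (nat \<Rightarrow> complex) set" where
  "fspace m = {u. \<forall>i\<ge>m. u i = 0}"

definition fform :: "nat \<Rightarrow> (complex vec \<Rightarrow> complex vec \<Rightarrow> complex) \<Rightarrow> (nat \<Rightarrow> complex) \<Rightarrow> (nat \<Rightarrow> complex) \<Rightarrow> complex" where
  "fform m H u v = H (vec m u) (vec m v)"

definition fun_of_vec :: "complex vec \<Rightarrow> nat \<Rightarrow> complex" where
  "fun_of_vec v = (\<lambda>i. if i < dim_vec v then v $ i else 0)"

definition funit :: "nat \<Rightarrow> nat \<Rightarrow> complex" where
  "funit j = (\<lambda>i. if i = j then 1 else 0)"

definition mat_of_op :: "nat \<Rightarrow> ((nat \<Rightarrow> complex) \<Rightarrow> nat \<Rightarrow> complex) \<Rightarrow> complex mat" where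
  "mat_of_op m T = mat m m (\<lambda>(i, j). T (funit j) i)"

definition op_of_mat :: "complex mat \<Rightarrow> (nat \<Rightarrow> complex) \<Rightarrow> nat \<Rightarrow> complex" where
  "op_of_mat A u = fun_of_vec (A *\<^sub>v vec (dim_col A) u)"

lemma sum_fun_apply: "(\<Sum>a\<in>A. (f a :: nat \<Rightarrow> complex)) x = (\<Sum>a\<in>A. f a x)"
  by (induction A rule: infinite_finite_induct) auto

lemma mat_of_op_carrier [simp]: "mat_of_op m T \<in> carrier_mat m m"
  by (simp add: mat_of_op_def)

lemma vec_fun_of_vec [simp]: "v \<in> carrier_vec m \<Longrightarrow> vec m (fun_of_vec v) = v"
  by (auto simp: fun_of_vec_def)

lemma fun_of_vec_vec: "u \<in> fspace m \<Longrightarrow> fun_of_vec (vec m u) = u"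
  by (auto simp: fun_of_vec_def fspace_def fun_eq_iff)

lemma fun_of_vec_in_fspace: "v \<in> carrier_vec m \<Longrightarrow> fun_of_vec v \<in> fspace m"
  by (auto simp: fun_of_vec_def fspace_def)

lemma vec_add: "vec m (u + v) = vec m u + vec m (v :: nat \<Rightarrow> complex)"
  by auto

lemma vec_fscale: "vec m (fscale c u) = c \<cdot>\<^sub>v vec m u"
  by (auto simp: fscale_def)

interpretation fun_vs: vector_space fscale
  by unfold_locales (auto simp: fscale_def fun_eq_iff algebra_simps)

lemma subspace_fspace: "fun_vs.subspace (fspace m)"
  by (auto simp: fun_vs.subspace_def fspace_def fscale_def)

lemma funit_in_fspace: "j < m \<Longrightarrow> funit j \<in> fspace m"
  by (auto simp: funit_def fspace_def)

lemma vec_funit: "j < m \<Longrightarrow> vec m (funit j) = unit_vec m j"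
  by (auto simp: funit_def unit_vec_def)

lemma fspace_expand:
  assumes "u \<in> fspace m" shows "u = (\<Sum>j<m. fscale (u j) (funit j))"
proof
  fix i
  have "(\<Sum>j<m. fscale (u j) (funit j)) i = (\<Sum>j<m. if i = j then u j else 0)"
    unfolding sum_fun_apply by (rule sum.cong) (auto simp: fscale_def funit_def)
  also have "\<dots> = u i" using assms by (auto simp: fspace_def)
  finally show "u i = (\<Sum>j<m. fscale (u j) (funit j)) i" by simp
qed

text \<open>Multiplying the block matrix with rows \<open>(1, U)\<close> and \<open>(- W, 1)\<close> by the unipotent one with rows \<open>(1, 0)\<close> and \<open>(W, 1)\<close>
  from the right or from the left clears one off-diagonal block, and leaves \<open>1 + U W\<close> or \<open>1 + W U\<close> on the diagonal.\<close>

lemma det_rank_one_update: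
  fixes u w :: "nat \<Rightarrow> complex"
  shows "det (mat m m (\<lambda>(i, j). (if i = j then 1 else 0) + u i * w j)) = 1 + (\<Sum>i<m. w i * u i)"
proof -
  define U where "U = mat m 1 (\<lambda>(i, j). u i)"
  define W where "W = mat 1 m (\<lambda>(i, j). w j)"
  define K where "K = (1\<^sub>m 1 + W * U :: complex mat)"
  define L where "L = (1\<^sub>m m + U * W :: complex mat)"
  have c: "U \<in> carrier_mat m 1" "W \<in> carrier_mat 1 m" "- W \<in> carrier_mat 1 m" "W * U \<in> carrier_mat 1 1"
     "K \<in> carrier_mat 1 1" "L \<in> carrier_mat m m" "U * W \<in> carrier_mat m m"
    by (auto simp: U_def W_def K_def L_def)
  define M where "M = four_block_mat (1\<^sub>m m) U (- W) (1\<^sub>m 1)"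
  define X where "X = four_block_mat (1\<^sub>m m) (0\<^sub>m m 1) W (1\<^sub>m 1)"
  have X: "X \<in> carrier_mat (m + 1) (m + 1)" "M \<in> carrier_mat (m + 1) (m + 1)"
    unfolding X_def M_def using c by (auto intro!: four_block_carrier_mat)
  have nw: "- W + W = 0\<^sub>m 1 m" "W + - W = 0\<^sub>m 1 m" using c by (auto intro!: eq_matI)
  have "M * X = four_block_mat L U (0\<^sub>m 1 m) (1\<^sub>m 1)"
    unfolding M_def X_def L_def using c nw
    by (subst mult_four_block_mat[of _ m m _ 1 _ 1]) auto
  then have 1: "det (M * X) = det L"
    using c by (simp add: det_four_block_mat_lower_left_zero[of _ m _ 1])
  have "X * M = four_block_mat (1\<^sub>m m) U (0\<^sub>m 1 m) K"
    unfolding M_def X_def K_def using c nw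
    by (subst mult_four_block_mat[of _ m m _ 1 _ 1]) (auto simp: comm_add_mat[of "W * U" 1 1])
  then have 2: "det (X * M) = det K"
    using c by (simp add: det_four_block_mat_lower_left_zero[of _ m _ 1])
  have "det K = det L" using 1 2 X by (simp add: det_mult mult.commute)
  moreover have "L = mat m m (\<lambda>(i, j). (if i = j then 1 else 0) + u i * w j)"
    by (rule eq_matI) (auto simp: L_def U_def W_def scalar_prod_def)
  moreover have "det K = 1 + (\<Sum>i<m. w i * u i)"
    using det_single[OF c(5)] by (simp add: K_def U_def W_def scalar_prod_def atLeast0LessThan)
  ultimately show ?thesis by simp
qed

locale hermitian_vec_space =
  fixes m :: nat and H :: "complex vec \<Rightarrow> complex vec \<Rightarrow> complex"
  assumes herm: "hermitian_form m H"
begin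

sublocale hermitian_space fscale "fform m H"
proof
  fix u v w :: "nat \<Rightarrow> complex" and c :: complex
  have vc: "vec m u \<in> carrier_vec m" for u :: "nat \<Rightarrow> complex" by simp
  show "fform m H (u + v) w = fform m H u w + fform m H v w"
    using herm vc unfolding fform_def vec_add hermitian_form_def by blast
  show "fform m H (fscale c u) v = c * fform m H u v"
    using herm vc unfolding fform_def vec_fscale hermitian_form_def by blast
  show "fform m H v u = cnj (fform m H u v)"
    using herm vc unfolding fform_def hermitian_form_def by blast
qed

lemma vec_op_eq_mult:
  assumes T: "linear_op T" "\<And>v. v \<in> fspace m \<Longrightarrow> T v \<in> fspace m" and u: "u \<in> fspace m"
  shows "vec m (T u) = mat_of_op m T *\<^sub>v vec m u"
proof (rule eq_vecI)
  fix i assume "i < dim_vec (mat_of_op m T *\<^sub>v vec m u)"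
  then have i: "i < m" by (simp add: mat_of_op_def)
  have "T u = (\<Sum>j<m. fscale (u j) (T (funit j)))"
    by (subst fspace_expand[OF u]) (simp add: linear_op_sum[OF T(1)] linear_op_scale[OF T(1)])
  then have "T u i = (\<Sum>j<m. u j * T (funit j) i)"
    by (simp add: sum_fun_apply fscale_def)
  also have "\<dots> = (mat_of_op m T *\<^sub>v vec m u) $ i"
    using i by (simp add: mat_of_op_def scalar_prod_def atLeast0LessThan mult.commute)
  finally show "vec m (T u) $ i = (mat_of_op m T *\<^sub>v vec m u) $ i" using i by simp
qed (simp add: mat_of_op_def)

lemma mat_of_op_comp:
  assumes S: "linear_op S" "\<And>v. v \<in> fspace m \<Longrightarrow> S v \<in> fspace m"
    and T: "\<And>v. v \<in> fspace m \<Longrightarrow> T v \<in> fspace m"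
  shows "mat_of_op m (S \<circ> T) = mat_of_op m S * mat_of_op m T"
proof (rule eq_matI)
  fix i j assume "i < dim_row (mat_of_op m S * mat_of_op m T)" "j < dim_col (mat_of_op m S * mat_of_op m T)"
  then have ij: "i < m" "j < m" by (simp_all add: mat_of_op_def)
  have "vec m (S (T (funit j))) = mat_of_op m S *\<^sub>v vec m (T (funit j))"
    using ij by (intro vec_op_eq_mult[OF S] T funit_in_fspace)
  moreover have "vec m (T (funit j)) = col (mat_of_op m T) j"
    using ij by (auto simp: mat_of_op_def)
  ultimately have "vec m (S (T (funit j))) $ i = (mat_of_op m S *\<^sub>v col (mat_of_op m T) j) $ i" by simp
  then show "mat_of_op m (S \<circ> T) $$ (i, j) = (mat_of_op m S * mat_of_op m T) $$ (i, j)"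
    using ij by (simp add: mat_of_op_def)
qed (simp_all add: mat_of_op_def)

lemma mat_of_op_cong: "(\<And>v. v \<in> fspace m \<Longrightarrow> S v = T v) \<Longrightarrow> mat_of_op m S = mat_of_op m T"
  by (auto simp: mat_of_op_def funit_in_fspace intro!: cong_mat)

lemma mat_of_op_id: "mat_of_op m id = 1\<^sub>m m"
  by (rule eq_matI) (auto simp: mat_of_op_def funit_def)

lemma mat_of_op_scale: "mat_of_op m (\<lambda>v. fscale c (T v)) = c \<cdot>\<^sub>m mat_of_op m T"
  by (rule eq_matI) (auto simp: mat_of_op_def fscale_def)

lemma det_crefl:
  assumes u: "u \<in> fspace m" "fform m H u u \<noteq> 0"
  shows "det (mat_of_op m (crefl u \<zeta>)) = \<zeta>"
proof -
  define w where "w j = (\<zeta> - 1) * fform m H (funit j) u / fform m H u u" for j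
  have "mat_of_op m (crefl u \<zeta>) = mat m m (\<lambda>(i, j). (if i = j then 1 else 0) + u i * w j)"
    by (rule eq_matI) (auto simp: mat_of_op_def crefl_def w_def fscale_def funit_def)
  then have "det (mat_of_op m (crefl u \<zeta>)) = 1 + (\<Sum>i<m. w i * u i)"
    by (simp add: det_rank_one_update)
  also have "(\<Sum>i<m. w i * u i) = (\<zeta> - 1) / fform m H u u * (\<Sum>i<m. u i * fform m H (funit i) u)"
    by (simp add: w_def sum_distrib_left mult_ac)
  also have "(\<Sum>i<m. u i * fform m H (funit i) u) = fform m H (\<Sum>i<m. fscale (u i) (funit i)) u"
    by (simp add: H_sum_left H_scale_left)
  also have "\<dots> = fform m H u u" using fspace_expand[OF u(1)] by simp
  finally show ?thesis using u by simp
qed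

text \<open>The Gram matrix \<open>G\<close> of the form satisfies \<open>A\<^sup>T G (cnj A) = G\<close> for the matrix \<open>A\<close> of an isometry, and \<open>det G \<noteq> 0\<close>.\<close>

lemma det_isometry_unimodular:
  assumes nd: "nondegenerate_form m H"
    and T: "isometry T" "\<And>v. v \<in> fspace m \<Longrightarrow> T v \<in> fspace m"
  shows "cmod (det (mat_of_op m T)) = 1"
proof -
  interpret cnj_hom: comm_ring_hom cnj by unfold_locales auto
  define A where "A = mat_of_op m T"
  define G where "G = mat m m (\<lambda>(i, j). fform m H (funit i) (funit j))"
  have c: "A \<in> carrier_mat m m" "G \<in> carrier_mat m m" "map_mat cnj A \<in> carrier_mat m m" "A\<^sup>T \<in> carrier_mat m m"
    by (auto simp: A_def G_def)
  have "A\<^sup>T * G * map_mat cnj A = G"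
  proof (rule eq_matI)
    fix i j assume "i < dim_row G" "j < dim_col G"
    then have ij: "i < m" "j < m" by (auto simp: G_def)
    have ex: "T (funit k) = (\<Sum>l<m. fscale (T (funit k) l) (funit l))" if "k < m" for k
      by (rule fspace_expand) (rule T(2), rule funit_in_fspace[OF that])
    have "fform m H (funit i) (funit j) = fform m H (T (funit i)) (T (funit j))"
      using isometry_H[OF T(1)] by simp
    also have "\<dots> = fform m H (\<Sum>l<m. fscale (T (funit i) l) (funit l)) (\<Sum>k<m. fscale (T (funit j) k) (funit k))"
      using ex[OF ij(1)] ex[OF ij(2)] by simp
    also have "\<dots> = (\<Sum>k<m. (\<Sum>l<m. T (funit i) l * fform m H (funit l) (funit k)) * cnj (T (funit j) k))"
      unfolding H_sum_right H_scale_right H_sum_left H_scale_left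
      by (simp add: mult.commute)
    also have "\<dots> = (A\<^sup>T * G * map_mat cnj A) $$ (i, j)"
      using ij by (simp add: A_def G_def mat_of_op_def scalar_prod_def atLeast0LessThan)
    finally show "(A\<^sup>T * G * map_mat cnj A) $$ (i, j) = G $$ (i, j)" using ij by (simp add: G_def)
  qed (auto simp: A_def G_def mat_of_op_def)
  then have "det (A\<^sup>T * G * map_mat cnj A) = det G" by simp
  then have d: "det A * det G * cnj (det A) = det G"
    using c by (simp add: det_mult[of _ m] det_transpose[of _ m])
  have "det G \<noteq> 0"
  proof
    assume "det G = 0"
    then obtain v where v: "v \<in> carrier_vec m" "v \<noteq> 0\<^sub>v m" "G *\<^sub>v v = 0\<^sub>v m"
      using det_0_iff_vec_prod_zero[OF c(2)] by auto
    define x where "x j = (if j < m then cnj (v $ j) else 0)" for j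
    have x: "x \<in> fspace m" by (simp add: x_def fspace_def)
    have z: "fform m H (funit i) x = 0" if "i < m" for i
    proof -
      have "fform m H (funit i) x = fform m H (funit i) (\<Sum>j<m. fscale (x j) (funit j))"
        using fspace_expand[OF x] by simp
      also have "\<dots> = (\<Sum>j<m. v $ j * fform m H (funit i) (funit j))"
        unfolding H_sum_right H_scale_right by (rule sum.cong) (auto simp: x_def)
      also have "\<dots> = (G *\<^sub>v v) $ i"
        using that v(1) by (simp add: G_def scalar_prod_def atLeast0LessThan mult.commute)
      also have "\<dots> = 0" using that v by simp
      finally show ?thesis .
    qed
    have "H (vec m x) w = 0" if w: "w \<in> carrier_vec m" for w
    proof -
      define y where "y = fun_of_vec w"
      have y: "y \<in> fspace m" "vec m y = w" using w by (auto simp: y_def fun_of_vec_in_fspace)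
      have "fform m H y x = fform m H (\<Sum>j<m. fscale (y j) (funit j)) x"
        using fspace_expand[OF y(1)] by simp
      also have "\<dots> = 0" by (simp add: H_sum_left H_scale_left z)
      finally have "fform m H x y = 0" using H_zero_commute by blast
      then show ?thesis by (simp add: fform_def y)
    qed
    then have "vec m x = 0\<^sub>v m" using nd unfolding nondegenerate_form_def by simp
    then have "x j = 0" if "j < m" for j using that by (metis index_vec index_zero_vec(1))
    then have "v = 0\<^sub>v m" using v(1) by (intro eq_vecI) (auto simp: x_def)
    with v show False by simp
  qed
  with d have "det A * cnj (det A) = 1" by simp
  then have "complex_of_real ((cmod (det A))\<^sup>2) = 1" by (simp only: complex_norm_square)
  then have "(cmod (det A))\<^sup>2 = 1" by (simp only: of_real_eq_1_iff)
  then show ?thesis unfolding A_def by (metis norm_ge_zero one_power2 power2_eq_imp_eq zero_le_one)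
qed

text \<open>Let \<open>e\<close> and \<open>p\<close> be a negative and a positive member of the orthogonal basis. A vector orthogonal to \<open>e\<close> has no
  component along \<open>e\<close>, and the other basis vectors contribute nonnegative terms to its norm. If all terms vanish, the
  vector lies in the radical, which is 0.\<close>

lemma signature_vectors:
  assumes nd: "nondegenerate_form m H" and sig: "has_signature m H n 1" "n > 0"
  obtains e p where "e \<in> fspace m" "Re (fform m H e e) < 0" "p \<in> fspace m" "Re (fform m H p p) > 0"
    "fform m H e p = 0"
    "\<And>u. u \<in> fspace m \<Longrightarrow> fform m H u e = 0 \<Longrightarrow> u \<noteq> 0 \<Longrightarrow> Re (fform m H u u) > 0"
proof -
  interpret vs: vec_space "TYPE(complex)" m .
  obtain B where B: "vs.basis B" and orth: "\<And>b c. b \<in> B \<Longrightarrow> c \<in> B \<Longrightarrow> b \<noteq> c \<Longrightarrow> H b c = 0"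
    and pos: "card {b \<in> B. Re (H b b) > 0} = n" and neg: "card {b \<in> B. Re (H b b) < 0} = 1"
    using sig(1) unfolding has_signature_def by blast
  have Bc: "B \<subseteq> carrier_vec m" and spB: "vs.span B = carrier_vec m"
    using B unfolding vs.basis_def by auto
  obtain e' where e': "{b \<in> B. Re (H b b) < 0} = {e'}" using neg by (auto simp: card_1_singleton_iff)
  have "{b \<in> B. Re (H b b) > 0} \<noteq> {}" using pos sig(2) by (metis card.empty less_numeral_extra(3))
  then obtain p' where p': "p' \<in> B" "Re (H p' p') > 0" by blast
  have eB: "e' \<in> B" "Re (H e' e') < 0" using e' by auto
  define \<phi> where "\<phi> = fun_of_vec"
  have \<phi>V: "\<phi> b \<in> fspace m" and \<phi>v: "vec m (\<phi> b) = b" if "b \<in> B" for b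
    using that Bc by (auto simp: \<phi>_def fun_of_vec_in_fspace)
  have \<phi>H: "fform m H (\<phi> b) (\<phi> c) = H b c" if "b \<in> B" "c \<in> B" for b c
    using that by (simp add: fform_def \<phi>v)
  have ep: "e' \<noteq> p'" using eB p' by auto
  have expand: "\<exists>a A. finite A \<and> A \<subseteq> B \<and> u = (\<Sum>b\<in>A. fscale (a b) (\<phi> b))" if u: "u \<in> fspace m" for u
  proof -
    have "vec m u \<in> vs.span B" using spB by simp
    then obtain a A where A: "finite A" "A \<subseteq> B" "vs.lincomb a A = vec m u"
      unfolding vs.span_def by auto
    have Ac: "A \<subseteq> carrier_vec m" using A Bc by blast
    have "u i = (\<Sum>b\<in>A. fscale (a b) (\<phi> b)) i" for i
    proof (cases "i < m")
      case True
      have "u i = vs.lincomb a A $ i" using True A by simp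
      also have "\<dots> = (\<Sum>b\<in>A. a b * b $ i)" by (rule vs.lincomb_index[OF True Ac])
      also have "\<dots> = (\<Sum>b\<in>A. fscale (a b) (\<phi> b) i)"
        by (rule sum.cong) (use True Ac in \<open>auto simp: fscale_def \<phi>_def fun_of_vec_def\<close>)
      finally show ?thesis by (simp add: sum_fun_apply)
    next
      case False
      then have "\<phi> b i = 0" if "b \<in> A" for b using \<phi>V[of b] that A by (auto simp: fspace_def)
      moreover have "u i = 0" using False u by (simp add: fspace_def)
      ultimately show ?thesis by (simp add: sum_fun_apply fscale_def)
    qed
    then have "u = (\<Sum>b\<in>A. fscale (a b) (\<phi> b))" by (rule ext)
    then show ?thesis using A by blast
  qed
  have positive: "Re (fform m H u u) > 0"
    if u: "u \<in> fspace m" "fform m H u (\<phi> e') = 0" "u \<noteq> 0" for u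
  proof -
    obtain a A where A: "finite A" "A \<subseteq> B" and ux: "u = (\<Sum>b\<in>A. fscale (a b) (\<phi> b))"
      using expand[OF u(1)] by blast
    have coef: "fform m H u (\<phi> c) = a c * H c c" if c: "c \<in> A" for c
    proof -
      have "fform m H u (\<phi> c) = (\<Sum>b\<in>A. a b * fform m H (\<phi> b) (\<phi> c))"
        by (subst ux) (simp add: H_sum_left H_scale_left)
      also have "\<dots> = (\<Sum>b\<in>A. if b = c then a c * H c c else 0)"
      proof (rule sum.cong[OF refl])
        fix b assume "b \<in> A"
        then have "b \<in> B" "c \<in> B" using A c by blast+
        then show "a b * fform m H (\<phi> b) (\<phi> c) = (if b = c then a c * H c c else 0)"
          using \<phi>H[of b c] orth[of b c] by simp
      qed
      finally show ?thesis using A c by simp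
    qed
    have uu: "fform m H u u = (\<Sum>c\<in>A. of_real ((cmod (a c))\<^sup>2 * Re (H c c)))"
    proof -
      have "fform m H u u = (\<Sum>c\<in>A. cnj (a c) * fform m H u (\<phi> c))"
        by (subst (2) ux) (simp add: H_sum_right H_scale_right)
      also have "\<dots> = (\<Sum>c\<in>A. of_real ((cmod (a c))\<^sup>2 * Re (H c c)))"
      proof (rule sum.cong[OF refl])
        fix c assume c: "c \<in> A"
        have "H c c = of_real (Re (H c c))"
          using H_self_of_real[of "\<phi> c"] \<phi>H[of c c] c A by auto
        then have "cnj (a c) * fform m H u (\<phi> c) = (a c * cnj (a c)) * of_real (Re (H c c))"
          unfolding coef[OF c] by (metis mult.assoc mult.commute)
        then show "cnj (a c) * fform m H u (\<phi> c) = of_real ((cmod (a c))\<^sup>2 * Re (H c c))"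
          by (simp only: complex_norm_square of_real_mult)
      qed
      finally show ?thesis .
    qed
    have nonneg: "Re (H c c) \<ge> 0" if "c \<in> B" "c \<noteq> e'" for c
      using that e' by (metis (mono_tags, lifting) mem_Collect_eq not_le singletonD)
    have ae: "a e' = 0" if "e' \<in> A" using coef[OF that] u(2) eB by auto
    have terms: "(cmod (a c))\<^sup>2 * Re (H c c) \<ge> 0" if "c \<in> A" for c
      using nonneg[of c] ae that A by (cases "c = e'") auto
    have "Re (fform m H u u) = (\<Sum>c\<in>A. (cmod (a c))\<^sup>2 * Re (H c c))" unfolding uu by simp
    moreover have "(\<Sum>c\<in>A. (cmod (a c))\<^sup>2 * Re (H c c)) \<noteq> 0"
    proof
      assume "(\<Sum>c\<in>A. (cmod (a c))\<^sup>2 * Re (H c c)) = 0"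
      then have z: "a c = 0 \<or> Re (H c c) = 0" if "c \<in> A" for c
        using sum_nonneg_eq_0_iff[OF A(1), of "\<lambda>c. (cmod (a c))\<^sup>2 * Re (H c c)"] terms that by auto
      have "H (vec m u) w = 0" if w: "w \<in> carrier_vec m" for w
      proof -
        define y where "y = \<phi> w"
        have y: "y \<in> fspace m" "vec m y = w" using w by (auto simp: y_def \<phi>_def fun_of_vec_in_fspace)
        obtain a2 A2 where A2: "finite A2" "A2 \<subseteq> B" and yx: "y = (\<Sum>b\<in>A2. fscale (a2 b) (\<phi> b))"
          using expand[OF y(1)] by blast
        have t: "a c * H c b = 0" if "c \<in> A" "b \<in> B" for c b
        proof (cases "c = b")
          case True
          have "H c c = of_real (Re (H c c))"
            using H_self_of_real[of "\<phi> c"] \<phi>H[of c c] that A by auto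
          then show ?thesis using z[OF that(1)] True by auto
        qed (use orth that A in auto)
        have "fform m H u y = (\<Sum>b\<in>A2. cnj (a2 b) * (\<Sum>c\<in>A. a c * fform m H (\<phi> c) (\<phi> b)))"
          by (subst yx, subst ux) (simp add: H_sum_right H_scale_right H_sum_left H_scale_left)
        also have "\<dots> = (\<Sum>b\<in>A2. cnj (a2 b) * (\<Sum>c\<in>A. a c * H c b))"
          by (intro sum.cong refl arg_cong2[where f = "(*)"] \<phi>H) (use A A2 in auto)
        also have "\<dots> = 0" using t A2 by (intro sum.neutral ballI) (auto intro!: sum.neutral)
        finally show ?thesis by (simp add: fform_def y)
      qed
      then have "vec m u = 0\<^sub>v m" using nd unfolding nondegenerate_form_def by simp
      then have "u i = 0" if "i < m" for i using that by (metis index_vec index_zero_vec(1))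
      moreover have "u i = 0" if "\<not> i < m" for i using that u(1) by (simp add: fspace_def)
      ultimately have "u = 0" by (auto simp: fun_eq_iff)
      with u show False by simp
    qed
    ultimately show ?thesis using sum_nonneg[of A "\<lambda>c. (cmod (a c))\<^sup>2 * Re (H c c)"] terms by force
  qed
  show thesis
    by (rule that[of "\<phi> e'" "\<phi> p'"]) (use \<phi>V \<phi>H eB p' ep orth positive in auto)
qed

lemma lorentz_space_det_det:
  assumes nd: "nondegenerate_form m H" and e: "e \<in> fspace m" "Re (fform m H e e) < 0"
    "\<And>u. u \<in> fspace m \<Longrightarrow> fform m H u e = 0 \<Longrightarrow> u \<noteq> 0 \<Longrightarrow> Re (fform m H u u) > 0"
  shows "lorentz_space_det fscale (fform m H) (fspace m) e (\<lambda>T. det (mat_of_op m T)) m"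
proof -
  interpret L: lorentz_space fscale "fform m H" "fspace m" e
  proof
    show "fun_vs.subspace (fspace m)" by (rule subspace_fspace)
    show "\<exists>B. finite B \<and> fspace m \<subseteq> fun_vs.span B"
    proof (intro exI conjI subsetI)
      show "finite (funit ` {..<m})" by simp
      fix u assume "u \<in> fspace m"
      then have "u = (\<Sum>j<m. fscale (u j) (funit j))" by (rule fspace_expand)
      also have "\<dots> \<in> fun_vs.span (funit ` {..<m})"
        by (intro fun_vs.span_sum fun_vs.span_scale fun_vs.span_base) auto
      finally show "u \<in> fun_vs.span (funit ` {..<m})" .
    qed
  qed (use e in auto)
  show ?thesis
  proof
    show "det (mat_of_op m (S \<circ> T)) = det (mat_of_op m S) * det (mat_of_op m T)"
      if "linear_op S" "linear_op T" "L.preserves S" "L.preserves T" for S T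
      using that mat_of_op_comp[of S T] by (auto simp: L.preserves_def det_mult[of _ m])
    show "det (mat_of_op m S) = det (mat_of_op m T)" if "\<And>v. v \<in> fspace m \<Longrightarrow> S v = T v" for S T
      using mat_of_op_cong[of S T] that by simp
    show "det (mat_of_op m id) = 1" by (simp add: mat_of_op_id)
    show "det (mat_of_op m (crefl u \<zeta>)) = \<zeta>" if "u \<in> fspace m" "fform m H u u \<noteq> 0" for u \<zeta>
      using that by (rule det_crefl)
    show "cmod (det (mat_of_op m T)) = 1" if "isometry T" "L.preserves T" for T
      using that by (intro det_isometry_unimodular[OF nd]) (auto simp: L.preserves_def)
    show "det (mat_of_op m (\<lambda>v. fscale c (T v))) = c ^ m * det (mat_of_op m T)" for c T
      by (simp add: mat_of_op_scale carrier_matD[OF mat_of_op_carrier])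
  qed
qed

definition form_preserving :: "complex mat \<Rightarrow> bool" where
  "form_preserving A \<longleftrightarrow> A \<in> carrier_mat m m \<and>
     (\<forall>u \<in> carrier_vec m. \<forall>v \<in> carrier_vec m. H (A *\<^sub>v u) (A *\<^sub>v v) = H u v)"

lemma op_of_mat_isometry:
  assumes A: "form_preserving A"
  shows "isometry (op_of_mat A)" "op_of_mat A u \<in> fspace m" "vec m (op_of_mat A u) = A *\<^sub>v vec m u"
    "mat_of_op m (op_of_mat A) = A"
proof -
  have c: "A \<in> carrier_mat m m" "dim_col A = m" "dim_row A = m" using A by (auto simp: form_preserving_def)
  show inV: "op_of_mat A u \<in> fspace m" for u
    unfolding op_of_mat_def using c by (intro fun_of_vec_in_fspace) auto
  show v: "vec m (op_of_mat A u) = A *\<^sub>v vec m u" for u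
    unfolding op_of_mat_def using c by (subst vec_fun_of_vec) auto
  have ix: "op_of_mat A u i = (if i < m then (A *\<^sub>v vec m u) $ i else 0)" for u i
    using c by (simp add: op_of_mat_def fun_of_vec_def)
  have "op_of_mat A (u + w) = op_of_mat A u + op_of_mat A w" for u w
    using c by (auto simp: fun_eq_iff ix vec_add mult_add_distrib_mat_vec[of _ m m])
  moreover have "op_of_mat A (fscale k u) = fscale k (op_of_mat A u)" for k u
  proof
    fix i
    have "A *\<^sub>v vec m (fscale k u) = k \<cdot>\<^sub>v (A *\<^sub>v vec m u)"
      unfolding vec_fscale using c by (intro mult_mat_vec) auto
    then show "op_of_mat A (fscale k u) i = fscale k (op_of_mat A u) i"
      using c by (simp only: ix fscale_def) simp
  qed
  moreover have "fform m H (op_of_mat A u) (op_of_mat A w) = fform m H u w" for u w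
    using A by (simp add: fform_def v form_preserving_def)
  ultimately show "isometry (op_of_mat A)" by (simp add: isometry_def linear_op_def)
  show "mat_of_op m (op_of_mat A) = A"
  proof (rule eq_matI)
    fix i j assume "i < dim_row A" "j < dim_col A"
    then show "mat_of_op m (op_of_mat A) $$ (i, j) = A $$ (i, j)"
      using c by (simp add: mat_of_op_def ix vec_funit)
  qed (use c in \<open>simp_all add: mat_of_op_def\<close>)
qed

lemma mat_of_op_form_preserving:
  assumes T: "isometry T" "\<And>v. v \<in> fspace m \<Longrightarrow> T v \<in> fspace m"
  shows "form_preserving (mat_of_op m T)"
proof -
  have "H (mat_of_op m T *\<^sub>v u) (mat_of_op m T *\<^sub>v v) = H u v"
    if uv: "u \<in> carrier_vec m" "v \<in> carrier_vec m" for u v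
  proof -
    have k: "mat_of_op m T *\<^sub>v w = vec m (T (fun_of_vec w))" if "w \<in> carrier_vec m" for w
      using vec_op_eq_mult[OF isometry_linear[OF T(1)] T(2) fun_of_vec_in_fspace[OF that]] that by simp
    have "H (mat_of_op m T *\<^sub>v u) (mat_of_op m T *\<^sub>v v) = fform m H (T (fun_of_vec u)) (T (fun_of_vec v))"
      by (simp add: k uv fform_def)
    also have "\<dots> = fform m H (fun_of_vec u) (fun_of_vec v)" by (rule isometry_H[OF T(1)])
    also have "\<dots> = H u v" using uv by (simp add: fform_def)
    finally show ?thesis .
  qed
  then show ?thesis by (simp add: form_preserving_def)
qed

theorem matrix_three_involution_root:
  assumes m: "m \<ge> 3" and nd: "nondegenerate_form m H" and sig: "has_signature m H n 1" "n > 0"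
    and G: "form_preserving G"
  shows "\<exists>c A B C. cmod c = 1 \<and> form_preserving A \<and> form_preserving B \<and> form_preserving C \<and>
    A * A = 1\<^sub>m m \<and> B * B = 1\<^sub>m m \<and> C * C = 1\<^sub>m m \<and> (A * (B * C)) * (A * (B * C)) = c \<cdot>\<^sub>m G"
proof -
  obtain e where e: "e \<in> fspace m" "Re (fform m H e e) < 0"
    "\<And>u. u \<in> fspace m \<Longrightarrow> fform m H u e = 0 \<Longrightarrow> u \<noteq> 0 \<Longrightarrow> Re (fform m H u u) > 0"
    using signature_vectors[OF nd sig] by blast
  interpret L: lorentz_space_det fscale "fform m H" "fspace m" e "\<lambda>T. det (mat_of_op m T)" m
    by (rule lorentz_space_det_det[OF nd e])
  have "L.unitary (op_of_mat G)"
    using op_of_mat_isometry[OF G] by (simp add: L.unitary_def L.preserves_def)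
  then obtain c where c: "cmod c = 1" and "L.three_involution_root (\<lambda>v. fscale c (op_of_mat G v))"
    using L.three_involution_root_exists[OF _ m] by blast
  then obtain A B C where ABC: "L.unitary A" "L.unitary B" "L.unitary C"
    and all: "\<forall>v\<in>fspace m. A (A v) = v \<and> B (B v) = v \<and> C (C v) = v \<and>
        A (B (C (A (B (C v))))) = fscale c (op_of_mat G v)"
    unfolding L.three_involution_root_def by (elim exE conjE)
  have inv: "A (A v) = v" "B (B v) = v" "C (C v) = v"
    and root: "A (B (C (A (B (C v))))) = fscale c (op_of_mat G v)" if "v \<in> fspace m" for v
    using bspec[OF all that] by simp_all
  have mo: "mat_of_op m (S \<circ> T) = mat_of_op m S * mat_of_op m T" if "L.unitary S" "L.unitary T" for S T
    using that by (intro mat_of_op_comp) (auto simp: L.unitary_linear L.unitary_preserves)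
  have sq: "mat_of_op m T * mat_of_op m T = 1\<^sub>m m" if "L.unitary T" "\<And>v. v \<in> fspace m \<Longrightarrow> T (T v) = v" for T
    using mat_of_op_cong[of "T \<circ> T" id] that by (simp add: mat_of_op_id flip: mo)
  have fp: "form_preserving (mat_of_op m T)" if "L.unitary T" for T
    using that by (intro mat_of_op_form_preserving) (auto simp: L.unitary_isometry L.unitary_preserves)
  have BC: "L.unitary (B \<circ> C)" "L.unitary (A \<circ> (B \<circ> C))" using ABC by (auto intro!: L.unitary_comp)
  have "(mat_of_op m A * (mat_of_op m B * mat_of_op m C)) * (mat_of_op m A * (mat_of_op m B * mat_of_op m C))
     = mat_of_op m ((A \<circ> (B \<circ> C)) \<circ> (A \<circ> (B \<circ> C)))"
    using mo[OF BC(2,2)] mo[OF ABC(1) BC(1)] mo[OF ABC(2,3)] by simp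
  also have "\<dots> = mat_of_op m (\<lambda>v. fscale c (op_of_mat G v))"
    by (rule mat_of_op_cong) (simp add: root)
  also have "\<dots> = c \<cdot>\<^sub>m G" using op_of_mat_isometry(4)[OF G] by (simp add: mat_of_op_scale)
  finally have "(mat_of_op m A * (mat_of_op m B * mat_of_op m C)) * (mat_of_op m A * (mat_of_op m B * mat_of_op m C))
     = c \<cdot>\<^sub>m G" .
  then show ?thesis using c fp[OF ABC(1)] fp[OF ABC(2)] fp[OF ABC(3)]
      sq[OF ABC(1) inv(1)] sq[OF ABC(2) inv(2)] sq[OF ABC(3) inv(3)] by blast
qed

end

section \<open>The projective unitary group\<close>

lemma smult_smult_mat: "a \<cdot>\<^sub>m (b \<cdot>\<^sub>m A) = (a * b) \<cdot>\<^sub>m (A :: 'a :: semigroup_mult mat)"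
  by (rule eq_matI) (auto simp: mult.assoc)

lemma smult_mult_mat_vec:
  fixes A :: "'a :: comm_ring_1 mat"
  assumes "A \<in> carrier_mat r n" "v \<in> carrier_vec n"
  shows "(k \<cdot>\<^sub>m A) *\<^sub>v v = k \<cdot>\<^sub>v (A *\<^sub>v v)"
  using assms by (intro eq_vecI) (auto simp: scalar_prod_def sum_distrib_left mult.assoc)

context lorentz_space
begin

text \<open>The assumptions say that \<open>A\<close> conjugates the reflection to \<open>\<kappa>\<close> times its inverse, on two vectors. Then \<open>y = A e0\<close> is an
  eigenvector with eigenvalue \<open>\<kappa>\<close>; comparing norms in \<open>(\<kappa> - 1) y = (\<i> - 1) \<langle>y, u\<rangle> u\<close>, whose two sides are
  multiples of a negative and of a positive vector, gives \<open>\<kappa> = 1\<close>. Hence \<open>A u\<close> would be an eigenvector for \<open>- \<i>\<close>.\<close>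

lemma quarter_turn_not_inverted:
  assumes u: "H u u = 1" "H e0 u = 0" and A: "isometry A"
    and conj: "crefl u \<i> (A (crefl u \<i> e0)) = \<kappa> *s A e0" "crefl u \<i> (A (crefl u \<i> u)) = \<kappa> *s A u"
  shows False
proof -
  have cr: "crefl u \<i> v = v + ((\<i> - 1) * H v u) *s u" for v by (simp add: crefl_def u)
  define y where "y = A e0"
  have yy: "H y y = H e0 e0" by (simp add: y_def isometry_H[OF A])
  have "crefl u \<i> y = \<kappa> *s y" using conj(1) u by (simp add: y_def crefl_orth)
  then have k: "(\<kappa> - 1) *s y = ((\<i> - 1) * H y u) *s u"
    by (simp add: cr scale_left_diff_distrib diff_eq_eq add.commute)
  have "H ((\<kappa> - 1) *s y) ((\<kappa> - 1) *s y) = ((\<kappa> - 1) * cnj (\<kappa> - 1)) * H y y"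
    by (simp add: H_scale_left H_scale_right)
  moreover have "H ((\<kappa> - 1) *s y) ((\<kappa> - 1) *s y) = ((\<i> - 1) * H y u) * cnj ((\<i> - 1) * H y u)"
    unfolding k by (simp add: H_scale_left H_scale_right u)
  ultimately have "of_real ((cmod (\<kappa> - 1))\<^sup>2) * H y y = of_real ((cmod ((\<i> - 1) * H y u))\<^sup>2)"
    by (simp only: complex_norm_square)
  then have "Re (of_real ((cmod (\<kappa> - 1))\<^sup>2) * H y y) = (cmod ((\<i> - 1) * H y u))\<^sup>2" by simp
  then have "(cmod (\<kappa> - 1))\<^sup>2 * Re (H e0 e0) = (cmod ((\<i> - 1) * H y u))\<^sup>2"
    by (simp only: yy Re_complex_of_real times_complex.sel Im_complex_of_real mult_zero_left diff_zero)
  moreover have "(cmod ((\<i> - 1) * H y u))\<^sup>2 \<ge> 0" by simp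
  ultimately have "(cmod (\<kappa> - 1))\<^sup>2 * Re (H e0 e0) \<ge> 0" by simp
  then have "\<kappa> = 1" using e0_negative by (simp add: zero_le_mult_iff)
  define z where "z = A u"
  have zz: "H z z = 1" using u by (simp add: z_def isometry_H[OF A])
  have "crefl u \<i> (\<i> *s z) = z"
    using conj(2) u \<open>\<kappa> = 1\<close> by (simp add: z_def crefl_self linear_op_scale[OF isometry_linear[OF A]])
  then have iz: "\<i> *s crefl u \<i> z = z" by (simp add: linear_op_scale[OF linear_op_crefl])
  have "H (crefl u \<i> z) u = \<i> * H z u" using H_crefl[of u \<i> z] u by simp
  then have "H (\<i> *s crefl u \<i> z) u = - H z u" by (simp add: H_scale_left)
  then have zu: "H z u = 0" using iz by simp
  then have "\<i> *s z = z" using iz by (simp add: crefl_orth)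
  then have "H (\<i> *s z) z = H z z" by simp
  then show False using zz by (simp add: H_scale_left complex_eq_iff)
qed

end

definition (in hermitian_vec_space) "U = unitary_group m H"

context hermitian_vec_space
begin

lemma invertible_mat_iff:
  assumes "A \<in> carrier_mat m m"
  shows "invertible_mat A \<longleftrightarrow> (\<exists>B \<in> carrier_mat m m. A * B = 1\<^sub>m m \<and> B * A = 1\<^sub>m m)"
proof
  assume "invertible_mat A"
  then obtain B where B: "A * B = 1\<^sub>m m" "B * A = 1\<^sub>m (dim_row B)"
    using assms by (auto simp: invertible_mat_def inverts_mat_def)
  have "dim_col (A * B) = m" "dim_col (B * A) = dim_row B" unfolding B by auto
  then have "B \<in> carrier_mat m m" using assms by auto
  with B show "\<exists>B \<in> carrier_mat m m. A * B = 1\<^sub>m m \<and> B * A = 1\<^sub>m m" by auto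
next
  assume "\<exists>B \<in> carrier_mat m m. A * B = 1\<^sub>m m \<and> B * A = 1\<^sub>m m"
  then show "invertible_mat A" using assms by (auto simp: invertible_mat_def inverts_mat_def square_mat.simps)
qed

lemma carrier_U: "A \<in> carrier U \<longleftrightarrow> form_preserving A \<and> (\<exists>B \<in> carrier_mat m m. A * B = 1\<^sub>m m \<and> B * A = 1\<^sub>m m)"
  unfolding U_def unitary_group_def form_preserving_def using invertible_mat_iff by auto

lemma U_mult: "A \<otimes>\<^bsub>U\<^esub> B = A * B" and U_one: "\<one>\<^bsub>U\<^esub> = 1\<^sub>m m"
  by (simp_all add: U_def unitary_group_def)

lemma U_carrier_mat: "A \<in> carrier U \<Longrightarrow> A \<in> carrier_mat m m"
  by (simp add: carrier_U form_preserving_def)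

lemma form_preserving_mult:
  assumes "form_preserving A" "form_preserving B" shows "form_preserving (A * B)"
proof -
  have c: "A \<in> carrier_mat m m" "B \<in> carrier_mat m m" using assms by (auto simp: form_preserving_def)
  have "H ((A * B) *\<^sub>v u) ((A * B) *\<^sub>v v) = H u v" if "u \<in> carrier_vec m" "v \<in> carrier_vec m" for u v
  proof -
    have "(A * B) *\<^sub>v w = A *\<^sub>v (B *\<^sub>v w)" "B *\<^sub>v w \<in> carrier_vec m" if "w \<in> carrier_vec m" for w
      using c that by (auto simp: assoc_mult_mat_vec[of _ m m _ m])
    then show ?thesis using that assms by (simp add: form_preserving_def)
  qed
  then show ?thesis using c by (simp add: form_preserving_def)
qed

lemma form_preserving_one: "form_preserving (1\<^sub>m m)"
  by (simp add: form_preserving_def)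

lemma form_preservingD:
  "form_preserving A \<Longrightarrow> u \<in> carrier_vec m \<Longrightarrow> v \<in> carrier_vec m \<Longrightarrow> H (A *\<^sub>v u) (A *\<^sub>v v) = H u v"
  by (simp add: form_preserving_def)

lemma form_preserving_inverse:
  assumes "form_preserving A" "B \<in> carrier_mat m m" "A * B = 1\<^sub>m m"
  shows "form_preserving B"
proof -
  have c: "A \<in> carrier_mat m m" using assms by (auto simp: form_preserving_def)
  have k: "A *\<^sub>v (B *\<^sub>v w) = w" "B *\<^sub>v w \<in> carrier_vec m" if "w \<in> carrier_vec m" for w
    using c assms(2,3) that by (auto simp flip: assoc_mult_mat_vec[of _ m m _ m])
  have "H (B *\<^sub>v u) (B *\<^sub>v v) = H u v" if "u \<in> carrier_vec m" "v \<in> carrier_vec m" for u v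
  proof -
    have "H (B *\<^sub>v u) (B *\<^sub>v v) = H (A *\<^sub>v (B *\<^sub>v u)) (A *\<^sub>v (B *\<^sub>v v))"
      by (rule form_preservingD[OF assms(1) k(2)[OF that(1)] k(2)[OF that(2)], symmetric])
    then show ?thesis using k that by simp
  qed
  then show ?thesis using assms(2) by (simp add: form_preserving_def)
qed

lemma group_U: "group U"
proof (rule groupI)
  fix x y z assume x: "x \<in> carrier U" and y: "y \<in> carrier U"
  obtain x' y' where x': "x' \<in> carrier_mat m m" "x * x' = 1\<^sub>m m" "x' * x = 1\<^sub>m m"
    and y': "y' \<in> carrier_mat m m" "y * y' = 1\<^sub>m m" "y' * y = 1\<^sub>m m"
    using x y by (auto simp: carrier_U)
  note c = U_carrier_mat[OF x] U_carrier_mat[OF y] x'(1) y'(1)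
  have "(x * y) * (y' * x') = x * ((y * y') * x')" "(y' * x') * (x * y) = y' * ((x' * x) * y)"
    using c by (simp_all add: assoc_mult_mat[of _ m m _ m _ m])
  then have "(x * y) * (y' * x') = 1\<^sub>m m" "(y' * x') * (x * y) = 1\<^sub>m m"
    using c x' y' by simp_all
  moreover have "y' * x' \<in> carrier_mat m m" using c by simp
  ultimately show "x \<otimes>\<^bsub>U\<^esub> y \<in> carrier U"
    using x y form_preserving_mult unfolding U_mult carrier_U by blast
  show "\<exists>y\<in>carrier U. y \<otimes>\<^bsub>U\<^esub> x = \<one>\<^bsub>U\<^esub>"
    using x x' U_carrier_mat[OF x] form_preserving_inverse[of x x'] unfolding U_mult U_one
    by (intro bexI[of _ x']) (auto simp: carrier_U)
  show "\<one>\<^bsub>U\<^esub> \<otimes>\<^bsub>U\<^esub> x = x" using U_carrier_mat[OF x] by (simp add: U_mult U_one)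
  assume z: "z \<in> carrier U"
  show "x \<otimes>\<^bsub>U\<^esub> y \<otimes>\<^bsub>U\<^esub> z = x \<otimes>\<^bsub>U\<^esub> (y \<otimes>\<^bsub>U\<^esub> z)"
    using c U_carrier_mat[OF z] by (simp add: U_mult assoc_mult_mat[of _ m m _ m _ m])
next
  show "\<one>\<^bsub>U\<^esub> \<in> carrier U" unfolding U_one carrier_U
    using form_preserving_one by (auto intro!: bexI[of _ "1\<^sub>m m"])
qed

lemma unit_scalars_eq: "unit_scalars m = {c \<cdot>\<^sub>m 1\<^sub>m m | c. cmod c = 1}"
proof -
  have "\<exists>\<theta>. c = exp (\<i> * of_real \<theta>)" if "cmod c = 1" for c
    proof -
    have "c \<noteq> 0" using that by auto
    then have "c = cis (Arg c)" using cis_Arg[of c] that by (simp add: sgn_eq)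
    then show ?thesis unfolding cis_conv_exp by blast
  qed
  moreover have "cmod (exp (\<i> * of_real \<theta>)) = 1" for \<theta> :: real by simp
  ultimately show ?thesis unfolding unit_scalars_def by blast
qed

lemma mult_carrier [simp]:
  "A \<in> carrier_mat m m \<Longrightarrow> B \<in> carrier_mat m m \<Longrightarrow> A * B \<in> carrier_mat m m"
  for A B :: "complex mat"
  by (rule mult_carrier_mat)

lemma smult_left: "A \<in> carrier_mat m m \<Longrightarrow> B \<in> carrier_mat m m \<Longrightarrow> (c \<cdot>\<^sub>m A) * B = c \<cdot>\<^sub>m (A * B)"
  for A B :: "complex mat"
  by (rule mult_smult_assoc_mat)

lemma smult_right: "A \<in> carrier_mat m m \<Longrightarrow> B \<in> carrier_mat m m \<Longrightarrow> A * (c \<cdot>\<^sub>m B) = c \<cdot>\<^sub>m (A * B)"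
  for A B :: "complex mat"
  by (rule mult_smult_distrib)

lemma smult_mult:
  "A \<in> carrier_mat m m \<Longrightarrow> B \<in> carrier_mat m m \<Longrightarrow> (c \<cdot>\<^sub>m A) * (d \<cdot>\<^sub>m B) = (c * d) \<cdot>\<^sub>m (A * B)"
  for A B :: "complex mat"
  by (simp add: smult_left smult_right smult_smult_mat mult.commute)

lemma scalar_mult:
  fixes A :: "complex mat"
  assumes "A \<in> carrier_mat m m"
  shows "(c \<cdot>\<^sub>m 1\<^sub>m m) * A = c \<cdot>\<^sub>m A" "A * (c \<cdot>\<^sub>m 1\<^sub>m m) = c \<cdot>\<^sub>m A"
  using assms by (simp_all add: smult_left smult_right)

lemma scalar_in_U: "cmod c = 1 \<Longrightarrow> c \<cdot>\<^sub>m 1\<^sub>m m \<in> carrier U"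
proof -
  assume "cmod c = 1"
  then have c: "c * cnj c = 1" by (simp flip: complex_norm_square)
  have "H ((c \<cdot>\<^sub>m 1\<^sub>m m) *\<^sub>v u) ((c \<cdot>\<^sub>m 1\<^sub>m m) *\<^sub>v v) = H u v" if uv: "u \<in> carrier_vec m" "v \<in> carrier_vec m" for u v
  proof -
    have k: "(c \<cdot>\<^sub>m 1\<^sub>m m) *\<^sub>v w = vec m (fscale c (fun_of_vec w))" if "w \<in> carrier_vec m" for w
      using that by (simp add: vec_fscale smult_mult_mat_vec[of _ m m])
    have "H ((c \<cdot>\<^sub>m 1\<^sub>m m) *\<^sub>v u) ((c \<cdot>\<^sub>m 1\<^sub>m m) *\<^sub>v v) = c * cnj c * fform m H (fun_of_vec u) (fun_of_vec v)"
      unfolding k[OF uv(1)] k[OF uv(2)] using H_scale_left H_scale_right by (simp add: fform_def mult.assoc)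
    then show ?thesis using c uv by (simp add: fform_def)
  qed
  then have "form_preserving (c \<cdot>\<^sub>m 1\<^sub>m m)" by (simp add: form_preserving_def)
  moreover have "(c \<cdot>\<^sub>m 1\<^sub>m m) * (cnj c \<cdot>\<^sub>m 1\<^sub>m m) = 1\<^sub>m m" "(cnj c \<cdot>\<^sub>m 1\<^sub>m m) * (c \<cdot>\<^sub>m 1\<^sub>m m) = 1\<^sub>m m"
    using c by (auto simp: smult_mult mult.commute intro!: eq_matI)
  ultimately show ?thesis unfolding carrier_U by (auto intro!: bexI[of _ "cnj c \<cdot>\<^sub>m 1\<^sub>m m"])
qed

lemma normal_unit_scalars: "unit_scalars m \<lhd> U"
proof -
  interpret U: group U by (rule group_U)
  have sg: "subgroup (unit_scalars m) U"
  proof (rule U.subgroupI)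
    show "unit_scalars m \<subseteq> carrier U" using scalar_in_U by (auto simp: unit_scalars_eq)
    show "unit_scalars m \<noteq> {}" by (auto simp: unit_scalars_def)
    fix a assume "a \<in> unit_scalars m"
    then obtain c where c: "cmod c = 1" "a = c \<cdot>\<^sub>m 1\<^sub>m m" by (auto simp: unit_scalars_eq)
    have cc: "cnj c * c = 1" using c by (simp add: mult.commute flip: complex_norm_square)
    have "inv\<^bsub>U\<^esub> a = cnj c \<cdot>\<^sub>m 1\<^sub>m m"
      by (rule U.inv_equality) (use c cc in \<open>auto simp: U_mult U_one smult_mult scalar_in_U intro!: eq_matI\<close>)
    then show "inv\<^bsub>U\<^esub> a \<in> unit_scalars m" using c by (auto simp: unit_scalars_eq)
    fix b assume "b \<in> unit_scalars m"
    then obtain d where "cmod d = 1" "b = d \<cdot>\<^sub>m 1\<^sub>m m" by (auto simp: unit_scalars_eq)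
    then show "a \<otimes>\<^bsub>U\<^esub> b \<in> unit_scalars m" using c
      by (auto simp: unit_scalars_eq U_mult smult_mult norm_mult intro!: exI[of _ "c * d"])
  qed
  show ?thesis unfolding U.normal_inv_iff
  proof (intro conjI ballI)
    fix x h assume x: "x \<in> carrier U" and h: "h \<in> unit_scalars m"
    then obtain c where c: "h = c \<cdot>\<^sub>m 1\<^sub>m m" by (auto simp: unit_scalars_eq)
    have hU: "h \<in> carrier U" using sg h subgroup.mem_carrier by fast
    have "x \<otimes>\<^bsub>U\<^esub> h = h \<otimes>\<^bsub>U\<^esub> x" using U_carrier_mat[OF x] by (simp add: c U_mult scalar_mult)
    then have "x \<otimes>\<^bsub>U\<^esub> h \<otimes>\<^bsub>U\<^esub> inv\<^bsub>U\<^esub> x = h" using x hU by (simp add: U.m_assoc)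
    then show "x \<otimes>\<^bsub>U\<^esub> h \<otimes>\<^bsub>U\<^esub> inv\<^bsub>U\<^esub> x \<in> unit_scalars m" using h by simp
  qed (rule sg)
qed

definition "PU = proj_unitary_group m H"

definition proj :: "complex mat \<Rightarrow> complex mat set" where
  "proj A = unit_scalars m #>\<^bsub>U\<^esub> A"

lemma PU_eq: "PU = U Mod unit_scalars m"
  by (simp add: PU_def proj_unitary_group_def U_def)

lemma group_PU: "group PU"
  unfolding PU_eq by (rule normal.factorgroup_is_group[OF normal_unit_scalars])

lemma carrier_PU: "carrier PU = proj ` carrier U"
  by (auto simp: PU_eq FactGroup_def RCOSETS_def proj_def)

lemma proj_mult: "A \<in> carrier U \<Longrightarrow> B \<in> carrier U \<Longrightarrow> proj A \<otimes>\<^bsub>PU\<^esub> proj B = proj (A * B)"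
  using normal.rcos_sum[OF normal_unit_scalars, of A B] by (simp add: PU_eq FactGroup_def proj_def U_mult)

lemma proj_alt: "A \<in> carrier U \<Longrightarrow> proj A = {c \<cdot>\<^sub>m A | c. cmod c = 1}"
  using scalar_mult(1)[OF U_carrier_mat]
  by (auto simp: proj_def r_coset_def unit_scalars_eq U_mult)

lemma proj_one: "proj (1\<^sub>m m) = \<one>\<^bsub>PU\<^esub>"
proof -
  have "1\<^sub>m m \<in> carrier U" using group.is_monoid[OF group_U, THEN monoid.one_closed] by (simp add: U_one)
  then show ?thesis by (simp add: proj_alt PU_eq FactGroup_def unit_scalars_eq)
qed

lemma proj_eqD:
  assumes "A \<in> carrier U" "B \<in> carrier U" "proj A = proj B"
  shows "\<exists>c. cmod c = 1 \<and> A = c \<cdot>\<^sub>m B"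
proof -
  have "A = 1 \<cdot>\<^sub>m A" by auto
  then have "A \<in> proj A" unfolding proj_alt[OF assms(1)] by (metis (mono_tags, lifting) mem_Collect_eq norm_one)
  then have "A \<in> {c \<cdot>\<^sub>m B | c. cmod c = 1}" using assms(3) proj_alt[OF assms(2)] by simp
  then show ?thesis by blast
qed

lemma proj_scale:
  assumes "A \<in> carrier U" "B \<in> carrier U" "cmod c = 1" "A = c \<cdot>\<^sub>m B"
  shows "proj A = proj B"
proof -
  have "\<exists>d'. d \<cdot>\<^sub>m A = d' \<cdot>\<^sub>m B \<and> cmod d' = 1" if "cmod d = 1" for d
    using assms that by (intro exI[of _ "d * c"]) (auto simp: norm_mult smult_smult_mat)
  moreover have "\<exists>d'. d \<cdot>\<^sub>m B = d' \<cdot>\<^sub>m A \<and> cmod d' = 1" if "cmod d = 1" for d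
  proof -
    have "cnj c * c = 1" using assms(3) by (simp add: mult.commute flip: complex_norm_square)
    then show ?thesis using assms that
      by (intro exI[of _ "d * cnj c"]) (auto simp: norm_mult smult_smult_mat mult.assoc)
  qed
  ultimately show ?thesis unfolding proj_alt[OF assms(1)] proj_alt[OF assms(2)] by blast
qed

end

lemma (in monoid) pow_two: "x \<in> carrier G \<Longrightarrow> x [^] (2::nat) = x \<otimes> x"
  by (simp add: numeral_2_eq_2)

text \<open>Factors equal to the identity are no involutions and have to be dropped.\<close>

lemma (in group) involution_length_le:
  assumes "set xs \<subseteq> carrier G" "\<And>x. x \<in> set xs \<Longrightarrow> x \<otimes> x = \<one>"
  shows "involution_length G (foldr (\<otimes>) xs \<one>) \<le> enat (length xs)"
proof -
  define ys where "ys = filter (\<lambda>x. x \<noteq> \<one>) xs"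
  have cl: "foldr (\<otimes>) zs \<one> \<in> carrier G" if "set zs \<subseteq> carrier G" for zs
    using that by (induction zs) auto
  have "foldr (\<otimes>) xs \<one> = foldr (\<otimes>) (filter (\<lambda>x. x \<noteq> \<one>) xs) \<one>"
    using assms(1)
  proof (induction xs)
    case (Cons x xs)
    then have "foldr (\<otimes>) xs \<one> \<in> carrier G" using cl[of xs] by auto
    then show ?case using Cons by auto
  qed simp
  moreover have "set ys \<subseteq> involutions G"
    using assms by (auto simp: ys_def involutions_def pow_two)
  ultimately have "enat (length ys) \<in> {enat (length Is) | Is. set Is \<subseteq> involutions G \<and> foldr (\<otimes>) xs \<one> = foldr (\<otimes>) Is \<one>}"
    unfolding ys_def by blast
  then have "involution_length G (foldr (\<otimes>) xs \<one>) \<le> enat (length ys)"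
    unfolding involution_length_def by (rule Inf_lower)
  also have "\<dots> \<le> enat (length xs)" by (simp add: ys_def)
  finally show ?thesis .
qed

text \<open>Shorter products of involutions are padded with the identity to length two.\<close>

lemma (in group) involution_length_ge_3:
  assumes h: "\<And>x y. x \<in> carrier G \<Longrightarrow> y \<in> carrier G \<Longrightarrow> x \<otimes> x = \<one> \<Longrightarrow> y \<otimes> y = \<one> \<Longrightarrow> h \<noteq> x \<otimes> y"
  shows "involution_length G h \<ge> 3"
  unfolding involution_length_def
proof (rule Inf_greatest, safe)
  fix Is assume Is: "set Is \<subseteq> involutions G" "h = foldr (\<otimes>) Is \<one>"
  have inv: "x \<in> carrier G \<and> x \<otimes> x = \<one>" if "x \<in> set Is" for x
    using that Is by (auto simp: involutions_def simp flip: pow_two)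
  have "\<not> length Is \<le> 2"
  proof
    assume "length Is \<le> 2"
    then consider "Is = []" | x where "Is = [x]" | x y where "Is = [x, y]"
      by (auto simp: numeral_2_eq_2 le_Suc_eq length_Suc_conv)
    then show False
    proof cases
      case 1 then show False using h[of \<one> \<one>] Is by simp
    next
      case (2 x) then show False using h[of x \<one>] Is inv by simp
    next
      case (3 x y) then show False using h[of x y] Is inv by simp
    qed
  qed
  then have "3 \<le> length Is" by simp
  then show "3 \<le> enat (length Is)" by (metis enat_ord_simps(1) numeral_eq_enat)
qed

context hermitian_vec_space
begin

lemma exists_root_of_length_3:
  assumes m: "m \<ge> 3" and nd: "nondegenerate_form m H" and sig: "has_signature m H n 1" "n > 0"
    and g: "g \<in> carrier PU"
  shows "\<exists>h\<in>carrier PU. h [^]\<^bsub>PU\<^esub> (2::nat) = g \<and> involution_length PU h \<le> 3"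
proof -
  interpret P: group PU by (rule group_PU)
  interpret UG: group U by (rule group_U)
  obtain G where G: "G \<in> carrier U" "g = proj G" using g by (auto simp: carrier_PU)
  then obtain c A B C where c: "cmod c = 1" and ABC: "form_preserving A" "form_preserving B" "form_preserving C"
    and inv: "A * A = 1\<^sub>m m" "B * B = 1\<^sub>m m" "C * C = 1\<^sub>m m"
    and root: "(A * (B * C)) * (A * (B * C)) = c \<cdot>\<^sub>m G"
    using matrix_three_involution_root[OF m nd sig, of G] by (auto simp: carrier_U)
  have U: "A \<in> carrier U" "B \<in> carrier U" "C \<in> carrier U"
    using ABC inv by (auto simp: carrier_U form_preserving_def)
  have BC: "B * C \<in> carrier U" "A * (B * C) \<in> carrier U"
    using UG.m_closed U unfolding U_mult by blast+
  define h where "h = proj (A * (B * C))"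
  have hP: "h \<in> carrier PU" using BC by (auto simp: h_def carrier_PU)
  have "h [^]\<^bsub>PU\<^esub> (2::nat) = proj ((A * (B * C)) * (A * (B * C)))"
    using hP BC by (simp add: P.pow_two proj_mult h_def)
  also have "\<dots> = g" unfolding G(2)
    by (rule proj_scale[OF _ G(1) c root]) (use UG.m_closed[OF BC(2,2)] in \<open>simp add: U_mult\<close>)
  finally have sq: "h [^]\<^bsub>PU\<^esub> (2::nat) = g" .
  have cP: "proj A \<in> carrier PU" "proj B \<in> carrier PU" "proj C \<in> carrier PU" using U by (auto simp: carrier_PU)
  have "involution_length PU (foldr (\<otimes>\<^bsub>PU\<^esub>) [proj A, proj B, proj C] \<one>\<^bsub>PU\<^esub>) \<le> enat (length [proj A, proj B, proj C])"
    by (rule P.involution_length_le) (use cP U inv in \<open>auto simp: proj_mult proj_one\<close>)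
  moreover have "foldr (\<otimes>\<^bsub>PU\<^esub>) [proj A, proj B, proj C] \<one>\<^bsub>PU\<^esub> = h"
    using cP U BC by (simp add: proj_mult h_def)
  ultimately have "involution_length PU h \<le> 3" by (simp add: numeral_eq_enat numeral_3_eq_3)
  then show ?thesis using hP sq by blast
qed

text \<open>The witness is the class of a complex reflection \<open>G\<close> of order 4 in a unit vector. If \<open>G = \<delta> (A B)^2\<close> and \<open>A^2\<close>, \<open>B^2\<close>
  are scalars, then \<open>G A G\<close> collapses to a multiple of \<open>A\<close>.\<close>

lemma exists_element_without_short_root:
  assumes nd: "nondegenerate_form m H" and sig: "has_signature m H n 1" "n > 0"
  shows "\<exists>g\<in>carrier PU. \<forall>h\<in>carrier PU. h [^]\<^bsub>PU\<^esub> (2::nat) = g \<longrightarrow> involution_length PU h \<ge> 3"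
proof -
  interpret P: group PU by (rule group_PU)
  interpret UG: group U by (rule group_U)
  obtain e p where e: "e \<in> fspace m" "Re (fform m H e e) < 0"
    and p: "p \<in> fspace m" "Re (fform m H p p) > 0" "fform m H e p = 0"
    and pos: "\<And>u. u \<in> fspace m \<Longrightarrow> fform m H u e = 0 \<Longrightarrow> u \<noteq> 0 \<Longrightarrow> Re (fform m H u u) > 0"
    using signature_vectors[OF nd sig] by blast
  interpret L: lorentz_space_det fscale "fform m H" "fspace m" e "\<lambda>T. det (mat_of_op m T)" m
    by (rule lorentz_space_det_det[OF nd e pos])
  obtain k where k: "fform m H (fscale k p) (fscale k p) = 1" using L.unit_multiple[OF p(2)] by blast
  define u where "u = fscale k p"
  have u: "u \<in> fspace m" "fform m H u u = 1" "fform m H e u = 0"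
    using k p L.V_closed(2) by (auto simp: u_def H_scale_right)
  define T where "T = crefl u \<i>"
  define T' where "T' = crefl u (- \<i>)"
  have T: "L.unitary T" "L.unitary T'" unfolding T_def T'_def using u by (auto intro!: L.unitary_crefl)
  have TT: "T \<circ> T' = id" "T' \<circ> T = id" using u by (auto simp: T_def T'_def fun_eq_iff crefl_crefl crefl_one)
  have mo: "mat_of_op m (S \<circ> T) = mat_of_op m S * mat_of_op m T" if "L.unitary S" "L.unitary T" for S T
    using that by (intro mat_of_op_comp) (auto simp: L.unitary_linear L.unitary_preserves)
  define G where "G = mat_of_op m T"
  have "form_preserving G" unfolding G_def
    using T by (intro mat_of_op_form_preserving) (auto simp: L.unitary_isometry L.unitary_preserves)
  moreover have "G * mat_of_op m T' = 1\<^sub>m m" "mat_of_op m T' * G = 1\<^sub>m m"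
    using TT mo[OF T] mo[OF T(2,1)] by (simp_all add: G_def mat_of_op_id)
  ultimately have G: "G \<in> carrier U" unfolding carrier_U by (auto intro!: bexI[of _ "mat_of_op m T'"])
  have Gv: "G *\<^sub>v vec m v = vec m (T v)" if "v \<in> fspace m" for v
    unfolding G_def using T that by (intro vec_op_eq_mult[symmetric]) (auto simp: L.unitary_linear L.unitary_preserves)
  have "involution_length PU h \<ge> 3" if h: "h \<in> carrier PU" "h [^]\<^bsub>PU\<^esub> (2::nat) = proj G" for h
  proof (rule P.involution_length_ge_3, rule notI)
    fix x y assume x: "x \<in> carrier PU" "x \<otimes>\<^bsub>PU\<^esub> x = \<one>\<^bsub>PU\<^esub>" and y: "y \<in> carrier PU" "y \<otimes>\<^bsub>PU\<^esub> y = \<one>\<^bsub>PU\<^esub>"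
      and hxy: "h = x \<otimes>\<^bsub>PU\<^esub> y"
    obtain A B where A: "A \<in> carrier U" "x = proj A" and B: "B \<in> carrier U" "y = proj B"
      using x y by (auto simp: carrier_PU)
    note c = U_carrier_mat[OF A(1)] U_carrier_mat[OF B(1)] U_carrier_mat[OF G]
    have one: "1\<^sub>m m \<in> carrier U" using UG.one_closed by (simp add: U_one)
    have AA: "A * A \<in> carrier U" "B * B \<in> carrier U" "A * B \<in> carrier U"
      using UG.m_closed A B unfolding U_mult by blast+
    then have AB2: "(A * B) * (A * B) \<in> carrier U" using UG.m_closed unfolding U_mult by blast
    have "proj (A * A) = proj (1\<^sub>m m)" "proj (B * B) = proj (1\<^sub>m m)"
      using x y A B by (simp_all add: proj_mult proj_one)
    then obtain \<alpha> \<beta> where ab: "A * A = \<alpha> \<cdot>\<^sub>m 1\<^sub>m m" "B * B = \<beta> \<cdot>\<^sub>m 1\<^sub>m m"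
      using proj_eqD[OF AA(1) one] proj_eqD[OF AA(2) one] by blast
    have "proj G = proj ((A * B) * (A * B))"
      using h hxy A B AA by (simp add: P.pow_two proj_mult)
    then obtain \<delta> where G_eq: "G = \<delta> \<cdot>\<^sub>m ((A * B) * (A * B))" using proj_eqD[OF G AB2] by blast
    have "((A * B) * (A * B)) * (A * ((A * B) * (A * B))) = (A * B * A) * (B * ((A * A) * (B * (A * B))))"
      using c by (simp add: assoc_mult_mat[of _ m m _ m _ m])
    also have "\<dots> = \<alpha> \<cdot>\<^sub>m ((A * B * A) * ((B * B) * (A * B)))"
      unfolding ab(1) using c by (simp add: smult_left smult_right assoc_mult_mat[of _ m m _ m _ m])
    also have "\<dots> = (\<alpha> * \<beta>) \<cdot>\<^sub>m ((A * B) * ((A * A) * B))"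
      unfolding ab(2) using c by (simp add: smult_left smult_right assoc_mult_mat[of _ m m _ m _ m] smult_smult_mat)
    also have "\<dots> = (\<alpha> * \<beta> * \<alpha>) \<cdot>\<^sub>m (A * (B * B))"
      unfolding ab(1) using c by (simp add: smult_left smult_right assoc_mult_mat[of _ m m _ m _ m] smult_smult_mat)
    also have "\<dots> = (\<alpha> * \<beta> * \<alpha> * \<beta>) \<cdot>\<^sub>m A"
      unfolding ab(2) using c by (simp add: smult_left smult_right smult_smult_mat)
    finally have key: "((A * B) * (A * B)) * (A * ((A * B) * (A * B))) = (\<alpha> * \<beta> * \<alpha> * \<beta>) \<cdot>\<^sub>m A" .
    define \<kappa> where "\<kappa> = \<delta> * \<delta> * (\<alpha> * \<beta> * \<alpha> * \<beta>)"
    have GAG: "G * (A * G) = \<kappa> \<cdot>\<^sub>m A"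
    proof -
      define W where "W = (A * B) * (A * B)"
      have W: "W \<in> carrier_mat m m" using c by (simp add: W_def)
      have "G * (A * G) = (\<delta> * \<delta>) \<cdot>\<^sub>m (W * (A * W))"
        unfolding G_eq W_def[symmetric] using c W
        by (simp add: smult_left smult_right smult_smult_mat)
      then show ?thesis unfolding W_def key by (simp add: \<kappa>_def smult_smult_mat)
    qed
    have fA: "form_preserving A" using A by (simp add: carrier_U)
    define a where "a = op_of_mat A"
    note a = op_of_mat_isometry[OF fA, folded a_def]
    have conj: "T (a (T v)) = fscale \<kappa> (a v)" if v: "v \<in> fspace m" for v
    proof -
      have TV: "T v \<in> fspace m" if "v \<in> fspace m" for v using T that by (auto simp: L.unitary_preserves)
      have "vec m (T (a (T v))) = G *\<^sub>v (A *\<^sub>v (G *\<^sub>v vec m v))"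
        using v TV a(2) by (simp add: Gv flip: a(3))
      also have "\<dots> = (G * (A * G)) *\<^sub>v vec m v"
        using c by (simp add: assoc_mult_mat_vec[of _ m m _ m])
      also have "\<dots> = \<kappa> \<cdot>\<^sub>v (A *\<^sub>v vec m v)" unfolding GAG using c by (simp add: smult_mult_mat_vec[of _ m m])
      also have "\<dots> = vec m (fscale \<kappa> (a v))" by (simp add: vec_fscale a(3))
      finally have "fun_of_vec (vec m (T (a (T v)))) = fun_of_vec (vec m (fscale \<kappa> (a v)))" by simp
      then show ?thesis using TV v a(2) L.V_closed(2) by (simp add: fun_of_vec_vec)
    qed
    show False
      using L.quarter_turn_not_inverted[OF u(2,3) a(1), of \<kappa>] conj[OF e(1)] conj[OF u(1)] by (simp add: T_def)
  qed
  then show ?thesis using G by (auto simp: carrier_PU)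
qed

end

theorem theorem1p2:
  fixes n :: nat and H :: "complex vec \<Rightarrow> complex vec \<Rightarrow> complex"
  assumes "n \<ge> 2"
    and "hermitian_form (n + 1) H"
    and "nondegenerate_form (n + 1) H"
    and "has_signature (n + 1) H n 1"
  shows "let PU = proj_unitary_group (n + 1) H in
         (\<forall>g \<in> carrier PU. \<exists>h \<in> carrier PU.
            h [^]\<^bsub>PU\<^esub> (2::nat) = g \<and> involution_length PU h \<le> 3) \<and>
         (SUP g \<in> carrier PU. INF h \<in> {h \<in> carrier PU. h [^]\<^bsub>PU\<^esub> (2::nat) = g}.
            involution_length PU h) = 3"
proof -
  interpret hermitian_vec_space "n + 1" H by unfold_locales (rule assms(2))
  have m: "n + 1 \<ge> 3" "n > 0" using assms(1) by auto
  have upper: "\<exists>h\<in>carrier PU. h [^]\<^bsub>PU\<^esub> (2::nat) = g \<and> involution_length PU h \<le> 3" if "g \<in> carrier PU" for g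
    by (rule exists_root_of_length_3[OF m(1) assms(3,4) m(2) that])
  have "(SUP g \<in> carrier PU. INF h \<in> {h \<in> carrier PU. h [^]\<^bsub>PU\<^esub> (2::nat) = g}. involution_length PU h) = 3"
  proof (rule antisym)
    show "(SUP g \<in> carrier PU. INF h \<in> {h \<in> carrier PU. h [^]\<^bsub>PU\<^esub> (2::nat) = g}. involution_length PU h) \<le> 3"
    proof (rule SUP_least)
      fix g assume "g \<in> carrier PU"
      then obtain h where h: "h \<in> carrier PU" "h [^]\<^bsub>PU\<^esub> (2::nat) = g" "involution_length PU h \<le> 3"
        using upper by blast
      then show "(INF h \<in> {h \<in> carrier PU. h [^]\<^bsub>PU\<^esub> (2::nat) = g}. involution_length PU h) \<le> 3"
        by (intro INF_lower2[of h]) auto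
    qed
    obtain g where g: "g \<in> carrier PU"
      "\<And>h. h \<in> carrier PU \<Longrightarrow> h [^]\<^bsub>PU\<^esub> (2::nat) = g \<Longrightarrow> involution_length PU h \<ge> 3"
      using exists_element_without_short_root[OF assms(3,4) m(2)] by blast
    have "3 \<le> (INF h \<in> {h \<in> carrier PU. h [^]\<^bsub>PU\<^esub> (2::nat) = g}. involution_length PU h)"
      by (rule INF_greatest) (use g in auto)
    then show "3 \<le> (SUP g \<in> carrier PU. INF h \<in> {h \<in> carrier PU. h [^]\<^bsub>PU\<^esub> (2::nat) = g}. involution_length PU h)"
      by (rule SUP_upper2[OF g(1)])
  qed
  then show ?thesis using upper unfolding Let_def PU_def by blast
qed

end
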